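(* Let $(M_1^{n_1},g_1)$ be a Riemannian manifold, $(M_2^{n_2},F_2)$ a weakly Berwald Finsler manifold with positive scalar curvature, $n_1,n_2\ge2$, and $f$ a positive smooth function on $M_1$, such that the Finsler warped product $M=M_1\times_f M_2$ is Einstein with positive scalar curvature. Suppose that any one of the following conditions holds: (a) there exists a point $\tilde x_2\in M_2$ such that $\|\nabla f(x_1)\|\ge\sqrt{\frac{\operatorname{Scal}_{M_2}(\tilde x_2)}{n_2(n_2-1)}}$ for every $x_1\in M_1$; (b) $\operatorname{Scal}_M\le\operatorname{Scal}_{M_1}$; (c) $\operatorname{Scal}_M-\operatorname{Scal}_{M_2}\ge\operatorname{Scal}_{M_1}$ and $\frac{\operatorname{Scal}_{M_2}(x_2)}{\operatorname{Scal}_M(x_1,x_2)}\ge\frac{n_2}{n_1+n_2}$ for all $(x_1,x_2)\in M_1\times M_2$; (d) $\operatorname{Scal}_M-\frac{\operatorname{Scal}_{M_2}}{f^2}\ge\operatorname{Scal}_{M_1}$; (e) $\operatorname{Scal}_{M_1}\le0$; (f) $\operatorname{Scal}_{M_1}\ge\frac{n_1\operatorname{Scal}_{M_2}(x_2)}{n_2f^2(x_1)}$. Then the warping function $f$ is either subharmonic or superharmonic on $M_1$. Consequently, if the base $M_1$ is compact, or if $f$ attains either its maximum or its minimum, then $f$ is constant; in this case $M$ is a weakly Berwald Finsler manifold which is simply a Riemannian product of two Finsler manifolds.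
   Context: Manifolds are connected. Inequalities between functions of $x_1\in M_1$, $x_2\in M_2$ are understood at all points $(x_1,x_2)\in M_1\times M_2$. A Finsler metric on a smooth manifold $M$ is a continuous $F:TM\to[0,\infty)$, smooth on $TM^0=TM\setminus\{0\}$, positively 1-homogeneous on fibers, with $g_{ij}=\frac12\frac{\partial^2F^2}{\partial y^i\partial y^j}$ positive definite on $TM^0$. Spray coefficients: $G^i=\frac14 g^{i\ell}\{[F^2]_{x^ky^\ell}y^k-[F^2]_{x^\ell}\}$. $(M,F)$ is weakly Berwald if $E_{ij}=\frac12\frac{\partial^2}{\partial y^i\partial y^j}\big(\frac{\partial G^s}{\partial y^s}\big)$ vanishes identically. Riemann curvature: $R^i_k=2\frac{\partial G^i}{\partial x^k}-y^j\frac{\partial^2G^i}{\partial x^j\partial y^k}+2G^j\frac{\partial^2G^i}{\partial y^j\partial y^k}-\frac{\partial G^i}{\partial y^j}\frac{\partial G^j}{\partial y^k}$; Ricci curvature: $\operatorname{Ric}=\sum_i R^i_i$, and $\operatorname{Ric}_{ij}=\frac12\frac{\partial^2\operatorname{Ric}}{\partial y^i\partial y^j}$. $(M,F)$ is Einstein with Ricci scalar $\lambda$ if $\operatorname{Ric}(x,y)=\lambda(x)F^2(x,y)$, i.e. $\operatorname{Ric}_{ij}=\lambda g_{ij}$, for a function $\lambda=\lambda(x)$ on $M$. The scalar curvature is $\operatorname{Scal}=g^{ij}\operatorname{Ric}_{ij}$; thus $\operatorname{Scal}_M=(n_1+n_2)\lambda$, a function on $M$. The Finsler warped product $M=M_1\times_f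 M_2$ of a base $(M_1,F_1)$ and fiber $(M_2,F_2)$ with warping function $f>0$ smooth on $M_1$ is $M_1\times M_2$ with $F^2(x_1,y_1,x_2,y_2)=F_1^2(x_1,y_1)+f^2(x_1)F_2^2(x_2,y_2)$ on $TM_1^0\times TM_2^0$, with geometric quantities computed there. If $f$ is constant it is called a Riemannian product of two Finsler manifolds. When the base is Riemannian, the fiber weakly Berwald and $M$ Einstein, the fiber is Einstein, $\operatorname{Ric}^{M_2}_{\alpha\beta}=\mu g_{\alpha\beta}$, and $\operatorname{Scal}_{M_2}=n_2\mu$ is a function on $M_2$. With $\Delta f=-\operatorname{tr}_{g_1}H^f$ ($H^f$ the Hessian on $(M_1,g_1)$), "subharmonic or superharmonic" means that $\Delta f\ge0$ on all of $M_1$ or $\Delta f\le0$ on all of $M_1$.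
   Formalization: "f attains either its maximum or its minimum" is read as: Δf≤0 and f attains its maximum, or Δf≥0 and f attains its minimum; unrestricted it fails, e.g. f=cos r on the ball of radius π/4 in S³ with fiber S². *)

theory Defs
  imports "HOL-Analysis.Analysis"
begin

text \<open>For open sets S this is the usual notion of a C-infinity map on S.\<close>

fun Ck_on :: "nat \<Rightarrow> 'm::real_normed_vector set \<Rightarrow> ('m \<Rightarrow> 'n::real_normed_vector) \<Rightarrow> bool" where
  "Ck_on 0 S h \<longleftrightarrow> continuous_on S h"
| "Ck_on (Suc k) S h \<longleftrightarrow> (\<forall>x\<in>S. h differentiable (at x)) \<and>
     (\<forall>v. Ck_on k S (\<lambda>x. frechet_derivative h (at x) v))"

definition smooth_on :: "'m::real_normed_vector set \<Rightarrow> ('m \<Rightarrow> 'n::real_normed_vector) \<Rightarrow> bool" where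
  "smooth_on S h \<longleftrightarrow> (\<forall>k. Ck_on k S h)"

text \<open>
  The points of a manifold are all elements of a type 'a, whose topology is given by its type
  class. A chart is a pair of a domain and a coordinate map into a Euclidean space 'e; the
  dimension is DIM('e), and coordinate indices range over Basis.
\<close>

type_synonym ('a, 'e) chart = "'a set \<times> ('a \<Rightarrow> 'e)"

abbreviation cdom :: "('a, 'e) chart \<Rightarrow> 'a set" where "cdom c \<equiv> fst c"
abbreviation cmap :: "('a, 'e) chart \<Rightarrow> 'a \<Rightarrow> 'e" where "cmap c \<equiv> snd c"
abbreviation cimage :: "('a, 'e) chart \<Rightarrow> 'e set" where "cimage c \<equiv> cmap c ` cdom c"
abbreviation cinv :: "('a, 'e) chart \<Rightarrow> 'e \<Rightarrow> 'a" where "cinv c \<equiv> inv_into (cdom c) (cmap c)"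

definition smooth_manifold ::
    "('a::{t2_space,second_countable_topology}, 'e::euclidean_space) chart set \<Rightarrow> bool" where
  "smooth_manifold A \<longleftrightarrow>
     connected (UNIV :: 'a set) \<and>
     (\<Union>c\<in>A. cdom c) = UNIV \<and>
     (\<forall>c\<in>A. open (cdom c) \<and> open (cimage c) \<and>
        homeomorphism (cdom c) (cimage c) (cmap c) (cinv c)) \<and>
     (\<forall>c\<in>A. \<forall>d\<in>A. smooth_on (cmap c ` (cdom c \<inter> cdom d)) (cmap d \<circ> cinv c))"

definition smooth_fun :: "('a, 'e::euclidean_space) chart set \<Rightarrow> ('a \<Rightarrow> real) \<Rightarrow> bool" where
  "smooth_fun A h \<longleftrightarrow> (\<forall>c\<in>A. smooth_on (cimage c) (h \<circ> cinv c))"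

definition chart_at :: "('a, 'e) chart set \<Rightarrow> 'a \<Rightarrow> ('a, 'e) chart" where
  "chart_at A p = (SOME c. c \<in> A \<and> p \<in> cdom c)"

text \<open>
  A tangent vector at p is the operator taking the derivative at p of a real function in some
  direction. It acts on functions differentiable at p and is set to 0 on all others, so that
  equality of tangent vectors is equality of functions; in particular the operator does not depend
  on the chart used to write it down. The vector below is the one with components y in the chart c.
\<close>

type_synonym 'a tvec = "('a \<Rightarrow> real) \<Rightarrow> real"

definition tvec :: "('a, 'e::euclidean_space) chart \<Rightarrow> 'a \<Rightarrow> 'e \<Rightarrow> 'a tvec" where
  "tvec c p y = (\<lambda>h. if (h \<circ> cinv c) differentiable (at (cmap c p))
                     then frechet_derivative (h \<circ> cinv c) (at (cmap c p)) y else 0)"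

definition tspace :: "('a, 'e::euclidean_space) chart set \<Rightarrow> 'a \<Rightarrow> 'a tvec set" where
  "tspace A p = {tvec c p y | c y. c \<in> A \<and> p \<in> cdom c}"

definition slit :: "('a, 'e::euclidean_space) chart set \<Rightarrow> 'a \<Rightarrow> 'a tvec set" where
  "slit A p = tspace A p - {\<lambda>_. 0}"

definition components :: "('a, 'e::euclidean_space) chart \<Rightarrow> 'a tvec \<Rightarrow> 'e" where
  "components c v = (\<Sum>i\<in>Basis. v (\<lambda>q. cmap c q \<bullet> i) *\<^sub>R i)"

definition pushforward :: "('a \<Rightarrow> 'b) \<Rightarrow> 'a tvec \<Rightarrow> 'b tvec" where
  "pushforward \<pi> v = (\<lambda>h. v (h \<circ> \<pi>))"

text \<open>
  Functions on (part of) the tangent bundle are written in a chart as functions of position x and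
  fibre coordinate y. The operators below are partial derivatives along basis vectors k.
\<close>

definition dx :: "'e::euclidean_space \<Rightarrow> ('e \<Rightarrow> 'e \<Rightarrow> real) \<Rightarrow> 'e \<Rightarrow> 'e \<Rightarrow> real" where
  "dx k L x y = frechet_derivative (\<lambda>x'. L x' y) (at x) k"

definition dy :: "'e::euclidean_space \<Rightarrow> ('e \<Rightarrow> 'e \<Rightarrow> real) \<Rightarrow> 'e \<Rightarrow> 'e \<Rightarrow> real" where
  "dy k L x y = frechet_derivative (\<lambda>y'. L x y') (at y) k"

definition partial :: "'e::euclidean_space \<Rightarrow> ('e \<Rightarrow> real) \<Rightarrow> 'e \<Rightarrow> real" where
  "partial k h x = frechet_derivative h (at x) k"

text \<open>Entries of the inverse of an invertible matrix indexed by Basis.\<close>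

definition minv :: "('e::euclidean_space \<Rightarrow> 'e \<Rightarrow> real) \<Rightarrow> 'e \<Rightarrow> 'e \<Rightarrow> real" where
  "minv m i j = inv (\<lambda>u. \<Sum>a\<in>Basis. (\<Sum>b\<in>Basis. m a b * (u \<bullet> b)) *\<^sub>R a) j \<bullet> i"

text \<open>In the following L stands for the coordinate expression of the square of F.\<close>

definition fund :: "('e::euclidean_space \<Rightarrow> 'e \<Rightarrow> real) \<Rightarrow> 'e \<Rightarrow> 'e \<Rightarrow> 'e \<Rightarrow> 'e \<Rightarrow> real" where
  "fund L i j x y = dy i (dy j L) x y / 2"

definition fund_inv :: "('e::euclidean_space \<Rightarrow> 'e \<Rightarrow> real) \<Rightarrow> 'e \<Rightarrow> 'e \<Rightarrow> 'e \<Rightarrow> 'e \<Rightarrow> real" where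
  "fund_inv L i j x y = minv (\<lambda>a b. fund L a b x y) i j"

definition spray :: "('e::euclidean_space \<Rightarrow> 'e \<Rightarrow> real) \<Rightarrow> 'e \<Rightarrow> 'e \<Rightarrow> 'e \<Rightarrow> real" where
  "spray L i x y = (\<Sum>l\<in>Basis. fund_inv L i l x y *
     ((\<Sum>k\<in>Basis. dy l (dx k L) x y * (y \<bullet> k)) - dx l L x y)) / 4"

definition riemann :: "('e::euclidean_space \<Rightarrow> 'e \<Rightarrow> real) \<Rightarrow> 'e \<Rightarrow> 'e \<Rightarrow> 'e \<Rightarrow> 'e \<Rightarrow> real" where
  "riemann L i k x y =
     2 * dx k (spray L i) x y
     - (\<Sum>j\<in>Basis. (y \<bullet> j) * dx j (dy k (spray L i)) x y)
     + 2 * (\<Sum>j\<in>Basis. spray L j x y * dy j (dy k (spray L i)) x y)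
     - (\<Sum>j\<in>Basis. dy j (spray L i) x y * dy k (spray L j) x y)"

definition ricci :: "('e::euclidean_space \<Rightarrow> 'e \<Rightarrow> real) \<Rightarrow> 'e \<Rightarrow> 'e \<Rightarrow> real" where
  "ricci L x y = (\<Sum>i\<in>Basis. riemann L i i x y)"

definition ricci_tensor :: "('e::euclidean_space \<Rightarrow> 'e \<Rightarrow> real) \<Rightarrow> 'e \<Rightarrow> 'e \<Rightarrow> 'e \<Rightarrow> 'e \<Rightarrow> real" where
  "ricci_tensor L i j x y = dy i (dy j (ricci L)) x y / 2"

definition scalar_curv :: "('e::euclidean_space \<Rightarrow> 'e \<Rightarrow> real) \<Rightarrow> 'e \<Rightarrow> 'e \<Rightarrow> real" where
  "scalar_curv L x y = (\<Sum>i\<in>Basis. \<Sum>j\<in>Basis. fund_inv L i j x y * ricci_tensor L i j x y)"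

definition E_curv :: "('e::euclidean_space \<Rightarrow> 'e \<Rightarrow> real) \<Rightarrow> 'e \<Rightarrow> 'e \<Rightarrow> 'e \<Rightarrow> 'e \<Rightarrow> real" where
  "E_curv L i j x y = dy i (dy j (\<lambda>x y. \<Sum>s\<in>Basis. dy s (spray L s) x y)) x y / 2"

text \<open>
  A Finsler metric is a function F of a point and a tangent vector there. A warped product metric
  is regular only on a proper open conic part of the slit tangent bundle, so the notions below
  take a set D p of tangent vectors at each p; an ordinary Finsler manifold has D = slit A.
\<close>

definition loc :: "('a, 'e::euclidean_space) chart \<Rightarrow> ('a \<Rightarrow> 'a tvec \<Rightarrow> real) \<Rightarrow> 'e \<Rightarrow> 'e \<Rightarrow> real" where
  "loc c F x y = F (cinv c x) (tvec c (cinv c x) y)"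

definition sqloc :: "('a, 'e::euclidean_space) chart \<Rightarrow> ('a \<Rightarrow> 'a tvec \<Rightarrow> real) \<Rightarrow> 'e \<Rightarrow> 'e \<Rightarrow> real" where
  "sqloc c F x y = (loc c F x y)\<^sup>2"

definition locdom :: "('a, 'e::euclidean_space) chart \<Rightarrow> ('a \<Rightarrow> 'a tvec set) \<Rightarrow> ('e \<times> 'e) set" where
  "locdom c D = {(x, y). x \<in> cimage c \<and> tvec c (cinv c x) y \<in> D (cinv c x)}"

definition finsler_metric_on ::
    "('a, 'e::euclidean_space) chart set \<Rightarrow> ('a \<Rightarrow> 'a tvec set) \<Rightarrow> ('a \<Rightarrow> 'a tvec \<Rightarrow> real) \<Rightarrow> bool" where
  "finsler_metric_on A D F \<longleftrightarrow>
     (\<forall>p. \<forall>v\<in>tspace A p. F p v \<ge> 0 \<and> (\<forall>t>0. F p (\<lambda>h. t * v h) = t * F p v)) \<and>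
     (\<forall>c\<in>A. continuous_on (cimage c \<times> UNIV) (\<lambda>(x, y). loc c F x y)) \<and>
     (\<forall>c\<in>A. smooth_on (locdom c D) (\<lambda>(x, y). loc c F x y)) \<and>
     (\<forall>c\<in>A. \<forall>(x, y)\<in>locdom c D. \<forall>u. u \<noteq> 0 \<longrightarrow>
        (\<Sum>i\<in>Basis. \<Sum>j\<in>Basis. fund (sqloc c F) i j x y * (u \<bullet> i) * (u \<bullet> j)) > 0)"

definition weakly_berwald_on ::
    "('a, 'e::euclidean_space) chart set \<Rightarrow> ('a \<Rightarrow> 'a tvec set) \<Rightarrow> ('a \<Rightarrow> 'a tvec \<Rightarrow> real) \<Rightarrow> bool" where
  "weakly_berwald_on A D F \<longleftrightarrow>
     (\<forall>c\<in>A. \<forall>(x, y)\<in>locdom c D. \<forall>i\<in>Basis. \<forall>j\<in>Basis. E_curv (sqloc c F) i j x y = 0)"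

definition einstein_on ::
    "('a, 'e::euclidean_space) chart set \<Rightarrow> ('a \<Rightarrow> 'a tvec set) \<Rightarrow> ('a \<Rightarrow> 'a tvec \<Rightarrow> real) \<Rightarrow> bool" where
  "einstein_on A D F \<longleftrightarrow>
     (\<exists>lam. \<forall>c\<in>A. \<forall>(x, y)\<in>locdom c D. ricci (sqloc c F) x y = lam (cinv c x) * (loc c F x y)\<^sup>2)"

text \<open>
  The coordinate expression of the scalar curvature has the same value in all charts; it is
  evaluated in a chosen one.
\<close>

definition scal_dir ::
    "('a, 'e::euclidean_space) chart set \<Rightarrow> ('a \<Rightarrow> 'a tvec \<Rightarrow> real) \<Rightarrow> 'a \<Rightarrow> 'a tvec \<Rightarrow> real" where
  "scal_dir A F p v =
     (let c = chart_at A p in scalar_curv (sqloc c F) (cmap c p) (components c v))"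

text \<open>
  The scalar curvature as a function on the manifold, for metrics for which it does not depend on
  the direction v (Riemannian and Einstein metrics).
\<close>

definition scal ::
    "('a, 'e::euclidean_space) chart set \<Rightarrow> ('a \<Rightarrow> 'a tvec set) \<Rightarrow> ('a \<Rightarrow> 'a tvec \<Rightarrow> real) \<Rightarrow> 'a \<Rightarrow> real" where
  "scal A D F p = (THE s. \<forall>v\<in>D p. scal_dir A F p v = s)"

definition positive_scal_on ::
    "('a, 'e::euclidean_space) chart set \<Rightarrow> ('a \<Rightarrow> 'a tvec set) \<Rightarrow> ('a \<Rightarrow> 'a tvec \<Rightarrow> real) \<Rightarrow> bool" where
  "positive_scal_on A D F \<longleftrightarrow> (\<forall>p. \<forall>v\<in>D p. scal_dir A F p v > 0)"

definition gloc :: "('a, 'e::euclidean_space) chart \<Rightarrow> ('a \<Rightarrow> 'a tvec \<Rightarrow> 'a tvec \<Rightarrow> real) \<Rightarrow> 'e \<Rightarrow> 'e \<Rightarrow> 'e \<Rightarrow> real" where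
  "gloc c g u v x = g (cinv c x) (tvec c (cinv c x) u) (tvec c (cinv c x) v)"

definition riemannian_metric ::
    "('a, 'e::euclidean_space) chart set \<Rightarrow> ('a \<Rightarrow> 'a tvec \<Rightarrow> 'a tvec \<Rightarrow> real) \<Rightarrow> bool" where
  "riemannian_metric A g \<longleftrightarrow>
     (\<forall>c\<in>A.
        (\<forall>x\<in>cimage c. bilinear (\<lambda>u v. gloc c g u v x) \<and>
           (\<forall>u v. gloc c g u v x = gloc c g v u x) \<and>
           (\<forall>u. u \<noteq> 0 \<longrightarrow> gloc c g u u x > 0)) \<and>
        (\<forall>u v. smooth_on (cimage c) (gloc c g u v)))"

definition riem_norm :: "('a \<Rightarrow> 'a tvec \<Rightarrow> 'a tvec \<Rightarrow> real) \<Rightarrow> 'a \<Rightarrow> 'a tvec \<Rightarrow> real" where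
  "riem_norm g p v = sqrt (g p v v)"

definition ginv :: "('a, 'e::euclidean_space) chart \<Rightarrow> ('a \<Rightarrow> 'a tvec \<Rightarrow> 'a tvec \<Rightarrow> real) \<Rightarrow> 'e \<Rightarrow> 'e \<Rightarrow> 'e \<Rightarrow> real" where
  "ginv c g i j x = minv (\<lambda>a b. gloc c g a b x) i j"

definition christoffel ::
    "('a, 'e::euclidean_space) chart \<Rightarrow> ('a \<Rightarrow> 'a tvec \<Rightarrow> 'a tvec \<Rightarrow> real) \<Rightarrow> 'e \<Rightarrow> 'e \<Rightarrow> 'e \<Rightarrow> 'e \<Rightarrow> real" where
  "christoffel c g k i j x = (\<Sum>l\<in>Basis. ginv c g k l x *
     (partial i (gloc c g j l) x + partial j (gloc c g i l) x - partial l (gloc c g i j) x)) / 2"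

definition hessian ::
    "('a, 'e::euclidean_space) chart \<Rightarrow> ('a \<Rightarrow> 'a tvec \<Rightarrow> 'a tvec \<Rightarrow> real) \<Rightarrow> ('a \<Rightarrow> real) \<Rightarrow> 'e \<Rightarrow> 'e \<Rightarrow> 'e \<Rightarrow> real" where
  "hessian c g f i j x = partial i (partial j (f \<circ> cinv c)) x
     - (\<Sum>k\<in>Basis. christoffel c g k i j x * partial k (f \<circ> cinv c) x)"

text \<open>Gradient and Laplacian are chart independent; note the sign of the latter.\<close>

definition gradient ::
    "('a, 'e::euclidean_space) chart set \<Rightarrow> ('a \<Rightarrow> 'a tvec \<Rightarrow> 'a tvec \<Rightarrow> real) \<Rightarrow> ('a \<Rightarrow> real) \<Rightarrow> 'a \<Rightarrow> 'a tvec" where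
  "gradient A g f p = (let c = chart_at A p; x = cmap c p in
     tvec c p (\<Sum>i\<in>Basis. (\<Sum>j\<in>Basis. ginv c g i j x * partial j (f \<circ> cinv c) x) *\<^sub>R i))"

definition laplacian ::
    "('a, 'e::euclidean_space) chart set \<Rightarrow> ('a \<Rightarrow> 'a tvec \<Rightarrow> 'a tvec \<Rightarrow> real) \<Rightarrow> ('a \<Rightarrow> real) \<Rightarrow> 'a \<Rightarrow> real" where
  "laplacian A g f p = (let c = chart_at A p; x = cmap c p in
     - (\<Sum>i\<in>Basis. \<Sum>j\<in>Basis. ginv c g i j x * hessian c g f i j x))"

definition prod_chart :: "('a, 'e) chart \<Rightarrow> ('b, 'f) chart \<Rightarrow> ('a \<times> 'b, 'e \<times> 'f) chart" where
  "prod_chart c d = (cdom c \<times> cdom d, map_prod (cmap c) (cmap d))"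

definition prod_atlas :: "('a, 'e) chart set \<Rightarrow> ('b, 'f) chart set \<Rightarrow> ('a \<times> 'b, 'e \<times> 'f) chart set" where
  "prod_atlas A B = {prod_chart c d | c d. c \<in> A \<and> d \<in> B}"

text \<open>The product of the two slit tangent bundles, inside the tangent bundle of the product.\<close>

definition warped_dom ::
    "('a, 'e::euclidean_space) chart set \<Rightarrow> ('b, 'f::euclidean_space) chart set \<Rightarrow> 'a \<times> 'b \<Rightarrow> ('a \<times> 'b) tvec set" where
  "warped_dom A B pq = {w \<in> tspace (prod_atlas A B) pq.
     pushforward fst w \<in> slit A (fst pq) \<and> pushforward snd w \<in> slit B (snd pq)}"

definition warped_metric ::
    "('a \<Rightarrow> 'a tvec \<Rightarrow> real) \<Rightarrow> ('b \<Rightarrow> 'b tvec \<Rightarrow> real) \<Rightarrow> ('a \<Rightarrow> real) \<Rightarrow> 'a \<times> 'b \<Rightarrow> ('a \<times> 'b) tvec \<Rightarrow> real" where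
  "warped_metric F1 F2 f pq w =
     sqrt ((F1 (fst pq) (pushforward fst w))\<^sup>2 + (f (fst pq))\<^sup>2 * (F2 (snd pq) (pushforward snd w))\<^sup>2)"

definition riemannian_product ::
    "('a::{t2_space,second_countable_topology}, 'e::euclidean_space) chart set \<Rightarrow> ('a \<Rightarrow> 'a tvec \<Rightarrow> real) \<Rightarrow>
     ('b::{t2_space,second_countable_topology}, 'f::euclidean_space) chart set \<Rightarrow> ('b \<Rightarrow> 'b tvec \<Rightarrow> real) \<Rightarrow>
     ('a \<Rightarrow> real) \<Rightarrow> bool" where
  "riemannian_product A F1 B F2 f \<longleftrightarrow>
     smooth_manifold A \<and> finsler_metric_on A (slit A) F1 \<and>
     smooth_manifold B \<and> finsler_metric_on B (slit B) F2 \<and>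
     (\<exists>r>0. \<forall>p. f p = r)"

end

theory Submission
  imports Defs
begin

text \<open>
  In product coordinates the spray of the warped product is
  \<open>G\<^sub>1\<^sup>i - f (grad f)\<^sup>i F\<^sub>2\<^sup>2 / 2\<close> on the base and
  \<open>G\<^sub>2\<^sup>\<alpha> + (df(y\<^sub>1) / f) y\<^sub>2\<^sup>\<alpha>\<close> on the fibre, which gives
  \<open>Ric = Ric\<^sub>1 + Ric\<^sub>2 - (n\<^sub>2 / f) Hess f (y\<^sub>1, y\<^sub>1) - (f tr Hess f + (n\<^sub>2 - 1) |grad f|\<^sup>2) F\<^sub>2\<^sup>2\<close>.
  The Einstein equation with factor \<open>\<lambda>\<close> is therefore the sum of a part homogeneous in \<open>y\<^sub>1\<close> and a part
  homogeneous in \<open>y\<^sub>2\<close>, and splits: \<open>\<lambda>\<close> depends on the base point only, the fibre is Einstein with a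
  constant factor \<open>\<mu>\<close>, and \<open>Scal\<^sub>1 = n\<^sub>1 \<lambda> - n\<^sub>2 \<Delta>f / f\<close>,
  \<open>\<mu> = \<lambda> f\<^sup>2 - f \<Delta>f + (n\<^sub>2 - 1) |grad f|\<^sup>2\<close>. Pointwise algebra turns each of the six conditions into
  a sign of \<open>\<Delta>f\<close>; only in (f) with \<open>n\<^sub>1 = n\<^sub>2\<close> does one use that the gradient vanishes everywhere.
  Hopf's strong maximum principle, applied in charts, shows that the set where \<open>f\<close> attains its
  extremum is open, hence everything.
\<close>

subsection \<open>Smooth functions\<close>

text \<open>The Ricci curvature is computed from \<open>spray_div\<close>, the trace dG^s/dy^s,
  which the warping changes only by n2 df(y1) / f. The Riemannian base enters here: its trace is
  linear in y1 with the contracted Christoffel symbols as coefficients, and exactly these complete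
  the coordinate divergence of grad f to the trace of Hess f. The separation of the Einstein
  equation rests on homogeneity: the base part has degree 2 in y1, while the rest does not contain
  y1. The Einstein factor comes without any regularity, so it is differentiated only in y, where it
  is a constant. The Laplacian is evaluated in a chart that is chosen anew at every point, whereas
  the maximum principle needs one chart on a whole neighbourhood. The transformation law of the
  Christoffel symbols is avoided: the fibre equation expresses tr Hess f in every chart through
  quantities that do not depend on the chart.\<close>

lemma frechet_derivative_cong_open:
  assumes "open S" "x \<in> S" "\<And>x. x \<in> S \<Longrightarrow> f x = g x"
  shows "frechet_derivative f (at x) = frechet_derivative g (at x)"
proof -
  have "(f has_derivative D) (at x) \<longleftrightarrow> (g has_derivative D) (at x)" for D
    using has_derivative_transform_within_open[OF _ assms(1,2)] assms(3) by metis
  then show ?thesis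
    by (simp add: frechet_derivative_def)
qed

lemma differentiable_cong_open:
  assumes "open S" "x \<in> S" "\<And>x. x \<in> S \<Longrightarrow> f x = g x"
  shows "f differentiable (at x) \<longleftrightarrow> g differentiable (at x)"
  using has_derivative_transform_within_open[OF _ assms(1,2)] assms(3)
  unfolding differentiable_def by metis

text \<open>Chart expressions are given by formulas valid only on part of the space; on an open set
  they may be exchanged, since all derivatives agree there too.\<close>

lemma Ck_on_cong:
  assumes "open S" "\<And>x. x \<in> S \<Longrightarrow> f x = g x"
  shows "Ck_on k S f \<longleftrightarrow> Ck_on k S g"
  using assms(2)
proof (induction k arbitrary: f g)
  case 0
  then show ?case by (simp cong: continuous_on_cong)
next
  case (Suc k)
  have "Ck_on k S (\<lambda>x. frechet_derivative f (at x) v) \<longleftrightarrow> Ck_on k S (\<lambda>x. frechet_derivative g (at x) v)" for v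
    by (rule Suc.IH) (metis Suc.prems assms(1) frechet_derivative_cong_open)
  moreover have "\<forall>x\<in>S. f differentiable (at x) \<longleftrightarrow> g differentiable (at x)"
    using differentiable_cong_open[OF assms(1)] Suc.prems by metis
  ultimately show ?case by simp
qed

lemma Ck_on_Suc_imp: "Ck_on (Suc k) S f \<Longrightarrow> Ck_on k S f"
proof (induction k arbitrary: f)
  case 0
  then show ?case
    by (auto simp: continuous_on_eq_continuous_within intro!: continuous_at_imp_continuous_at_within
        differentiable_imp_continuous_within intro: differentiable_at_withinI)
qed auto

text \<open>Most closure properties below are inductions on the order. This rule lets the derivative
  be any explicit formula, so that the induction hypothesis applies to its factors instead of to
  \<open>frechet_derivative\<close> of a compound term.\<close>

lemma Ck_on_SucI:
  assumes "open S" "\<And>x. x \<in> S \<Longrightarrow> (f has_derivative f' x) (at x)"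
    and "\<And>v. Ck_on k S (\<lambda>x. f' x v)"
  shows "Ck_on (Suc k) S f"
proof -
  have "Ck_on k S (\<lambda>x. frechet_derivative f (at x) v)" for v
    using assms(3)[of v] by (rule Ck_on_cong[OF assms(1), THEN iffD1, rotated])
      (metis assms(2) frechet_derivative_at)
  moreover have "f differentiable (at x)" if "x \<in> S" for x
    using assms(2)[OF that] by (auto simp: differentiable_def)
  ultimately show ?thesis by simp
qed

lemma Ck_on_SucD:
  assumes "Ck_on (Suc k) S f"
  shows "x \<in> S \<Longrightarrow> (f has_derivative frechet_derivative f (at x)) (at x)"
    and "Ck_on k S (\<lambda>x. frechet_derivative f (at x) v)"
    and "Ck_on k S f"
  using assms Ck_on_Suc_imp[OF assms] by (auto simp: frechet_derivative_works[symmetric])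

lemma Ck_on_subset: "Ck_on k S f \<Longrightarrow> T \<subseteq> S \<Longrightarrow> Ck_on k T f"
  by (induction k arbitrary: f) (auto intro: continuous_on_subset)

lemma Ck_on_const: "open S \<Longrightarrow> Ck_on k S (\<lambda>x. c)"
  by (induction k arbitrary: c) (auto intro!: Ck_on_SucI)

lemma Ck_on_bounded_linear:
  assumes "open S" "bounded_linear T" "Ck_on k S f"
  shows "Ck_on k S (\<lambda>x. T (f x))"
  using assms(3)
proof (induction k arbitrary: f)
  case 0
  then show ?case using assms(2) by (simp add: bounded_linear.continuous_on)
next
  case (Suc k)
  show ?case
    by (rule Ck_on_SucI[OF assms(1) bounded_linear.has_derivative[OF assms(2) Ck_on_SucD(1)[OF Suc.prems]]])
      (auto intro: Suc.IH Ck_on_SucD(2)[OF Suc.prems])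
qed

lemma Ck_on_add:
  assumes "open S" "Ck_on k S f" "Ck_on k S g"
  shows "Ck_on k S (\<lambda>x. f x + g x)"
  using assms(2,3)
proof (induction k arbitrary: f g)
  case 0
  then show ?case by (simp add: continuous_on_add)
next
  case (Suc k)
  show ?case
    by (rule Ck_on_SucI[OF assms(1) has_derivative_add[OF Ck_on_SucD(1)[OF Suc.prems(1)] Ck_on_SucD(1)[OF Suc.prems(2)]]])
      (auto intro: Suc.IH Ck_on_SucD(2)[OF Suc.prems(1)] Ck_on_SucD(2)[OF Suc.prems(2)])
qed

lemma Ck_on_Pair:
  assumes "open S" "Ck_on k S f" "Ck_on k S g"
  shows "Ck_on k S (\<lambda>x. (f x, g x))"
  using assms(2,3)
proof (induction k arbitrary: f g)
  case 0
  then show ?case by (simp add: continuous_on_Pair)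
next
  case (Suc k)
  show ?case
    by (rule Ck_on_SucI[OF assms(1) has_derivative_Pair[OF Ck_on_SucD(1)[OF Suc.prems(1)] Ck_on_SucD(1)[OF Suc.prems(2)]]])
      (auto intro: Suc.IH Ck_on_SucD(2)[OF Suc.prems(1)] Ck_on_SucD(2)[OF Suc.prems(2)])
qed

text \<open>The product rule multiplies the derivative of one factor by the other factor itself, so
  the functions as well as their derivatives are used at order k.\<close>

lemma Ck_on_mult:
  fixes f g :: "_ \<Rightarrow> real"
  assumes "open S" "Ck_on k S f" "Ck_on k S g"
  shows "Ck_on k S (\<lambda>x. f x * g x)"
  using assms(2,3)
proof (induction k arbitrary: f g)
  case 0
  then show ?case by (simp add: continuous_on_mult)
next
  case (Suc k)
  show ?case
    by (rule Ck_on_SucI[OF assms(1) has_derivative_mult[OF Ck_on_SucD(1)[OF Suc.prems(1)] Ck_on_SucD(1)[OF Suc.prems(2)]]])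
      (auto intro!: Ck_on_add Suc.IH Ck_on_SucD(2,3)[OF Suc.prems(1)] Ck_on_SucD(2,3)[OF Suc.prems(2)] assms(1))
qed

text \<open>With a linear inner map the derivative f'(l x)(l v) is again a function composed with l,
  so the induction closes at once. The inner maps in use are coordinate projections.\<close>

lemma Ck_on_comp_linear:
  assumes "open S" "open T" "bounded_linear l" "\<And>x. x \<in> S \<Longrightarrow> l x \<in> T" "Ck_on k T f"
  shows "Ck_on k S (\<lambda>x. f (l x))"
  using assms(5)
proof (induction k arbitrary: f)
  case 0
  then have "continuous_on S (f \<circ> l)"
    using assms by (intro continuous_on_compose continuous_on_subset[OF _ image_subsetI])
      (auto intro: linear_continuous_on)
  then show ?case by (simp add: o_def)
next
  case (Suc k)
  have d: "((\<lambda>x. f (l x)) has_derivative (\<lambda>v. frechet_derivative f (at (l x)) (l v))) (at x)" if "x \<in> S" for x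
    using diff_chain_at[OF bounded_linear_imp_has_derivative[OF assms(3)]
        Ck_on_SucD(1)[OF Suc.prems assms(4)[OF that]]] by (simp add: o_def)
  show ?case
    by (rule Ck_on_SucI[OF assms(1) d]) (auto intro: Suc.IH Ck_on_SucD(2)[OF Suc.prems])
qed

text \<open>The derivative contains the reciprocal of f itself, which the induction hypothesis
  covers at order k. The same pattern serves the square root and the exponential.\<close>

lemma Ck_on_inverse:
  fixes f :: "_ \<Rightarrow> real"
  assumes "open S" "\<And>x. x \<in> S \<Longrightarrow> f x \<noteq> 0" "Ck_on k S f"
  shows "Ck_on k S (\<lambda>x. inverse (f x))"
  using assms(3)
proof (induction k)
  case 0
  then show ?case using assms by (simp add: continuous_on_inverse)
next
  case (Suc k)
  have d: "((\<lambda>x. inverse (f x)) has_derivative (\<lambda>h. - 1 * (inverse (f x) * frechet_derivative f (at x) h * inverse (f x)))) (at x)"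
    if "x \<in> S" for x
    using Deriv.has_derivative_inverse[OF assms(2)[OF that] Ck_on_SucD(1)[OF Suc.prems that]] by simp
  show ?case
    by (rule Ck_on_SucI[OF assms(1) d])
      (assumption, intro Ck_on_mult[OF assms(1)] Ck_on_const[OF assms(1)]
        Suc.IH[OF Ck_on_SucD(3)[OF Suc.prems]] Ck_on_SucD(2)[OF Suc.prems])
qed

lemma Ck_on_sqrt:
  fixes f :: "_ \<Rightarrow> real"
  assumes "open S" "\<And>x. x \<in> S \<Longrightarrow> f x > 0" "Ck_on k S f"
  shows "Ck_on k S (\<lambda>x. sqrt (f x))"
  using assms(3)
proof (induction k)
  case 0
  then show ?case by (simp add: continuous_on_real_sqrt)
next
  case (Suc k)
  have d: "((\<lambda>x. sqrt (f x)) has_derivative (\<lambda>h. frechet_derivative f (at x) h * (inverse (sqrt (f x)) * (1/2)))) (at x)"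
    if "x \<in> S" for x
    using has_derivative_real_sqrt[OF assms(2)[OF that] Ck_on_SucD(1)[OF Suc.prems that]]
    by (simp add: field_simps)
  show ?case
    by (rule Ck_on_SucI[OF assms(1) d])
      (assumption, intro Ck_on_mult[OF assms(1)] Ck_on_const[OF assms(1)]
        Ck_on_inverse[OF assms(1) _ Suc.IH[OF Ck_on_SucD(3)[OF Suc.prems]]]
        Ck_on_SucD(2)[OF Suc.prems], use assms(2) in force)
qed

lemma smooth_onI:
  assumes "\<And>k. Ck_on k S f"
  shows "smooth_on S f"
  using assms by (simp add: smooth_on_def)

lemma smooth_on_cong:
  "open S \<Longrightarrow> (\<And>x. x \<in> S \<Longrightarrow> f x = g x) \<Longrightarrow> smooth_on S f \<longleftrightarrow> smooth_on S g"
  by (simp add: smooth_on_def cong: Ck_on_cong)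

lemma smooth_on_has_derivative:
  "smooth_on S f \<Longrightarrow> x \<in> S \<Longrightarrow> (f has_derivative frechet_derivative f (at x)) (at x)"
  using Ck_on_SucD(1)[of 0] unfolding smooth_on_def by blast

lemma smooth_on_derivative:
  "smooth_on S f \<Longrightarrow> smooth_on S (\<lambda>x. frechet_derivative f (at x) v)"
  using Ck_on_SucD(2) unfolding smooth_on_def by blast

lemma smooth_on_imp_continuous_on: "smooth_on S f \<Longrightarrow> continuous_on S f"
  unfolding smooth_on_def by (metis Ck_on.simps(1))

lemma smooth_on_subset: "smooth_on S f \<Longrightarrow> T \<subseteq> S \<Longrightarrow> smooth_on T f"
  unfolding smooth_on_def by (metis Ck_on_subset)

lemma smooth_on_const [intro]: "open S \<Longrightarrow> smooth_on S (\<lambda>x. c)"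
  by (simp add: smooth_on_def Ck_on_const)

lemma smooth_on_add [intro]:
  "open S \<Longrightarrow> smooth_on S f \<Longrightarrow> smooth_on S g \<Longrightarrow> smooth_on S (\<lambda>x. f x + g x)"
  by (simp add: smooth_on_def Ck_on_add)

lemma smooth_on_Pair:
  "open S \<Longrightarrow> smooth_on S f \<Longrightarrow> smooth_on S g \<Longrightarrow> smooth_on S (\<lambda>x. (f x, g x))"
  by (simp add: smooth_on_def Ck_on_Pair)

lemma smooth_on_mult [intro]:
  fixes f g :: "_ \<Rightarrow> real"
  shows "open S \<Longrightarrow> smooth_on S f \<Longrightarrow> smooth_on S g \<Longrightarrow> smooth_on S (\<lambda>x. f x * g x)"
  by (simp add: smooth_on_def Ck_on_mult)

lemma smooth_on_minus [intro]:
  fixes f :: "_ \<Rightarrow> real"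
  shows "open S \<Longrightarrow> smooth_on S f \<Longrightarrow> smooth_on S (\<lambda>x. - f x)"
  using smooth_on_mult[OF _ smooth_on_const[of S "-1"], of f] by simp

lemma smooth_on_diff [intro]:
  fixes f g :: "_ \<Rightarrow> real"
  shows "open S \<Longrightarrow> smooth_on S f \<Longrightarrow> smooth_on S g \<Longrightarrow> smooth_on S (\<lambda>x. f x - g x)"
  using smooth_on_add[OF _ _ smooth_on_minus[of S g], of f] by simp

lemma smooth_on_inverse:
  fixes f :: "_ \<Rightarrow> real"
  shows "open S \<Longrightarrow> (\<And>x. x \<in> S \<Longrightarrow> f x \<noteq> 0) \<Longrightarrow> smooth_on S f \<Longrightarrow> smooth_on S (\<lambda>x. inverse (f x))"
  by (simp add: smooth_on_def Ck_on_inverse)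

lemma smooth_on_divide [intro]:
  fixes f g :: "_ \<Rightarrow> real"
  shows "open S \<Longrightarrow> smooth_on S f \<Longrightarrow> smooth_on S g \<Longrightarrow> (\<And>x. x \<in> S \<Longrightarrow> g x \<noteq> 0) \<Longrightarrow> smooth_on S (\<lambda>x. f x / g x)"
  unfolding divide_inverse by (intro smooth_on_mult smooth_on_inverse)

lemma smooth_on_sqrt:
  fixes f :: "_ \<Rightarrow> real"
  shows "open S \<Longrightarrow> (\<And>x. x \<in> S \<Longrightarrow> f x > 0) \<Longrightarrow> smooth_on S f \<Longrightarrow> smooth_on S (\<lambda>x. sqrt (f x))"
  by (simp add: smooth_on_def Ck_on_sqrt)

lemma smooth_on_exp:
  fixes f :: "_ \<Rightarrow> real"
  assumes "open S" "smooth_on S f"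
  shows "smooth_on S (\<lambda>x. exp (f x))"
proof (rule smooth_onI)
  fix k
  have "Ck_on k S f" using assms(2) by (simp add: smooth_on_def)
  then show "Ck_on k S (\<lambda>x. exp (f x))"
  proof (induction k)
    case 0
    then show ?case by (simp add: continuous_on_exp)
  next
    case (Suc k)
    have d: "((\<lambda>x. exp (f x)) has_derivative (\<lambda>h. frechet_derivative f (at x) h * exp (f x))) (at x)" if "x \<in> S" for x
      using has_derivative_exp[OF Ck_on_SucD(1)[OF Suc.prems that]] by simp
    show ?case
      by (rule Ck_on_SucI[OF assms(1) d])
        (assumption, intro Ck_on_mult[OF assms(1)] Suc.IH[OF Ck_on_SucD(3)[OF Suc.prems]] Ck_on_SucD(2)[OF Suc.prems])
  qed
qed

lemma smooth_on_sum [intro]: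
  assumes "open S" "\<And>i. i \<in> I \<Longrightarrow> smooth_on S (f i)"
  shows "smooth_on S (\<lambda>x. \<Sum>i\<in>I. f i x)"
proof (cases "finite I")
  case True
  then show ?thesis using assms(2)
    by (induction I) (auto simp: assms(1) intro!: smooth_on_add smooth_on_const)
qed (use assms(1) in auto)

lemma smooth_on_comp_linear:
  "open S \<Longrightarrow> open T \<Longrightarrow> bounded_linear l \<Longrightarrow> (\<And>x. x \<in> S \<Longrightarrow> l x \<in> T) \<Longrightarrow> smooth_on T f
    \<Longrightarrow> smooth_on S (\<lambda>x. f (l x))"
  unfolding smooth_on_def by (metis Ck_on_comp_linear)

lemma smooth_on_ident: "open S \<Longrightarrow> smooth_on S (\<lambda>x. x)"
proof (rule smooth_onI)
  show "Ck_on k S (\<lambda>x. x)" if "open S" for k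
    by (cases k) (auto intro!: Ck_on_SucI Ck_on_const that)
qed

lemma smooth_on_linear: "open S \<Longrightarrow> bounded_linear l \<Longrightarrow> smooth_on S l"
  using Ck_on_bounded_linear smooth_on_ident unfolding smooth_on_def by blast

text \<open>Restriction to a line turns the Frechet derivative into an ordinary one, which opens it
  to the \<open>DERIV\<close> rules and to the one-variable mean value theorem.\<close>

lemma smooth_on_DERIV_line:
  fixes h :: "'m::real_normed_vector \<Rightarrow> real"
  assumes "smooth_on S h" "p + r *\<^sub>R w \<in> S"
  shows "((\<lambda>r. h (p + r *\<^sub>R w)) has_real_derivative frechet_derivative h (at (p + r *\<^sub>R w)) w) (at r)"
proof -
  have "((\<lambda>r. p + r *\<^sub>R w) has_derivative (\<lambda>h. h *\<^sub>R w)) (at r)"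
    by (auto intro!: derivative_eq_intros)
  from diff_chain_at[OF this smooth_on_has_derivative[OF assms]]
  have 1: "((\<lambda>r. h (p + r *\<^sub>R w)) has_derivative (\<lambda>s. frechet_derivative h (at (p + r *\<^sub>R w)) (s *\<^sub>R w))) (at r)"
    by (simp add: o_def)
  have "(\<lambda>s. frechet_derivative h (at (p + r *\<^sub>R w)) (s *\<^sub>R w)) = (*) (frechet_derivative h (at (p + r *\<^sub>R w)) w)"
    using has_derivative_linear[OF smooth_on_has_derivative[OF assms]] by (auto simp: fun_eq_iff linear_cmul)
  with 1 show ?thesis by (simp only: has_field_derivative_def)
qed

text \<open>The second difference of \<open>f\<close> is, by the mean value theorem applied twice, a value of either
  mixed derivative near \<open>x\<close>, times \<open>t\<^sup>2\<close>.\<close>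

lemma mixed_derivative_value:
  fixes f :: "'m::real_normed_vector \<Rightarrow> real"
  assumes f: "smooth_on S f" and sub: "\<And>a b. \<lbrakk>0 \<le> a; a \<le> t; 0 \<le> b; b \<le> t\<rbrakk> \<Longrightarrow> x + a *\<^sub>R u + b *\<^sub>R v \<in> S"
    and t: "t > 0"
  shows "\<exists>a b. 0 < a \<and> a < t \<and> 0 < b \<and> b < t \<and>
    f (x + t *\<^sub>R u + t *\<^sub>R v) - f (x + t *\<^sub>R u) - f (x + t *\<^sub>R v) + f x =
       t\<^sup>2 * frechet_derivative (\<lambda>z. frechet_derivative f (at z) u) (at (x + a *\<^sub>R u + b *\<^sub>R v)) v"
proof -
  note line = smooth_on_DERIV_line
  let ?G = "\<lambda>a. f (x + t *\<^sub>R v + a *\<^sub>R u) - f (x + a *\<^sub>R u)"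
  have "\<exists>a>0. a < t \<and> ?G t - ?G 0 = (t - 0) * (frechet_derivative f (at (x + t *\<^sub>R v + a *\<^sub>R u)) u
          - frechet_derivative f (at (x + a *\<^sub>R u)) u)"
  proof (rule MVT2[OF t])
    fix a assume a: "0 \<le> a" "a \<le> t"
    then have "x + t *\<^sub>R v + a *\<^sub>R u \<in> S" "x + a *\<^sub>R u \<in> S"
      using sub[OF a, of t] sub[OF a, of 0] t by (auto simp: algebra_simps)
    then show "(?G has_real_derivative frechet_derivative f (at (x + t *\<^sub>R v + a *\<^sub>R u)) u
          - frechet_derivative f (at (x + a *\<^sub>R u)) u) (at a)"
      by (intro DERIV_diff line[OF f])
  qed
  then obtain a where a: "0 < a" "a < t"
    and 1: "?G t - ?G 0 = t * (frechet_derivative f (at (x + t *\<^sub>R v + a *\<^sub>R u)) u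
          - frechet_derivative f (at (x + a *\<^sub>R u)) u)" by auto
  let ?H = "\<lambda>b. frechet_derivative f (at (x + a *\<^sub>R u + b *\<^sub>R v)) u"
  have "\<exists>b>0. b < t \<and> ?H t - ?H 0 = (t - 0) * frechet_derivative (\<lambda>z. frechet_derivative f (at z) u) (at (x + a *\<^sub>R u + b *\<^sub>R v)) v"
    by (rule MVT2[OF t], rule line[OF smooth_on_derivative[OF f]]) (use sub a in auto)
  then obtain b where b: "0 < b" "b < t"
    and 2: "?H t - ?H 0 = t * frechet_derivative (\<lambda>z. frechet_derivative f (at z) u) (at (x + a *\<^sub>R u + b *\<^sub>R v)) v"
    by auto
  have "?H t - ?H 0 = frechet_derivative f (at (x + t *\<^sub>R v + a *\<^sub>R u)) u - frechet_derivative f (at (x + a *\<^sub>R u)) u"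
    by (simp add: algebra_simps)
  then have "?G t - ?G 0 = t\<^sup>2 * frechet_derivative (\<lambda>z. frechet_derivative f (at z) u) (at (x + a *\<^sub>R u + b *\<^sub>R v)) v"
    using 1 2 by (simp add: power2_eq_square)
  then show ?thesis
    using a b by (intro exI[of _ a] exI[of _ b]) (auto simp: algebra_simps)
qed

text \<open>The second difference over a parallelogram is symmetric in the two directions, so the
  two orders of differentiation take equal values at two nearby points; continuity of both moves the
  equality to x.\<close>

lemma mixed_derivatives_commute:
  fixes f :: "'m::real_normed_vector \<Rightarrow> real"
  assumes f: "smooth_on S f" and S: "open S" "x \<in> S"
  shows "frechet_derivative (\<lambda>z. frechet_derivative f (at z) u) (at x) v =
         frechet_derivative (\<lambda>z. frechet_derivative f (at z) v) (at x) u"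
proof -
  let ?A = "\<lambda>y. frechet_derivative (\<lambda>z. frechet_derivative f (at z) u) (at y) v"
  let ?B = "\<lambda>y. frechet_derivative (\<lambda>z. frechet_derivative f (at z) v) (at y) u"
  have "dist (?A x) (?B x) < 2 * e" if e: "e > 0" for e
  proof -
    have "continuous (at x) ?A" "continuous (at x) ?B"
      using smooth_on_imp_continuous_on[OF smooth_on_derivative[OF smooth_on_derivative[OF f]]] S
      by (auto simp: continuous_on_eq_continuous_at)
    then obtain d1 d2 where d12: "d1 > 0" "d2 > 0" "\<And>y. dist y x < d1 \<Longrightarrow> dist (?A y) (?A x) < e"
       "\<And>y. dist y x < d2 \<Longrightarrow> dist (?B y) (?B x) < e"
      using e unfolding continuous_at_eps_delta by metis
    obtain d3 where d3: "d3 > 0" "ball x d3 \<subseteq> S"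
      using S open_contains_ball by blast
    define d where "d = min d1 (min d2 d3)"
    define N where "N = norm u + norm v + 1"
    have N: "N > 0" unfolding N_def by (smt (verit) norm_ge_zero)
    \<comment> \<open>Every point of the parallelogram is then within t * N = d / 2 of x. The
      summand 1 in N keeps the division legal when u and v vanish.\<close>
    define t where "t = d / (2 * N)"
    have d: "d > 0" using d12 d3 by (auto simp: d_def)
    have t: "t > 0" using d N by (simp add: t_def)
    have near: "dist (x + a *\<^sub>R u + b *\<^sub>R v) x < d" if "0 \<le> a" "a \<le> t" "0 \<le> b" "b \<le> t" for a b
    proof -
      have "norm (a *\<^sub>R u + b *\<^sub>R v) \<le> t * norm u + t * norm v"
        using that by (intro norm_triangle_mono) (auto intro: mult_right_mono)
      also have "\<dots> \<le> t * N" using t by (simp add: algebra_simps N_def)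
      also have "\<dots> = d / 2" using N by (simp add: t_def)
      also have "\<dots> < d" using d by simp
      finally show ?thesis by (simp add: dist_norm add.assoc)
    qed
    have inS: "x + a *\<^sub>R u + b *\<^sub>R v \<in> S" if "0 \<le> a" "a \<le> t" "0 \<le> b" "b \<le> t" for a b
      using near[OF that] d3 by (auto simp: d_def dist_commute subset_iff)
    obtain a b where ab: "0 < a" "a < t" "0 < b" "b < t" and
      1: "f (x + t *\<^sub>R u + t *\<^sub>R v) - f (x + t *\<^sub>R u) - f (x + t *\<^sub>R v) + f x = t\<^sup>2 * ?A (x + a *\<^sub>R u + b *\<^sub>R v)"
      using mixed_derivative_value[OF f inS t] by blast
    have inS': "x + a *\<^sub>R v + b *\<^sub>R u \<in> S" if "0 \<le> a" "a \<le> t" "0 \<le> b" "b \<le> t" for a b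
      using inS[of b a] that by (simp add: algebra_simps)
    obtain a' b' where ab': "0 < a'" "a' < t" "0 < b'" "b' < t" and
      2: "f (x + t *\<^sub>R v + t *\<^sub>R u) - f (x + t *\<^sub>R v) - f (x + t *\<^sub>R u) + f x = t\<^sup>2 * ?B (x + a' *\<^sub>R v + b' *\<^sub>R u)"
      using mixed_derivative_value[OF f inS' t] by blast
    have "f (x + t *\<^sub>R v + t *\<^sub>R u) - f (x + t *\<^sub>R v) - f (x + t *\<^sub>R u) + f x
       = f (x + t *\<^sub>R u + t *\<^sub>R v) - f (x + t *\<^sub>R u) - f (x + t *\<^sub>R v) + f x"
      by (simp add: algebra_simps)
    with 1 2 t have "?A (x + a *\<^sub>R u + b *\<^sub>R v) = ?B (x + a' *\<^sub>R v + b' *\<^sub>R u)" by simp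
    moreover have "dist (?A (x + a *\<^sub>R u + b *\<^sub>R v)) (?A x) < e"
      using near[of a b] ab by (intro d12) (auto simp: d_def)
    moreover have "dist (?B (x + a' *\<^sub>R v + b' *\<^sub>R u)) (?B x) < e"
      using near[of b' a'] ab' by (intro d12) (auto simp: d_def algebra_simps)
    ultimately show ?thesis by (smt (verit) dist_commute dist_triangle)
  qed
  \<comment> \<open>For e equal to half the distance, a positive distance would be smaller than
    itself.\<close>
  from this[of "dist (?A x) (?B x) / 2"] show ?thesis by auto
qed

subsection \<open>Positive definite matrices indexed by a basis\<close>

text \<open>Symmetry is kept as a separate hypothesis. Positivity alone already makes the matrix
  invertible, on which the description of the inverse by \<open>minv\<close> relies.\<close>

definition posdef :: "('e::euclidean_space \<Rightarrow> 'e \<Rightarrow> real) \<Rightarrow> bool" where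
  "posdef m \<longleftrightarrow> (\<forall>u. u \<noteq> 0 \<longrightarrow> (\<Sum>i\<in>Basis. \<Sum>j\<in>Basis. m i j * (u \<bullet> i) * (u \<bullet> j)) > 0)"

text \<open>One step of Gaussian elimination. Iterating it gives smoothness of the inverse matrix without
  determinants.\<close>

lemma schur_complement_pos:
  fixes m :: "'i \<Rightarrow> 'i \<Rightarrow> real"
  assumes "finite I" "k \<notin> I" and pos: "\<And>u. \<exists>i\<in>insert k I. u i \<noteq> 0 \<Longrightarrow>
      (\<Sum>i\<in>insert k I. \<Sum>j\<in>insert k I. m i j * u i * u j) > 0"
  shows "m k k > 0"
    and "\<exists>i\<in>I. u i \<noteq> 0 \<Longrightarrow> (\<Sum>i\<in>I. \<Sum>j\<in>I. (m i j - m i k * m k j / m k k) * u i * u j) > 0"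
proof -
  have "(\<Sum>i\<in>insert k I. \<Sum>j\<in>insert k I. m i j * (if i = k then 1 else 0) * (if j = k then 1 else 0)) = m k k"
    using assms(1) by (simp add: if_distrib[where f="\<lambda>x. _ * x"] sum.delta cong: if_cong)
  then show kk: "m k k > 0" using pos[of "\<lambda>i. if i = k then 1 else 0"] by auto
  assume u: "\<exists>i\<in>I. u i \<noteq> 0"
  define s where "s = (\<Sum>j\<in>I. m k j * u j)"
  define r where "r = (\<Sum>i\<in>I. m i k * u i)"
  \<comment> \<open>This value makes row k of m annihilate v, so the whole form at v collapses to
    the form of the Schur complement at u.\<close>
  define v where "v = u(k := - s / m k k)"
  have v: "v k = - s / m k k" "\<And>i. i \<in> I \<Longrightarrow> v i = u i" using assms(2) by (auto simp: v_def)
  have sum2: "(\<Sum>i\<in>I. \<Sum>j\<in>I. m i k * m k j / m k k * u i * u j) = r * s / m k k"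
    unfolding r_def s_def sum_product sum_divide_distrib by (intro sum.cong refl) (simp add: algebra_simps)
  have "(\<Sum>i\<in>insert k I. \<Sum>j\<in>insert k I. m i j * v i * v j)
      = m k k * v k * v k + v k * s + v k * r + (\<Sum>i\<in>I. \<Sum>j\<in>I. m i j * u i * u j)"
    using assms(1,2) by (simp add: v(2) sum.distrib s_def r_def sum_distrib_left algebra_simps)
  also have "\<dots> = (\<Sum>i\<in>I. \<Sum>j\<in>I. m i j * u i * u j) - r * s / m k k"
    using kk by (simp add: v(1) field_simps)
  also have "\<dots> = (\<Sum>i\<in>I. \<Sum>j\<in>I. (m i j - m i k * m k j / m k k) * u i * u j)"
    unfolding sum2[symmetric] by (simp add: sum_subtractf[symmetric] algebra_simps)
  finally show "(\<Sum>i\<in>I. \<Sum>j\<in>I. (m i j - m i k * m k j / m k k) * u i * u j) > 0"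
    using pos[of v] u v(2) by (metis insertCI)
qed

text \<open>Elimination uses only sums, products and division by a positive pivot, all of which
  preserve smoothness in the parameter x. The index set is an arbitrary finite set so that the
  induction can remove one index.\<close>

lemma smooth_solution:
  fixes m :: "'i \<Rightarrow> 'i \<Rightarrow> 'x::real_normed_vector \<Rightarrow> real"
  assumes "finite I" "open S"
    and "\<And>i j. i \<in> I \<Longrightarrow> j \<in> I \<Longrightarrow> smooth_on S (m i j)" "\<And>i. i \<in> I \<Longrightarrow> smooth_on S (b i)"
    and "\<And>x u. x \<in> S \<Longrightarrow> \<exists>i\<in>I. u i \<noteq> 0 \<Longrightarrow> (\<Sum>i\<in>I. \<Sum>j\<in>I. m i j x * u i * u j) > 0"
  shows "\<exists>w. (\<forall>i\<in>I. smooth_on S (w i)) \<and> (\<forall>x\<in>S. \<forall>i\<in>I. (\<Sum>j\<in>I. m i j x * w j x) = b i x)"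
  using assms(1,3-)
proof (induction I arbitrary: m b)
  case empty
  then show ?case by simp
next
  case (insert k I)
  note pos = schur_complement_pos[OF insert.hyps insert.prems(3)]
  have kk: "m k k x > 0" if "x \<in> S" for x using pos(1)[OF that] by simp
  then have kk0: "m k k x \<noteq> 0" if "x \<in> S" for x using that by force
  let ?m = "\<lambda>i j x. m i j x - m i k x * m k j x / m k k x"
  let ?b = "\<lambda>i x. b i x - m i k x * b k x / m k k x"
  have "\<exists>w. (\<forall>i\<in>I. smooth_on S (w i)) \<and> (\<forall>x\<in>S. \<forall>i\<in>I. (\<Sum>j\<in>I. ?m i j x * w j x) = ?b i x)"
    using insert.prems(1,2) kk0 assms(2) pos(2)
    by (intro insert.IH smooth_on_diff smooth_on_divide smooth_on_mult) auto
  then obtain w where w: "\<And>i. i \<in> I \<Longrightarrow> smooth_on S (w i)"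
    "\<And>x i. x \<in> S \<Longrightarrow> i \<in> I \<Longrightarrow> (\<Sum>j\<in>I. ?m i j x * w j x) = ?b i x" by blast
  \<comment> \<open>Back substitution: row k determines the unknown that was eliminated.\<close>
  define z where "z = w(k := \<lambda>x. (b k x - (\<Sum>j\<in>I. m k j x * w j x)) / m k k x)"
  have z: "z k = (\<lambda>x. (b k x - (\<Sum>j\<in>I. m k j x * w j x)) / m k k x)" "\<And>i. i \<in> I \<Longrightarrow> z i = w i"
    using insert.hyps by (auto simp: z_def)
  have "smooth_on S (z i)" if "i \<in> insert k I" for i
  proof (cases "i = k")
    case True
    then show ?thesis unfolding True z(1)
      using w(1) insert.prems(1,2) kk0 assms(2)
      by (intro smooth_on_divide smooth_on_diff smooth_on_sum smooth_on_mult) auto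
  qed (use that w(1) z(2) in auto)
  moreover have "(\<Sum>j\<in>insert k I. m i j x * z j x) = b i x" if x: "x \<in> S" and i: "i \<in> insert k I" for x i
  proof (cases "i = k")
    case True
    then show ?thesis
      using insert.hyps kk0[OF x] z by simp
  next
    case False
    then have i: "i \<in> I" using i by simp
    have "?b i x = (\<Sum>j\<in>I. m i j x * w j x) - m i k x / m k k x * (\<Sum>j\<in>I. m k j x * w j x)"
      unfolding w(2)[OF x i, symmetric] sum_distrib_left sum_subtractf[symmetric]
      by (intro sum.cong refl) (simp add: algebra_simps)
    moreover have "(\<Sum>j\<in>insert k I. m i j x * z j x)
        = m i k x * ((b k x - (\<Sum>j\<in>I. m k j x * w j x)) / m k k x) + (\<Sum>j\<in>I. m i j x * w j x)"
      using insert.hyps z by simp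
    ultimately show ?thesis by (simp add: diff_divide_distrib algebra_simps)
  qed
  ultimately show ?case by blast
qed

lemma posdef_sum_pos:
  fixes m :: "'e::euclidean_space \<Rightarrow> 'e \<Rightarrow> real"
  assumes "posdef m" "\<exists>i\<in>Basis. u i \<noteq> 0"
  shows "(\<Sum>i\<in>Basis. \<Sum>j\<in>Basis. m i j * u i * u j) > 0"
proof -
  define v :: 'e where "v = (\<Sum>i\<in>Basis. u i *\<^sub>R i)"
  have v: "v \<bullet> i = u i" if "i \<in> Basis" for i using that by (simp add: v_def)
  then have "v \<noteq> 0" using assms(2) by auto
  then have "(\<Sum>i\<in>Basis. \<Sum>j\<in>Basis. m i j * (v \<bullet> i) * (v \<bullet> j)) > 0"
    using assms(1) unfolding posdef_def by blast
  then show ?thesis by (simp add: v cong: sum.cong)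
qed

text \<open>The form of m at the difference of two solutions is zero, which positivity permits only
  for the zero vector.\<close>

lemma posdef_solution_unique:
  fixes m :: "'e::euclidean_space \<Rightarrow> 'e \<Rightarrow> real"
  assumes "posdef m" "\<And>i. i \<in> Basis \<Longrightarrow> (\<Sum>j\<in>Basis. m i j * u j) = (\<Sum>j\<in>Basis. m i j * v j)" "j \<in> Basis"
  shows "u j = v j"
proof (rule ccontr)
  assume "u j \<noteq> v j"
  then have "(\<Sum>i\<in>Basis. \<Sum>j\<in>Basis. m i j * (u i - v i) * (u j - v j)) > 0"
    using assms(3) by (intro posdef_sum_pos[OF assms(1)]) auto
  moreover have "(\<Sum>j\<in>Basis. m i j * (u i - v i) * (u j - v j)) = 0" if "i \<in> Basis" for i
  proof -
    have "(\<Sum>j\<in>Basis. m i j * (u i - v i) * (u j - v j))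
      = (u i - v i) * ((\<Sum>j\<in>Basis. m i j * u j) - (\<Sum>j\<in>Basis. m i j * v j))"
      unfolding sum_subtractf[symmetric] sum_distrib_left by (simp add: algebra_simps)
    then show ?thesis using assms(2)[OF that] by simp
  qed
  ultimately show False by simp
qed

text \<open>\<open>minv\<close> is built from \<open>inv\<close> of a function, so surjectivity must
  come first; in finite dimension it follows from the injectivity that uniqueness of solutions
  provides.\<close>

lemma minv_right:
  fixes m :: "'e::euclidean_space \<Rightarrow> 'e \<Rightarrow> real"
  assumes "posdef m" "i \<in> Basis" "k \<in> Basis"
  shows "(\<Sum>j\<in>Basis. m i j * minv m j k) = (if i = k then 1 else 0)"
proof -
  define M :: "'e \<Rightarrow> 'e" where "M = (\<lambda>u. \<Sum>a\<in>Basis. (\<Sum>b\<in>Basis. m a b * (u \<bullet> b)) *\<^sub>R a)"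
  have M: "M u \<bullet> a = (\<Sum>b\<in>Basis. m a b * (u \<bullet> b))" if "a \<in> Basis" for u a
    using that by (simp add: M_def)
  have "linear M"
    by (rule linearI; rule euclidean_eqI)
      (simp_all add: M inner_add_left sum.distrib algebra_simps sum_distrib_left)
  moreover have "inj M"
  proof (rule injI, rule euclidean_eqI)
    fix x y b assume "M x = M y" and b: "b \<in> (Basis :: 'e set)"
    then show "x \<bullet> b = y \<bullet> b"
      using posdef_solution_unique[OF assms(1), of "\<lambda>b. x \<bullet> b" "\<lambda>b. y \<bullet> b"] by (simp add: M[symmetric])
  qed
  ultimately have "surj M" by (simp add: linear_injective_imp_surjective)
  then have "M (inv M k) = k" by (rule surj_f_inv_f)
  then have "(\<Sum>j\<in>Basis. m i j * (inv M k \<bullet> j)) = k \<bullet> i"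
    using M[OF assms(2)] by metis
  then show ?thesis
    using assms(2,3) by (simp add: minv_def M_def inner_Basis)
qed

lemma minv_eqI:
  fixes m :: "'e::euclidean_space \<Rightarrow> 'e \<Rightarrow> real"
  assumes "posdef m" "\<And>i. i \<in> Basis \<Longrightarrow> (\<Sum>j\<in>Basis. m i j * w j) = (if i = k then 1 else 0)"
    "j \<in> Basis" "k \<in> Basis"
  shows "minv m j k = w j"
  by (rule posdef_solution_unique[OF assms(1), of "\<lambda>j. minv m j k"]) (simp_all add: minv_right assms)

text \<open>As functions of i, both sides solve the linear system with column k of m on the right,
  because m times its right inverse times m is m.\<close>

lemma minv_left:
  fixes m :: "'e::euclidean_space \<Rightarrow> 'e \<Rightarrow> real"
  assumes "posdef m" "i \<in> Basis" "k \<in> Basis"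
  shows "(\<Sum>j\<in>Basis. minv m i j * m j k) = (if i = k then 1 else 0)"
proof (rule posdef_solution_unique[OF assms(1), of "\<lambda>i. \<Sum>j\<in>Basis. minv m i j * m j k"])
  fix l :: 'e assume l: "l \<in> Basis"
  have "(\<Sum>i\<in>Basis. m l i * (\<Sum>j\<in>Basis. minv m i j * m j k))
      = (\<Sum>j\<in>Basis. (\<Sum>i\<in>Basis. m l i * minv m i j) * m j k)"
    unfolding sum_distrib_left sum_distrib_right by (subst sum.swap) (simp add: algebra_simps)
  also have "\<dots> = (\<Sum>j\<in>Basis. (if j = l then m j k else 0))"
    by (intro sum.cong refl) (auto simp: minv_right assms l)
  also have "\<dots> = m l k" using l by simp
  finally show "(\<Sum>i\<in>Basis. m l i * (\<Sum>j\<in>Basis. minv m i j * m j k))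
      = (\<Sum>i\<in>Basis. m l i * (if i = k then 1 else 0))"
    using assms(3) by (simp add: if_distrib[where f="\<lambda>x. _ * x"] cong: if_cong)
qed (rule assms(2))

lemma minv_apply:
  fixes m :: "'e::euclidean_space \<Rightarrow> 'e \<Rightarrow> real"
  assumes "posdef m" "i \<in> Basis"
  shows "(\<Sum>j\<in>Basis. minv m i j * (\<Sum>k\<in>Basis. m j k * v k)) = v i"
proof -
  have "(\<Sum>j\<in>Basis. minv m i j * (\<Sum>k\<in>Basis. m j k * v k))
     = (\<Sum>k\<in>Basis. (\<Sum>j\<in>Basis. minv m i j * m j k) * v k)"
    unfolding sum_distrib_left sum_distrib_right by (subst sum.swap) (simp add: algebra_simps)
  also have "\<dots> = (\<Sum>k\<in>Basis. (if k = i then v k else 0))"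
    by (intro sum.cong refl) (auto simp: minv_left assms)
  finally show ?thesis using assms(2) by simp
qed

text \<open>For symmetric m the transposed inverse satisfies the equations that determine the
  inverse.\<close>

lemma minv_sym:
  fixes m :: "'e::euclidean_space \<Rightarrow> 'e \<Rightarrow> real"
  assumes "posdef m" "\<And>i j. i \<in> Basis \<Longrightarrow> j \<in> Basis \<Longrightarrow> m i j = m j i" "i \<in> Basis" "k \<in> Basis"
  shows "minv m i k = minv m k i"
proof (rule minv_eqI[OF assms(1) _ assms(3,4)])
  fix l :: 'e assume l: "l \<in> Basis"
  have "(\<Sum>j\<in>Basis. m l j * minv m k j) = (\<Sum>j\<in>Basis. minv m k j * m j l)"
    by (intro sum.cong refl) (simp add: assms(2)[OF l])
  also have "\<dots> = (if l = k then 1 else 0)" using minv_left[OF assms(1,4) l] by auto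
  finally show "(\<Sum>j\<in>Basis. m l j * minv m k j) = (if l = k then 1 else 0)" .
qed

lemma minv_trace:
  fixes m :: "'e::euclidean_space \<Rightarrow> 'e \<Rightarrow> real"
  assumes "posdef m" "\<And>i j. i \<in> Basis \<Longrightarrow> j \<in> Basis \<Longrightarrow> m i j = m j i"
  shows "(\<Sum>i\<in>Basis. \<Sum>j\<in>Basis. minv m i j * m i j) = real DIM('e)"
proof -
  have "(\<Sum>j\<in>Basis. minv m i j * m i j) = 1" if i: "i \<in> Basis" for i
    using minv_left[OF assms(1) i i] assms(2)[OF i] by simp
  then show ?thesis by simp
qed

text \<open>With u the image of v under the inverse matrix, the inverse form at v equals the form of
  m at u.\<close>

lemma minv_posdef:
  fixes m :: "'e::euclidean_space \<Rightarrow> 'e \<Rightarrow> real"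
  assumes "posdef m"
  shows "posdef (minv m)"
  unfolding posdef_def
proof (intro allI impI)
  fix v :: 'e assume "v \<noteq> 0"
  define u where "u i = (\<Sum>j\<in>Basis. minv m i j * (v \<bullet> j))" for i
  have mu: "(\<Sum>j\<in>Basis. m i j * u j) = v \<bullet> i" if i: "i \<in> Basis" for i
  proof -
    have "(\<Sum>j\<in>Basis. m i j * u j) = (\<Sum>k\<in>Basis. (\<Sum>j\<in>Basis. m i j * minv m j k) * (v \<bullet> k))"
      unfolding u_def sum_distrib_left sum_distrib_right by (subst sum.swap) (simp add: algebra_simps)
    also have "\<dots> = (\<Sum>k\<in>Basis. (if k = i then v \<bullet> k else 0))"
      by (intro sum.cong refl) (auto simp: minv_right assms i)
    finally show ?thesis using i by simp
  qed
  have "\<exists>i\<in>Basis. u i \<noteq> 0"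
  proof (rule ccontr)
    assume "\<not> (\<exists>i\<in>Basis. u i \<noteq> 0)"
    then have "v \<bullet> b = 0 \<bullet> b" if "b \<in> Basis" for b using mu[OF that] by simp
    then have "v = 0" by (rule euclidean_eqI)
    with \<open>v \<noteq> 0\<close> show False by simp
  qed
  then have "0 < (\<Sum>i\<in>Basis. \<Sum>j\<in>Basis. m i j * u i * u j)"
    by (rule posdef_sum_pos[OF assms])
  also have "\<dots> = (\<Sum>i\<in>Basis. u i * (\<Sum>j\<in>Basis. m i j * u j))"
    by (simp add: sum_distrib_left algebra_simps)
  also have "\<dots> = (\<Sum>i\<in>Basis. \<Sum>j\<in>Basis. minv m i j * (v \<bullet> i) * (v \<bullet> j))"
    by (intro sum.cong refl) (simp add: mu, simp add: u_def sum_distrib_right sum_distrib_left algebra_simps)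
  finally show "0 < (\<Sum>i\<in>Basis. \<Sum>j\<in>Basis. minv m i j * (v \<bullet> i) * (v \<bullet> j))" .
qed

text \<open>Column j of the inverse solves the system with the unit vector j on the right, hence
  agrees with the smooth solution.\<close>

lemma smooth_on_minv:
  fixes m :: "'e::euclidean_space \<Rightarrow> 'e \<Rightarrow> 'x::real_normed_vector \<Rightarrow> real"
  assumes S: "open S" and m: "\<And>i j. i \<in> Basis \<Longrightarrow> j \<in> Basis \<Longrightarrow> smooth_on S (m i j)"
    and pos: "\<And>x. x \<in> S \<Longrightarrow> posdef (\<lambda>i j. m i j x)" and ij: "i \<in> Basis" "j \<in> Basis"
  shows "smooth_on S (\<lambda>x. minv (\<lambda>a b. m a b x) i j)"
proof -
  have "\<exists>w. (\<forall>i\<in>Basis. smooth_on S (w i)) \<and>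
    (\<forall>x\<in>S. \<forall>i\<in>Basis. (\<Sum>k\<in>Basis. m i k x * w k x) = (\<lambda>i x. if i = j then 1 else 0) i x)"
    by (rule smooth_solution) (use S m posdef_sum_pos[OF pos] in auto)
  then obtain w where w: "\<And>i. i \<in> Basis \<Longrightarrow> smooth_on S (w i)"
    "\<And>x i. x \<in> S \<Longrightarrow> i \<in> Basis \<Longrightarrow> (\<Sum>k\<in>Basis. m i k x * w k x) = (if i = j then 1 else 0)" by blast
  have "minv (\<lambda>a b. m a b x) i j = w i x" if "x \<in> S" for x
    by (rule minv_eqI[OF pos[OF that] _ ij]) (rule w(2)[OF that])
  then show ?thesis using w(1)[OF ij(1)] by (subst smooth_on_cong[OF S, of _ "w i"])
qed

lemma minv_cong:
  assumes "\<And>a b. a \<in> Basis \<Longrightarrow> b \<in> Basis \<Longrightarrow> m a b = m' a b"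
  shows "minv m i j = minv m' i j"
  unfolding minv_def using assms by (simp cong: sum.cong)

lemma posdef_cong:
  assumes "\<And>a b. a \<in> Basis \<Longrightarrow> b \<in> Basis \<Longrightarrow> m a b = m' a b"
  shows "posdef m \<longleftrightarrow> posdef m'"
  unfolding posdef_def using assms by (simp cong: sum.cong)

lemma sum_Basis_delta:
  assumes "l \<in> Basis"
  shows "(\<Sum>a\<in>Basis. c a * (l \<bullet> a)) = (c l :: real)"
proof -
  have "(\<Sum>a\<in>Basis. c a * (l \<bullet> a)) = (\<Sum>a\<in>Basis. if a = l then c a else 0)"
    using assms by (intro sum.cong refl) (auto simp: inner_Basis)
  then show ?thesis using assms by simp
qed

lemma sum_Basis_prod:
  fixes h :: "'a::euclidean_space \<times> 'b::euclidean_space \<Rightarrow> 'c::comm_monoid_add"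
  shows "sum h Basis = (\<Sum>i\<in>Basis. h (i, 0)) + (\<Sum>i\<in>Basis. h (0, i))"
proof -
  have "inj_on (\<lambda>u. (u::'a, 0::'b)) Basis" "inj_on (\<lambda>u. (0::'a, u::'b)) Basis"
    by (auto intro!: inj_onI)
  then show ?thesis
    unfolding Basis_prod_def by (subst sum.union_disjoint) (auto simp: sum.reindex)
qed

text \<open>Splitting off the rank one matrix a i k * a j k / a k k leaves the Schur complement, to
  which the induction applies: a Cholesky factorisation.\<close>

lemma posdef_decomposition:
  fixes a :: "'i \<Rightarrow> 'i \<Rightarrow> real"
  assumes "finite I" "\<And>i j. i \<in> I \<Longrightarrow> j \<in> I \<Longrightarrow> a i j = a j i"
    and "\<And>u. \<exists>i\<in>I. u i \<noteq> 0 \<Longrightarrow> (\<Sum>i\<in>I. \<Sum>j\<in>I. a i j * u i * u j) > 0"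
  shows "\<exists>v. \<forall>i\<in>I. \<forall>j\<in>I. a i j = (\<Sum>k\<in>I. v k i * v k j)"
  using assms
proof (induction I arbitrary: a)
  case empty
  then show ?case by simp
next
  case (insert k I)
  note pos = schur_complement_pos[OF insert.hyps insert.prems(2)]
  have kk: "a k k > 0" using pos(1) .
  have "\<exists>v. \<forall>i\<in>I. \<forall>j\<in>I. a i j - a i k * a k j / a k k = (\<Sum>l\<in>I. v l i * v l j)"
  proof (rule insert.IH)
    show "a i j - a i k * a k j / a k k = a j i - a j k * a k i / a k k" if "i \<in> I" "j \<in> I" for i j
      using insert.prems(1)[of i j] insert.prems(1)[of i k] insert.prems(1)[of k j] that by simp
  qed (use pos(2) in blast)
  then obtain v where v: "\<And>i j. i \<in> I \<Longrightarrow> j \<in> I \<Longrightarrow> a i j - a i k * a k j / a k k = (\<Sum>l\<in>I. v l i * v l j)" by blast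
  define w where "w l i = (if l = k then a i k / sqrt (a k k) else if i = k then 0 else v l i)" for l i
  have wk: "w k i = a i k / sqrt (a k k)" for i by (simp add: w_def)
  have wl: "(\<Sum>l\<in>I. w l i * w l j) = (if i = k \<or> j = k then 0 else \<Sum>l\<in>I. v l i * v l j)" for i j
    using insert.hyps by (auto simp: w_def intro!: sum.neutral sum.cong)
  have "a i j = (\<Sum>l\<in>insert k I. w l i * w l j)" if "i \<in> insert k I" "j \<in> insert k I" for i j
  proof -
    have "(\<Sum>l\<in>insert k I. w l i * w l j) = a i k * a j k / a k k + (if i = k \<or> j = k then 0 else \<Sum>l\<in>I. v l i * v l j)"
      using insert.hyps kk by (simp add: wl wk)
    also have "\<dots> = a i j"
      using v[of i j] insert.prems(1)[of i k] insert.prems(1)[of j k] that kk by auto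
    finally show ?thesis by simp
  qed
  then show ?case by blast
qed

text \<open>Writing a as a sum of rank one matrices turns the trace into a sum of values of the form
  H. The maximum principle uses this with H the second derivatives at a maximum.\<close>

lemma posdef_trace_nonpos:
  fixes a :: "'e::euclidean_space \<Rightarrow> 'e \<Rightarrow> real"
  assumes "posdef a" "\<And>i j. i \<in> Basis \<Longrightarrow> j \<in> Basis \<Longrightarrow> a i j = a j i"
    and H: "\<And>v. (\<Sum>i\<in>Basis. \<Sum>j\<in>Basis. (v \<bullet> i) * (v \<bullet> j) * H i j) \<le> 0"
  shows "(\<Sum>i\<in>Basis. \<Sum>j\<in>Basis. a i j * H i j) \<le> 0"
proof -
  have "\<exists>v. \<forall>i\<in>Basis. \<forall>j\<in>Basis. a i j = (\<Sum>k\<in>(Basis :: 'e set). v k i * v k j)"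
    by (rule posdef_decomposition[OF finite_Basis assms(2) posdef_sum_pos[OF assms(1)]])
  then obtain v where v: "\<And>i j. i \<in> Basis \<Longrightarrow> j \<in> Basis \<Longrightarrow> a i j = (\<Sum>k\<in>(Basis :: 'e set). v k i * v k j)"
    by blast
  have "(\<Sum>i\<in>Basis. \<Sum>j\<in>Basis. a i j * H i j) = (\<Sum>i\<in>Basis. \<Sum>j\<in>Basis. \<Sum>k\<in>Basis. v k i * v k j * H i j)"
    by (simp add: v sum_distrib_right)
  also have "\<dots> = (\<Sum>k\<in>Basis. \<Sum>i\<in>Basis. \<Sum>j\<in>Basis. v k i * v k j * H i j)"
    by (subst (2) sum.swap, subst sum.swap) simp
  also have "\<dots> \<le> 0"
  proof (rule sum_nonpos)
    fix k :: 'e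
    define w :: 'e where "w = (\<Sum>i\<in>Basis. v k i *\<^sub>R i)"
    have "w \<bullet> i = v k i" if "i \<in> Basis" for i using that by (simp add: w_def)
    then show "(\<Sum>i\<in>Basis. \<Sum>j\<in>Basis. v k i * v k j * H i j) \<le> 0"
      using H[of w] by (simp cong: sum.cong)
  qed
  finally show ?thesis .
qed

subsection \<open>Partial derivatives on the tangent bundle\<close>

text \<open>\<open>dx\<close> and \<open>dy\<close> act on curried functions with one variable
  frozen; joint smoothness is what lets them be iterated and interchanged.\<close>

definition smooth2 :: "('e::euclidean_space \<times> 'e) set \<Rightarrow> ('e \<Rightarrow> 'e \<Rightarrow> real) \<Rightarrow> bool" where
  "smooth2 W L \<longleftrightarrow> smooth_on W (\<lambda>z. L (fst z) (snd z))"

lemma smooth2_cong: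
  assumes "open W" "\<And>x y. (x, y) \<in> W \<Longrightarrow> L x y = M x y"
  shows "smooth2 W L \<longleftrightarrow> smooth2 W M"
  unfolding smooth2_def by (rule smooth_on_cong) (use assms in auto)

lemma smooth2_const: "open W \<Longrightarrow> smooth2 W (\<lambda>x y. c)"
  unfolding smooth2_def by (rule smooth_on_const)

lemma smooth2_add: "open W \<Longrightarrow> smooth2 W A \<Longrightarrow> smooth2 W B \<Longrightarrow> smooth2 W (\<lambda>x y. A x y + B x y)"
  unfolding smooth2_def by (rule smooth_on_add)

lemma smooth2_diff: "open W \<Longrightarrow> smooth2 W A \<Longrightarrow> smooth2 W B \<Longrightarrow> smooth2 W (\<lambda>x y. A x y - B x y)"
  unfolding smooth2_def by (rule smooth_on_diff)

lemma smooth2_mult: "open W \<Longrightarrow> smooth2 W A \<Longrightarrow> smooth2 W B \<Longrightarrow> smooth2 W (\<lambda>x y. A x y * B x y)"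
  unfolding smooth2_def by (rule smooth_on_mult)

lemma smooth2_divide:
  "open W \<Longrightarrow> smooth2 W A \<Longrightarrow> smooth2 W B \<Longrightarrow> (\<And>x y. (x, y) \<in> W \<Longrightarrow> B x y \<noteq> 0) \<Longrightarrow> smooth2 W (\<lambda>x y. A x y / B x y)"
  unfolding smooth2_def by (rule smooth_on_divide) auto

lemma smooth2_sum: "open W \<Longrightarrow> (\<And>i. i \<in> I \<Longrightarrow> smooth2 W (A i)) \<Longrightarrow> smooth2 W (\<lambda>x y. \<Sum>i\<in>I. A i x y)"
  unfolding smooth2_def by (rule smooth_on_sum)

lemma smooth2_base:
  assumes "open W" "open X" "W \<subseteq> X \<times> UNIV" "smooth_on X u"
  shows "smooth2 W (\<lambda>x y. u x)"
  unfolding smooth2_def by (rule smooth_on_comp_linear[OF assms(1,2) bounded_linear_fst _ assms(4)]) (use assms(3) in auto)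

lemma smooth2_inner: "open W \<Longrightarrow> smooth2 W (\<lambda>x y. y \<bullet> b)"
  unfolding smooth2_def
  by (intro smooth_on_linear bounded_linear_inner_left_comp bounded_linear_snd)

lemma dx_joint:
  assumes "smooth2 W L" "(x, y) \<in> W"
  shows "dx k L x y = frechet_derivative (\<lambda>z. L (fst z) (snd z)) (at (x, y)) (k, 0)"
proof -
  have "((\<lambda>x. (x, y)) has_derivative (\<lambda>h. (h, 0))) (at x)"
    by (auto intro!: derivative_eq_intros)
  from diff_chain_at[OF this smooth_on_has_derivative[OF assms(1)[unfolded smooth2_def] assms(2)]]
  show ?thesis unfolding dx_def by (auto simp: o_def dest!: frechet_derivative_at[symmetric])
qed

lemma dy_joint:
  assumes "smooth2 W L" "(x, y) \<in> W"
  shows "dy k L x y = frechet_derivative (\<lambda>z. L (fst z) (snd z)) (at (x, y)) (0, k)"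
proof -
  have "((\<lambda>y. (x, y)) has_derivative (\<lambda>h. (0, h))) (at y)"
    by (auto intro!: derivative_eq_intros)
  from diff_chain_at[OF this smooth_on_has_derivative[OF assms(1)[unfolded smooth2_def] assms(2)]]
  show ?thesis unfolding dy_def by (auto simp: o_def dest!: frechet_derivative_at[symmetric])
qed

lemma smooth2_dx: "open W \<Longrightarrow> smooth2 W L \<Longrightarrow> smooth2 W (dx k L)"
  unfolding smooth2_def
  by (rule smooth_on_cong[THEN iffD1, OF _ _ smooth_on_derivative[of _ _ "(k, 0)"]])
    (auto simp: dx_joint[OF smooth2_def[THEN iffD2]])

lemma smooth2_dy: "open W \<Longrightarrow> smooth2 W L \<Longrightarrow> smooth2 W (dy k L)"
  unfolding smooth2_def
  by (rule smooth_on_cong[THEN iffD1, OF _ _ smooth_on_derivative[of _ _ "(0, k)"]])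
    (auto simp: dy_joint[OF smooth2_def[THEN iffD2]])

lemma dx_DERIV:
  assumes "smooth2 W L" "(x, y) \<in> W"
  shows "((\<lambda>t. L (x + t *\<^sub>R k) y) has_real_derivative dx k L x y) (at 0)"
  using smooth_on_DERIV_line[OF assms(1)[unfolded smooth2_def], of "(x, y)" 0 "(k, 0)"] assms
  by (simp add: dx_joint)

lemma dy_DERIV:
  assumes "smooth2 W L" "(x, y) \<in> W"
  shows "((\<lambda>t. L x (y + t *\<^sub>R k)) has_real_derivative dy k L x y) (at 0)"
  using smooth_on_DERIV_line[OF assms(1)[unfolded smooth2_def], of "(x, y)" 0 "(0, k)"] assms
  by (simp add: dy_joint)

lemma partial_DERIV:
  assumes "smooth_on X u" "x \<in> X"
  shows "((\<lambda>t. u (x + t *\<^sub>R k)) has_real_derivative partial k u x) (at 0)"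
  using smooth_on_DERIV_line[OF assms(1), of x 0 k] assms(2) by (simp add: partial_def)

lemma dx_eqI:
  assumes "smooth2 W L" "(x, y) \<in> W" "((\<lambda>t. L (x + t *\<^sub>R k) y) has_real_derivative D) (at 0)"
  shows "dx k L x y = D"
  using DERIV_unique[OF dx_DERIV[OF assms(1,2)] assms(3)] .

lemma dy_eqI:
  assumes "smooth2 W L" "(x, y) \<in> W" "((\<lambda>t. L x (y + t *\<^sub>R k)) has_real_derivative D) (at 0)"
  shows "dy k L x y = D"
  using DERIV_unique[OF dy_DERIV[OF assms(1,2)] assms(3)] .

lemma partial_eqI:
  assumes "smooth_on X u" "x \<in> X" "((\<lambda>t. u (x + t *\<^sub>R k)) has_real_derivative D) (at 0)"
  shows "partial k u x = D"
  using DERIV_unique[OF partial_DERIV[OF assms(1,2)] assms(3)] .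

lemma dx_cong:
  assumes "open W" "(x, y) \<in> W" "\<And>x y. (x, y) \<in> W \<Longrightarrow> L x y = M x y"
  shows "dx k L x y = dx k M x y"
proof -
  have "open ((\<lambda>x. (x, y)) -` W)"
    by (intro open_vimage assms(1) continuous_intros)
  then show ?thesis
    unfolding dx_def using assms(2,3) by (subst frechet_derivative_cong_open[of _ x "\<lambda>x. L x y" "\<lambda>x. M x y"]) auto
qed

lemma dy_cong:
  assumes "open W" "(x, y) \<in> W" "\<And>x y. (x, y) \<in> W \<Longrightarrow> L x y = M x y"
  shows "dy k L x y = dy k M x y"
proof -
  have "open (Pair x -` W)"
    by (intro open_vimage assms(1) continuous_intros)
  then show ?thesis
    unfolding dy_def using assms(2,3) by (subst frechet_derivative_cong_open[of _ y "L x" "M x"]) auto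
qed

text \<open>The working rule for the warped product, together with its analogue for
  \<open>dy\<close>: pass from L to a formula M valid on W, then differentiate M along a single line
  with the one-variable rules.\<close>

lemma dx_eqI':
  assumes "open W" "(x, y) \<in> W" "\<And>x y. (x, y) \<in> W \<Longrightarrow> L x y = M x y" "smooth2 W M"
    "((\<lambda>t. M (x + t *\<^sub>R k) y) has_real_derivative D) (at 0)"
  shows "dx k L x y = D"
  using dx_cong[OF assms(1-3)] dx_eqI[OF assms(4,2,5)] by simp

lemma dy_eqI':
  assumes "open W" "(x, y) \<in> W" "\<And>x y. (x, y) \<in> W \<Longrightarrow> L x y = M x y" "smooth2 W M"
    "((\<lambda>t. M x (y + t *\<^sub>R k)) has_real_derivative D) (at 0)"
  shows "dy k L x y = D"
  using dy_cong[OF assms(1-3)] dy_eqI[OF assms(4,2,5)] by simp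

lemma partial_cong:
  assumes "open X" "x \<in> X" "\<And>x. x \<in> X \<Longrightarrow> u x = v x"
  shows "partial k u x = partial k v x"
  unfolding partial_def using frechet_derivative_cong_open[OF assms] by simp

lemma smooth_on_partial: "smooth_on X u \<Longrightarrow> smooth_on X (partial k u)"
  unfolding partial_def[abs_def] by (rule smooth_on_derivative)

lemma frechet_derivative_partial:
  assumes "smooth_on S u" "x \<in> S"
  shows "frechet_derivative u (at x) v = (\<Sum>j\<in>Basis. (v \<bullet> j) * partial j u x)"
proof -
  have l: "linear (frechet_derivative u (at x))"
    using has_derivative_linear[OF smooth_on_has_derivative[OF assms]] .
  have "frechet_derivative u (at x) v = frechet_derivative u (at x) (\<Sum>j\<in>Basis. (v \<bullet> j) *\<^sub>R j)"
    by (simp add: euclidean_representation)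
  also have "\<dots> = (\<Sum>j\<in>Basis. (v \<bullet> j) * partial j u x)"
    by (subst linear_sum[OF l]) (simp add: linear_cmul[OF l] partial_def)
  finally show ?thesis .
qed

lemma partial_sum:
  assumes "open S" "\<And>i. i \<in> I \<Longrightarrow> smooth_on S (u i)" "x \<in> S"
  shows "partial k (\<lambda>x. \<Sum>i\<in>I. c i * u i x) x = (\<Sum>i\<in>I. c i * partial k (u i) x)"
proof (rule partial_eqI[OF _ assms(3)])
  show "smooth_on S (\<lambda>x. \<Sum>i\<in>I. c i * u i x)"
    by (intro smooth_on_sum smooth_on_mult smooth_on_const assms)
  show "((\<lambda>t. \<Sum>i\<in>I. c i * u i (x + t *\<^sub>R k)) has_real_derivative (\<Sum>i\<in>I. c i * partial k (u i) x)) (at 0)"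
    by (intro DERIV_sum DERIV_cmult partial_DERIV[OF assms(2) assms(3)])
qed

lemma dx_sum:
  assumes "open W" "\<And>i. i \<in> I \<Longrightarrow> smooth2 W (A i)" "(x, y) \<in> W"
  shows "dx k (\<lambda>x y. \<Sum>i\<in>I. A i x y) x y = (\<Sum>i\<in>I. dx k (A i) x y)"
  by (rule dx_eqI[OF smooth2_sum[OF assms(1,2)] assms(3)])
    (auto intro!: DERIV_sum dx_DERIV[OF assms(2,3)])

lemma dy_sum:
  assumes "open W" "\<And>i. i \<in> I \<Longrightarrow> smooth2 W (A i)" "(x, y) \<in> W"
  shows "dy k (\<lambda>x y. \<Sum>i\<in>I. A i x y) x y = (\<Sum>i\<in>I. dy k (A i) x y)"
  by (rule dy_eqI[OF smooth2_sum[OF assms(1,2)] assms(3)])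
    (auto intro!: DERIV_sum dy_DERIV[OF assms(2,3)])

lemma dy_expand:
  assumes "smooth2 W L" "(x, y) \<in> W"
  shows "dy v L x y = (\<Sum>j\<in>Basis. (v \<bullet> j) * dy j L x y)"
proof -
  let ?D = "frechet_derivative (\<lambda>z. L (fst z) (snd z)) (at (x, y))"
  have lin: "linear ?D"
    using has_derivative_linear[OF smooth_on_has_derivative[OF assms[unfolded smooth2_def]]] .
  have "linear (\<lambda>v. (0 :: 'a, v :: 'a))" by (rule linearI) auto
  from linear_compose[OF this lin] have l: "linear (\<lambda>v. ?D (0, v))" by (simp add: o_def)
  have "?D (0, v) = ?D (0, \<Sum>j\<in>Basis. (v \<bullet> j) *\<^sub>R j)" by (simp add: euclidean_representation)
  also have "\<dots> = (\<Sum>j\<in>Basis. (v \<bullet> j) * ?D (0, j))"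
    by (subst linear_sum[OF l]) (simp add: linear_cmul[OF l])
  finally show ?thesis by (simp add: dy_joint[OF assms])
qed

lemma dy_scale:
  assumes "smooth2 W L" "(x, y) \<in> W"
  shows "dy k (\<lambda>x y. c x * L x y) x y = c x * dy k L x y"
proof -
  have "((\<lambda>y. (x, y)) has_derivative (\<lambda>h. (0, h))) (at y)"
    by (auto intro!: derivative_eq_intros)
  from diff_chain_at[OF this smooth_on_has_derivative[OF assms(1)[unfolded smooth2_def] assms(2)]]
  have d: "(L x has_derivative (\<lambda>h. frechet_derivative (\<lambda>z. L (fst z) (snd z)) (at (x, y)) (0, h))) (at y)"
    by (simp add: o_def)
  from frechet_derivative_at[OF has_derivative_mult_right[OF d, of "c x"], symmetric] show ?thesis
    by (simp add: dy_def[of k "\<lambda>x y. c x * L x y"] dy_joint[OF assms])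
qed

text \<open>The coefficients are not symmetrised, so the two index positions contribute
  separately.\<close>

lemma dy_quadratic:
  assumes "l \<in> Basis"
  shows "dy l (\<lambda>x y. \<Sum>a\<in>Basis. \<Sum>b\<in>Basis. q a b x * (y \<bullet> a) * (y \<bullet> b)) x y
      = (\<Sum>b\<in>Basis. (q l b x + q b l x) * (y \<bullet> b))"
proof -
  have "((\<lambda>y. \<Sum>a\<in>Basis. \<Sum>b\<in>Basis. q a b x * (y \<bullet> a) * (y \<bullet> b)) has_derivative
      (\<lambda>v. \<Sum>a\<in>Basis. \<Sum>b\<in>Basis. q a b x * (v \<bullet> a) * (y \<bullet> b) + q a b x * (y \<bullet> a) * (v \<bullet> b))) (at y)"
    by (auto intro!: derivative_eq_intros has_derivative_sum simp: algebra_simps)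
  from frechet_derivative_at[OF this, symmetric]
  have "dy l (\<lambda>x y. \<Sum>a\<in>Basis. \<Sum>b\<in>Basis. q a b x * (y \<bullet> a) * (y \<bullet> b)) x y
     = (\<Sum>a\<in>Basis. \<Sum>b\<in>Basis. q a b x * (l \<bullet> a) * (y \<bullet> b) + q a b x * (y \<bullet> a) * (l \<bullet> b))"
    by (simp add: dy_def)
  also have "\<dots> = (\<Sum>a\<in>Basis. (\<Sum>b\<in>Basis. q a b x * (y \<bullet> b)) * (l \<bullet> a)) + (\<Sum>a\<in>Basis. \<Sum>b\<in>Basis. q a b x * (y \<bullet> a) * (l \<bullet> b))"
    by (simp add: sum.distrib sum_distrib_left sum_distrib_right algebra_simps)
  also have "\<dots> = (\<Sum>b\<in>Basis. q l b x * (y \<bullet> b)) + (\<Sum>b\<in>Basis. q b l x * (y \<bullet> b))"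
    by (simp only: sum_Basis_delta[OF assms])
  finally show ?thesis by (simp add: sum.distrib algebra_simps)
qed

lemma dy_linear:
  assumes "l \<in> Basis"
  shows "dy l (\<lambda>x y. \<Sum>b\<in>Basis. c b x * (y \<bullet> b)) x y = c l x"
proof -
  have "((\<lambda>y. \<Sum>b\<in>Basis. c b x * (y \<bullet> b)) has_derivative (\<lambda>v. \<Sum>b\<in>Basis. c b x * (v \<bullet> b))) (at y)"
    by (auto intro!: derivative_eq_intros has_derivative_sum)
  from frechet_derivative_at[OF this, symmetric] show ?thesis
    by (simp add: dy_def sum_Basis_delta[OF assms])
qed

lemma dy_commute:
  assumes "open W" "smooth2 W L" "(x, y) \<in> W"
  shows "dy i (dy j L) x y = dy j (dy i L) x y"
proof -
  have *: "dy i (dy j L) x y = frechet_derivative (\<lambda>z. frechet_derivative (\<lambda>z. L (fst z) (snd z)) (at z) (0, j)) (at (x, y)) (0, i)" for i j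
    by (subst dy_joint[OF smooth2_dy[OF assms(1,2)] assms(3)],
        subst frechet_derivative_cong_open[OF assms(1,3), of _ "\<lambda>z. frechet_derivative (\<lambda>z. L (fst z) (snd z)) (at z) (0, j)"])
      (auto simp: dy_joint[OF assms(2)])
  show ?thesis
    unfolding * by (rule mixed_derivatives_commute[OF assms(2)[unfolded smooth2_def] assms(1,3)])
qed

section \<open>Homogeneous functions and Euler's identity\<close>

definition homog :: "nat \<Rightarrow> ('e::euclidean_space \<times> 'e) set \<Rightarrow> ('e \<Rightarrow> 'e \<Rightarrow> real) \<Rightarrow> bool" where
  "homog r W L \<longleftrightarrow> (\<forall>(x, y)\<in>W. \<forall>t>0. L x (t *\<^sub>R y) = t ^ r * L x y)"

lemma homogI: "(\<And>x y t. (x, y) \<in> W \<Longrightarrow> t > 0 \<Longrightarrow> L x (t *\<^sub>R y) = t ^ r * L x y) \<Longrightarrow> homog r W L"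
  unfolding homog_def by auto

lemma homogD: "homog r W L \<Longrightarrow> (x, y) \<in> W \<Longrightarrow> t > 0 \<Longrightarrow> L x (t *\<^sub>R y) = t ^ r * L x y"
  unfolding homog_def by auto

text \<open>Differentiate L x ((1 + t) y) = (1 + t)^r L x y at t = 0.\<close>

lemma euler_homog:
  assumes "smooth2 W L" "homog r W L" "(x, y) \<in> W"
  shows "(\<Sum>j\<in>Basis. (y \<bullet> j) * dy j L x y) = real r * L x y"
proof -
  have d: "((\<lambda>t. (1 + t) ^ r * L x y) has_real_derivative real r * L x y) (at 0)"
    by (auto intro!: derivative_eq_intros)
  have "((\<lambda>t. L x (y + t *\<^sub>R y)) has_real_derivative real r * L x y) (at 0)"
  \<comment> \<open>The scaling law holds for positive factors only, hence the restriction to t >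
    -1.\<close>
  proof (rule has_field_derivative_transform_within_open[OF d, of "{-1<..}"])
    fix t :: real assume "t \<in> {-1<..}"
    then have "L x ((1 + t) *\<^sub>R y) = (1 + t) ^ r * L x y" by (intro homogD[OF assms(2,3)]) simp
    then show "(1 + t) ^ r * L x y = L x (y + t *\<^sub>R y)" by (simp add: algebra_simps)
  qed auto
  from dy_eqI[OF assms(1,3) this] show ?thesis
    unfolding dy_expand[OF assms(1,3), of y] .
qed

text \<open>Covers the slit tangent bundle as well as the product of two slit bundles, on which the
  warped metric is regular.\<close>

locale conic_domain =
  fixes W :: "('e::euclidean_space \<times> 'e) set"
  assumes openW: "open W" and cone: "\<And>x y t. (x, y) \<in> W \<Longrightarrow> t > 0 \<Longrightarrow> (x, t *\<^sub>R y) \<in> W"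
begin

lemma eventually_line_in: "(x, y) \<in> W \<Longrightarrow> \<exists>S. open S \<and> 0 \<in> S \<and> (\<forall>t\<in>S. (x + t *\<^sub>R u, y + t *\<^sub>R v) \<in> W)"
proof (intro exI conjI)
  show "open ((\<lambda>t::real. (x + t *\<^sub>R u, y + t *\<^sub>R v)) -` W)"
    by (intro open_vimage openW continuous_intros)
qed auto

lemma homog_dy:
  assumes "smooth2 W L" "homog (Suc r) W L"
  shows "homog r W (dy k L)"
proof (rule homogI)
  fix x y and t :: real assume xy: "(x, y) \<in> W" and t: "t > 0"
  \<comment> \<open>The direction is k / t because t (y + s k / t) = t y + s k.\<close>
  obtain S where S: "open S" "0 \<in> S" "\<And>s. s \<in> S \<Longrightarrow> (x, y + s *\<^sub>R ((1/t) *\<^sub>R k)) \<in> W"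
    using eventually_line_in[OF xy, of 0 "(1/t) *\<^sub>R k"] by auto
  have "dy ((1/t) *\<^sub>R k) L x y = (1/t) * dy k L x y"
    by (simp add: dy_expand[OF assms(1) xy, of "(1/t) *\<^sub>R k"] dy_expand[OF assms(1) xy, of k] sum_distrib_left)
  then have "((\<lambda>s. t ^ Suc r * L x (y + s *\<^sub>R ((1/t) *\<^sub>R k))) has_real_derivative t ^ Suc r * ((1/t) * dy k L x y)) (at 0)"
    using dy_DERIV[OF assms(1) xy, of "(1/t) *\<^sub>R k"] by (intro DERIV_cmult) simp
  then have "((\<lambda>s. L x (t *\<^sub>R y + s *\<^sub>R k)) has_real_derivative t ^ Suc r * ((1/t) * dy k L x y)) (at 0)"
  proof (rule has_field_derivative_transform_within_open[OF _ S(1,2)])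
    fix s assume "s \<in> S"
    from homogD[OF assms(2) S(3)[OF this] t]
    show "t ^ Suc r * L x (y + s *\<^sub>R ((1/t) *\<^sub>R k)) = L x (t *\<^sub>R y + s *\<^sub>R k)"
      using t by (simp add: scaleR_add_right)
  qed
  from dy_eqI[OF assms(1) cone[OF xy t] this] show "dy k L x (t *\<^sub>R y) = t ^ r * dy k L x y"
    using t by simp
qed

lemma homog_dx:
  assumes "smooth2 W L" "homog r W L"
  shows "homog r W (dx k L)"
proof (rule homogI)
  fix x y and t :: real assume xy: "(x, y) \<in> W" and t: "t > 0"
  obtain S where S: "open S" "0 \<in> S" "\<And>s. s \<in> S \<Longrightarrow> (x + s *\<^sub>R k, y) \<in> W"
    using eventually_line_in[OF xy, of k 0] by auto
  have "((\<lambda>s. t ^ r * L (x + s *\<^sub>R k) y) has_real_derivative t ^ r * dx k L x y) (at 0)"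
    by (intro DERIV_cmult dx_DERIV[OF assms(1) xy])
  then have "((\<lambda>s. L (x + s *\<^sub>R k) (t *\<^sub>R y)) has_real_derivative t ^ r * dx k L x y) (at 0)"
    by (rule has_field_derivative_transform_within_open[OF _ S(1,2)])
      (use homogD[OF assms(2) S(3) t] in auto)
  from dx_eqI[OF assms(1) cone[OF xy t] this] show "dx k L x (t *\<^sub>R y) = t ^ r * dx k L x y" .
qed

end

subsection \<open>Sprays in coordinates\<close>

text \<open>The trace of the nonlinear connection dG^i/dy^j. Its vertical Hessian is twice the
  tensor \<open>E_curv\<close>, whose vanishing means weakly Berwald.\<close>

definition spray_div :: "('e::euclidean_space \<Rightarrow> 'e \<Rightarrow> real) \<Rightarrow> 'e \<Rightarrow> 'e \<Rightarrow> real" where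
  "spray_div L x y = (\<Sum>s\<in>Basis. dy s (spray L s) x y)"

locale finsler_coords = conic_domain W for W :: "('e::euclidean_space \<times> 'e) set" +
  fixes L :: "'e \<Rightarrow> 'e \<Rightarrow> real"
  assumes smoothL: "smooth2 W L" and homL: "homog 2 W L"
    and posdef_fund: "\<And>x y. (x, y) \<in> W \<Longrightarrow> posdef (\<lambda>i j. fund L i j x y)"
begin

lemma smooth_fund: "smooth2 W (fund L i j)"
  unfolding fund_def[abs_def]
  by (intro smooth2_divide smooth2_dy smooth2_const openW smoothL) auto

lemma fund_sym: "(x, y) \<in> W \<Longrightarrow> fund L i j x y = fund L j i x y"
  unfolding fund_def using dy_commute[OF openW smoothL] by metis

lemma smooth_fund_inv: "i \<in> Basis \<Longrightarrow> j \<in> Basis \<Longrightarrow> smooth2 W (fund_inv L i j)"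
  unfolding smooth2_def fund_inv_def
  using smooth_on_minv[OF openW, of "\<lambda>i j z. fund L i j (fst z) (snd z)" i j] smooth_fund posdef_fund
  by (auto simp: smooth2_def)

lemma smooth_spray: "i \<in> Basis \<Longrightarrow> smooth2 W (spray L i)"
  unfolding spray_def[abs_def]
  by (intro smooth2_divide smooth2_sum smooth2_mult smooth2_diff smooth2_dy smooth2_dx smooth2_inner
      smooth2_const openW smoothL smooth_fund_inv) auto

lemma smooth_spray_div: "smooth2 W (spray_div L)"
  unfolding spray_div_def[abs_def] by (intro smooth2_sum smooth2_dy openW smooth_spray)

lemma homog_fund_inv: "homog 0 W (fund_inv L i j)"
proof (rule homogI)
  fix x y and t :: real assume xy: "(x, y) \<in> W" "t > 0"
  have "homog 1 W (dy j L)" for j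
    using homog_dy[OF smoothL, of 1] homL by (simp add: numeral_2_eq_2)
  then have "homog 0 W (dy i (dy j L))" for i j
    using homog_dy[OF smooth2_dy[OF openW smoothL], of 0] by simp
  then have "fund L i j x (t *\<^sub>R y) = fund L i j x y" for i j
    using homogD[OF _ xy] unfolding fund_def by fastforce
  then show "fund_inv L i j x (t *\<^sub>R y) = t ^ 0 * fund_inv L i j x y"
    by (simp add: fund_inv_def)
qed

lemma homog_spray: "homog 2 W (spray L i)"
proof (rule homogI)
  fix x y and t :: real assume xy: "(x, y) \<in> W" "t > 0"
  have x: "homog 2 W (dx k L)" for k by (rule homog_dx[OF smoothL homL])
  then have "homog 1 W (dy l (dx k L))" for k l
    using homog_dy[OF smooth2_dx[OF openW smoothL], of 1] by (simp add: numeral_2_eq_2)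
  from homogD[OF this xy] homogD[OF x xy] homogD[OF homog_fund_inv xy]
  show "spray L i x (t *\<^sub>R y) = t ^ 2 * spray L i x y"
    by (simp add: spray_def sum_distrib_left algebra_simps power2_eq_square)
qed

lemma homog_spray_div: "homog 1 W (spray_div L)"
proof (rule homogI)
  fix x y and t :: real assume xy: "(x, y) \<in> W" "t > 0"
  have "homog 1 W (dy s (spray L s))" if "s \<in> Basis" for s
    using homog_dy[OF smooth_spray[OF that], of 1] homog_spray by (simp add: numeral_2_eq_2)
  from homogD[OF this xy] show "spray_div L x (t *\<^sub>R y) = t ^ 1 * spray_div L x y"
    by (simp add: spray_div_def sum_distrib_left)
qed

text \<open>Euler's identity for the first derivatives gives dL/dy^j = 2 g_jk y^k. In the spray of
  the warped product this turns the vertical derivative of F2 squared into a radial term along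
  y2.\<close>

lemma fund_inv_dy:
  assumes xy: "(x, y) \<in> W" and i: "i \<in> Basis"
  shows "(\<Sum>j\<in>Basis. fund_inv L i j x y * dy j L x y) = 2 * (y \<bullet> i)"
proof -
  have "homog 1 W (dy j L)" for j
    using homog_dy[OF smoothL, of 1] homL by (simp add: numeral_2_eq_2)
  from euler_homog[OF smooth2_dy[OF openW smoothL] this xy]
  have "dy j L x y = (\<Sum>k\<in>Basis. (y \<bullet> k) * dy k (dy j L) x y)" for j by simp
  also have "(\<Sum>k\<in>Basis. (y \<bullet> k) * dy k (dy j L) x y) = 2 * (\<Sum>k\<in>Basis. fund L j k x y * (y \<bullet> k))" for j
    by (simp add: fund_def sum_distrib_left dy_commute[OF openW smoothL xy, of _ j] mult.commute)
  finally have "(\<Sum>j\<in>Basis. fund_inv L i j x y * dy j L x y)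
      = 2 * (\<Sum>j\<in>Basis. fund_inv L i j x y * (\<Sum>k\<in>Basis. fund L j k x y * (y \<bullet> k)))"
    by (simp add: sum_distrib_left mult.assoc mult.left_commute)
  also have "\<dots> = 2 * (y \<bullet> i)"
    unfolding fund_inv_def by (subst minv_apply[OF posdef_fund[OF xy] i]) simp
  finally show ?thesis .
qed

lemma fund_inv_trace:
  "(x, y) \<in> W \<Longrightarrow> (\<Sum>i\<in>Basis. \<Sum>j\<in>Basis. fund_inv L i j x y * fund L i j x y) = real DIM('e)"
  unfolding fund_inv_def by (rule minv_trace[OF posdef_fund fund_sym])

text \<open>Summing the Riemann curvature over i before the outer derivatives collects two of its
  four terms into derivatives of \<open>spray_div\<close>.\<close>

lemma ricci_eq:
  assumes xy: "(x, y) \<in> W"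
  shows "ricci L x y = 2 * (\<Sum>i\<in>Basis. dx i (spray L i) x y) - (\<Sum>j\<in>Basis. (y \<bullet> j) * dx j (spray_div L) x y)
    + 2 * (\<Sum>j\<in>Basis. spray L j x y * dy j (spray_div L) x y)
    - (\<Sum>i\<in>Basis. \<Sum>j\<in>Basis. dy j (spray L i) x y * dy i (spray L j) x y)"
proof -
  have s: "smooth2 W (dy i (spray L i))" if "i \<in> Basis" for i
    using that by (intro smooth2_dy openW smooth_spray)
  have 1: "dx j (spray_div L) x y = (\<Sum>i\<in>Basis. dx j (dy i (spray L i)) x y)" for j
    unfolding spray_div_def[abs_def] by (rule dx_sum[OF openW s xy])
  have 2: "dy j (spray_div L) x y = (\<Sum>i\<in>Basis. dy j (dy i (spray L i)) x y)" for j
    unfolding spray_div_def[abs_def] by (rule dy_sum[OF openW s xy])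
  have "(\<Sum>i\<in>Basis. \<Sum>j\<in>Basis. (y \<bullet> j) * dx j (dy i (spray L i)) x y)
     = (\<Sum>j\<in>Basis. (y \<bullet> j) * dx j (spray_div L) x y)"
    unfolding 1 sum_distrib_left by (rule sum.swap)
  moreover have "(\<Sum>i\<in>Basis. \<Sum>j\<in>Basis. spray L j x y * dy j (dy i (spray L i)) x y)
     = (\<Sum>j\<in>Basis. spray L j x y * dy j (spray_div L) x y)"
    unfolding 2 sum_distrib_left by (rule sum.swap)
  ultimately show ?thesis
    by (simp add: ricci_def riemann_def sum.distrib sum_subtractf sum_distrib_left[symmetric])
qed

text \<open>The four terms of the trace formula have degrees 2, 1 + 1, 2 + 0 and 1 + 1 in y.\<close>

lemma homog_ricci: "homog 2 W (ricci L)"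
proof (rule homogI)
  fix x y and t :: real assume xy: "(x, y) \<in> W" "t > 0"
  note txy = cone[OF xy]
  have "homog 2 W (dx i (spray L i))" if "i \<in> Basis" for i
    by (rule homog_dx[OF smooth_spray[OF that] homog_spray])
  note 1 = homogD[OF this xy]
  note 2 = homogD[OF homog_dx[OF smooth_spray_div homog_spray_div] xy]
  have "homog 0 W (dy j (spray_div L))" for j
    using homog_dy[OF smooth_spray_div, of 0] homog_spray_div by simp
  note 3 = homogD[OF this xy] homogD[OF homog_spray xy]
  have "homog 1 W (dy j (spray L i))" if "i \<in> Basis" for i j
    using homog_dy[OF smooth_spray[OF that], of 1] homog_spray by (simp add: numeral_2_eq_2)
  note 4 = homogD[OF this xy]
  show "ricci L x (t *\<^sub>R y) = t\<^sup>2 * ricci L x y"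
    unfolding ricci_eq[OF xy(1)] ricci_eq[OF txy]
    by (simp add: 1 2 3 4 sum_distrib_left sum_subtractf algebra_simps power2_eq_square)
qed

text \<open>Only derivatives in y are taken, for which \<open>c x\<close> is a constant. The Ricci
  tensor is then c g, and the trace of g by its own inverse is the dimension.\<close>

lemma scalar_curv_einstein:
  assumes "\<And>x y. (x, y) \<in> W \<Longrightarrow> ricci L x y = c x * L x y" and xy: "(x, y) \<in> W"
  shows "scalar_curv L x y = real DIM('e) * c x"
proof -
  have "dy j (ricci L) x y = c x * dy j L x y" if "(x, y) \<in> W" for x y j
    using dy_cong[OF openW that assms(1)] dy_scale[OF smoothL that] by simp
  from dy_cong[OF openW xy this]
  have "ricci_tensor L i j x y = c x * fund L i j x y" for i j
    using dy_scale[OF smooth2_dy[OF openW smoothL] xy, of i c j] by (simp add: ricci_tensor_def fund_def)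
  then have "scalar_curv L x y = c x * (\<Sum>i\<in>Basis. \<Sum>j\<in>Basis. fund_inv L i j x y * fund L i j x y)"
    by (simp add: scalar_curv_def sum_distrib_left mult_ac)
  then show ?thesis by (simp add: fund_inv_trace[OF xy])
qed

text \<open>Euler's identity applied twice gives L = g_jk y^j y^k.\<close>

lemma L_pos:
  assumes xy: "(x, y) \<in> W" and y: "y \<noteq> 0"
  shows "L x y > 0"
proof -
  have h: "homog 1 W (dy j L)" for j
    using homog_dy[OF smoothL, of 1] homL by (simp add: numeral_2_eq_2)
  have "2 * L x y = (\<Sum>j\<in>Basis. (y \<bullet> j) * dy j L x y)"
    using euler_homog[OF smoothL homL xy] by simp
  also have "\<dots> = (\<Sum>j\<in>Basis. (y \<bullet> j) * (\<Sum>k\<in>Basis. (y \<bullet> k) * dy k (dy j L) x y))"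
    using euler_homog[OF smooth2_dy[OF openW smoothL] h xy] by simp
  also have "\<dots> = 2 * (\<Sum>j\<in>Basis. \<Sum>k\<in>Basis. fund L j k x y * (y \<bullet> j) * (y \<bullet> k))"
    by (simp add: fund_def dy_commute[OF openW smoothL xy] sum_distrib_left mult_ac)
  finally show ?thesis
    using posdef_fund[OF xy] y unfolding posdef_def by simp
qed

end

subsection \<open>Riemannian metrics in coordinates\<close>

text \<open>L is tied to the quadratic form off the zero section, where the Finsler quantities are
  evaluated; the fundamental tensor does not depend on y there.\<close>

locale riemann_coords =
  fixes X :: "'e::euclidean_space set" and \<gamma> :: "'e \<Rightarrow> 'e \<Rightarrow> 'e \<Rightarrow> real" and L :: "'e \<Rightarrow> 'e \<Rightarrow> real"
  assumes openX: "open X" and smooth\<gamma>: "\<And>i j. i \<in> Basis \<Longrightarrow> j \<in> Basis \<Longrightarrow> smooth_on X (\<gamma> i j)"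
    and sym\<gamma>: "\<And>i j x. x \<in> X \<Longrightarrow> i \<in> Basis \<Longrightarrow> j \<in> Basis \<Longrightarrow> \<gamma> i j x = \<gamma> j i x"
    and pos\<gamma>: "\<And>x. x \<in> X \<Longrightarrow> posdef (\<lambda>i j. \<gamma> i j x)"
    and L_eq: "\<And>x y. x \<in> X \<Longrightarrow> y \<noteq> 0 \<Longrightarrow> L x y = (\<Sum>a\<in>Basis. \<Sum>b\<in>Basis. \<gamma> a b x * (y \<bullet> a) * (y \<bullet> b))"
begin

definition \<gamma>inv :: "'e \<Rightarrow> 'e \<Rightarrow> 'e \<Rightarrow> real" where
  "\<gamma>inv i j x = minv (\<lambda>a b. \<gamma> a b x) i j"

definition chr :: "'e \<Rightarrow> 'e \<Rightarrow> 'e \<Rightarrow> 'e \<Rightarrow> real" where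
  "chr k i j x = (\<Sum>l\<in>Basis. \<gamma>inv k l x *
     (partial i (\<gamma> j l) x + partial j (\<gamma> i l) x - partial l (\<gamma> i j) x)) / 2"

definition hess :: "('e \<Rightarrow> real) \<Rightarrow> 'e \<Rightarrow> 'e \<Rightarrow> 'e \<Rightarrow> real" where
  "hess u i j x = partial i (partial j u) x - (\<Sum>k\<in>Basis. chr k i j x * partial k u x)"

definition grad :: "('e \<Rightarrow> real) \<Rightarrow> 'e \<Rightarrow> 'e \<Rightarrow> real" where
  "grad u i x = (\<Sum>j\<in>Basis. \<gamma>inv i j x * partial j u x)"

abbreviation W where "W \<equiv> X \<times> (- {0::'e})"

lemma open_W: "open W" by (intro open_Times openX) auto

lemma partial_sym: "x \<in> X \<Longrightarrow> i \<in> Basis \<Longrightarrow> j \<in> Basis \<Longrightarrow> partial k (\<gamma> i j) x = partial k (\<gamma> j i) x"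
  by (rule partial_cong[OF openX]) (auto simp: sym\<gamma>)

lemma \<gamma>inv_sym: "x \<in> X \<Longrightarrow> i \<in> Basis \<Longrightarrow> j \<in> Basis \<Longrightarrow> \<gamma>inv i j x = \<gamma>inv j i x"
  unfolding \<gamma>inv_def by (rule minv_sym[OF pos\<gamma> sym\<gamma>])

lemma smooth_\<gamma>inv: "i \<in> Basis \<Longrightarrow> j \<in> Basis \<Longrightarrow> smooth_on X (\<gamma>inv i j)"
  unfolding \<gamma>inv_def[abs_def] by (rule smooth_on_minv[OF openX smooth\<gamma> pos\<gamma>])

lemma smooth_chr: "k \<in> Basis \<Longrightarrow> i \<in> Basis \<Longrightarrow> j \<in> Basis \<Longrightarrow> smooth_on X (chr k i j)"
  unfolding chr_def[abs_def]
  by (intro smooth_on_divide smooth_on_sum smooth_on_mult smooth_on_diff smooth_on_add openX smooth_\<gamma>inv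
      smooth_on_partial smooth\<gamma> smooth_on_const) auto

lemma smooth2_\<gamma>: "i \<in> Basis \<Longrightarrow> j \<in> Basis \<Longrightarrow> smooth2 W (\<lambda>x y. \<gamma> i j x)"
  by (rule smooth2_base[OF open_W openX _ smooth\<gamma>]) auto

lemma smooth_L: "smooth2 W L"
proof (rule smooth2_cong[THEN iffD2, OF open_W])
  show "smooth2 W (\<lambda>x y. \<Sum>a\<in>Basis. \<Sum>b\<in>Basis. \<gamma> a b x * (y \<bullet> a) * (y \<bullet> b))"
    by (intro smooth2_sum smooth2_mult smooth2_inner smooth2_\<gamma> open_W)
qed (auto simp: L_eq)

lemma dy_L:
  assumes "x \<in> X" "y \<noteq> 0" "j \<in> Basis"
  shows "dy j L x y = (\<Sum>b\<in>Basis. (2 * \<gamma> j b x) * (y \<bullet> b))"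
proof -
  have "dy j L x y = dy j (\<lambda>x y. \<Sum>a\<in>Basis. \<Sum>b\<in>Basis. \<gamma> a b x * (y \<bullet> a) * (y \<bullet> b)) x y"
    by (rule dy_cong[OF open_W]) (use assms L_eq in auto)
  also have "\<dots> = (\<Sum>b\<in>Basis. (2 * \<gamma> j b x) * (y \<bullet> b))"
    unfolding dy_quadratic[OF assms(3)]
    by (intro sum.cong refl) (simp add: sym\<gamma>[OF assms(1) _ assms(3)])
  finally show ?thesis .
qed

lemma fund_eq:
  assumes "x \<in> X" "y \<noteq> 0" "i \<in> Basis" "j \<in> Basis"
  shows "fund L i j x y = \<gamma> i j x"
proof -
  have "dy i (dy j L) x y = dy i (\<lambda>x y. \<Sum>b\<in>Basis. (2 * \<gamma> j b x) * (y \<bullet> b)) x y"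
    by (rule dy_cong[OF open_W]) (use assms dy_L in auto)
  also have "\<dots> = 2 * \<gamma> j i x" by (rule dy_linear[OF assms(3)])
  finally show ?thesis using sym\<gamma> assms by (simp add: fund_def)
qed

sublocale finsler_coords W L
proof
  show "open W" by (rule open_W)
  show "(x, t *\<^sub>R y) \<in> W" if "(x, y) \<in> W" "t > 0" for x y and t :: real using that by auto
  show "smooth2 W L" by (rule smooth_L)
  show "homog 2 W L"
    by (rule homogI) (auto simp: L_eq sum_distrib_left power2_eq_square algebra_simps)
  show "posdef (\<lambda>i j. fund L i j x y)" if "(x, y) \<in> W" for x y
    using pos\<gamma>[of x] that posdef_cong[of "\<lambda>i j. fund L i j x y" "\<lambda>i j. \<gamma> i j x"] by (auto simp: fund_eq)
qed

lemma fund_inv_eq: "x \<in> X \<Longrightarrow> y \<noteq> 0 \<Longrightarrow> fund_inv L i j x y = \<gamma>inv i j x"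
  unfolding fund_inv_def \<gamma>inv_def by (rule minv_cong) (simp add: fund_eq)

lemma dx_L:
  assumes "x \<in> X" "y \<noteq> 0"
  shows "dx k L x y = (\<Sum>a\<in>Basis. \<Sum>b\<in>Basis. partial k (\<gamma> a b) x * (y \<bullet> a) * (y \<bullet> b))"
proof -
  let ?Q = "\<lambda>x y. \<Sum>a\<in>Basis. \<Sum>b\<in>Basis. \<gamma> a b x * (y \<bullet> a) * (y \<bullet> b)"
  have "dx k L x y = dx k ?Q x y"
    by (rule dx_cong[OF open_W]) (use assms L_eq in auto)
  also have "\<dots> = (\<Sum>a\<in>Basis. \<Sum>b\<in>Basis. partial k (\<gamma> a b) x * (y \<bullet> a) * (y \<bullet> b))"
  proof (rule dx_eqI)
    show "smooth2 W ?Q" by (intro smooth2_sum smooth2_mult smooth2_inner smooth2_\<gamma> open_W)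
    show "(x, y) \<in> W" using assms by auto
    show "((\<lambda>t. ?Q (x + t *\<^sub>R k) y) has_real_derivative (\<Sum>a\<in>Basis. \<Sum>b\<in>Basis. partial k (\<gamma> a b) x * (y \<bullet> a) * (y \<bullet> b))) (at 0)"
      by (intro DERIV_sum DERIV_cmult_right partial_DERIV[OF smooth\<gamma> assms(1)])
  qed
  finally show ?thesis .
qed

lemma dy_dx_L:
  assumes "x \<in> X" "y \<noteq> 0" "l \<in> Basis"
  shows "dy l (dx k L) x y = 2 * (\<Sum>b\<in>Basis. partial k (\<gamma> l b) x * (y \<bullet> b))"
proof -
  have "dy l (dx k L) x y = dy l (\<lambda>x y. \<Sum>a\<in>Basis. \<Sum>b\<in>Basis. partial k (\<gamma> a b) x * (y \<bullet> a) * (y \<bullet> b)) x y"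
    by (rule dy_cong[OF open_W]) (use assms dx_L in auto)
  also have "\<dots> = (\<Sum>b\<in>Basis. (2 * partial k (\<gamma> l b) x) * (y \<bullet> b))"
    unfolding dy_quadratic[OF assms(3)]
    by (intro sum.cong refl) (simp add: partial_sym[OF assms(1) _ assms(3)])
  finally show ?thesis by (simp add: sum_distrib_left algebra_simps)
qed

text \<open>Contraction with y^a y^b sees only the part of 2 d_a gamma_bl that is symmetric in a and
  b, and this is the sum of the two positive terms of the Christoffel symbol.\<close>

lemma spray_eq:
  assumes "x \<in> X" "y \<noteq> 0"
  shows "spray L i x y = (\<Sum>a\<in>Basis. \<Sum>b\<in>Basis. (chr i a b x / 2) * (y \<bullet> a) * (y \<bullet> b))"
proof -
  let ?y = "\<lambda>a b. (y \<bullet> a) * (y \<bullet> b)"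
  let ?S = "\<lambda>p. \<Sum>a\<in>Basis. \<Sum>b\<in>Basis. p a b * ?y a b"
  have 1: "(\<Sum>k\<in>Basis. dy l (dx k L) x y * (y \<bullet> k)) - dx l L x y =
     ?S (\<lambda>a b. partial a (\<gamma> b l) x + partial b (\<gamma> a l) x - partial l (\<gamma> a b) x)" if l: "l \<in> Basis" for l
  proof -
    have "(\<Sum>k\<in>Basis. dy l (dx k L) x y * (y \<bullet> k)) = 2 * ?S (\<lambda>a b. partial a (\<gamma> b l) x)"
      by (simp add: dy_dx_L[OF assms l] partial_sym[OF assms(1) l] sum_distrib_left sum_distrib_right algebra_simps)
    also have "?S (\<lambda>a b. partial a (\<gamma> b l) x) = ?S (\<lambda>a b. partial b (\<gamma> a l) x)"
      by (subst sum.swap) (simp add: algebra_simps)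
    then have "2 * ?S (\<lambda>a b. partial a (\<gamma> b l) x) = ?S (\<lambda>a b. partial a (\<gamma> b l) x) + ?S (\<lambda>a b. partial b (\<gamma> a l) x)"
      by simp
    finally show ?thesis
      unfolding dx_L[OF assms] by (simp add: sum.distrib sum_subtractf algebra_simps)
  qed
  have "spray L i x y = (\<Sum>l\<in>Basis. \<gamma>inv i l x *
    ?S (\<lambda>a b. partial a (\<gamma> b l) x + partial b (\<gamma> a l) x - partial l (\<gamma> a b) x)) / 4"
    unfolding spray_def by (simp add: 1 fund_inv_eq[OF assms])
  also have "\<dots> = (\<Sum>a\<in>Basis. \<Sum>b\<in>Basis. \<Sum>l\<in>Basis. \<gamma>inv i l x *
     ((partial a (\<gamma> b l) x + partial b (\<gamma> a l) x - partial l (\<gamma> a b) x) * ?y a b)) / 4"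
    unfolding sum_distrib_left by (subst sum.swap, subst (2) sum.swap) simp
  also have "\<dots> = (\<Sum>a\<in>Basis. \<Sum>b\<in>Basis. (chr i a b x / 2) * ?y a b)"
    unfolding chr_def sum_divide_distrib sum_distrib_right by (intro sum.cong refl) (simp add: field_simps)
  finally show ?thesis by (simp add: mult.assoc)
qed

lemma chr_sym: "x \<in> X \<Longrightarrow> i \<in> Basis \<Longrightarrow> j \<in> Basis \<Longrightarrow> chr k i j x = chr k j i x"
  unfolding chr_def by (simp add: partial_sym[of x i j] algebra_simps)

lemma spray_div_eq:
  assumes "x \<in> X" "y \<noteq> 0"
  shows "spray_div L x y = (\<Sum>b\<in>Basis. (\<Sum>k\<in>Basis. chr k k b x) * (y \<bullet> b))"
proof -
  have "dy s (spray L s) x y = (\<Sum>b\<in>Basis. chr s s b x * (y \<bullet> b))" if s: "s \<in> Basis" for s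
  proof -
    have "dy s (spray L s) x y = dy s (\<lambda>x y. \<Sum>a\<in>Basis. \<Sum>b\<in>Basis. (chr s a b x / 2) * (y \<bullet> a) * (y \<bullet> b)) x y"
      by (rule dy_cong[OF open_W]) (use assms spray_eq in auto)
    also have "\<dots> = (\<Sum>b\<in>Basis. chr s s b x * (y \<bullet> b))"
      unfolding dy_quadratic[OF s] by (intro sum.cong refl) (simp add: chr_sym[OF assms(1) _ s])
    finally show ?thesis .
  qed
  then show ?thesis
    unfolding spray_div_def sum_distrib_right by (subst sum.swap) (simp add: algebra_simps)
qed

text \<open>Against the symmetric inverse metric two of the three derivative terms cancel.\<close>

lemma chr_contract:
  assumes "x \<in> X" "j \<in> Basis"
  shows "(\<Sum>k\<in>Basis. chr k k j x) = (\<Sum>k\<in>Basis. \<Sum>l\<in>Basis. \<gamma>inv k l x * partial j (\<gamma> k l) x) / 2"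
proof -
  have "(\<Sum>k\<in>Basis. \<Sum>l\<in>Basis. \<gamma>inv k l x * partial l (\<gamma> k j) x)
      = (\<Sum>k\<in>Basis. \<Sum>l\<in>Basis. \<gamma>inv k l x * partial k (\<gamma> j l) x)"
    by (subst sum.swap) (intro sum.cong refl, simp add: \<gamma>inv_sym[OF assms(1)] partial_sym[OF assms(1,2)])
  then show ?thesis
    by (simp add: chr_def sum_divide_distrib[symmetric] algebra_simps sum.distrib sum_subtractf)
qed

text \<open>For a Riemannian metric the trace of the spray is linear in y, so its vertical
  derivative is a function of x alone.\<close>

lemma dy_spray_div:
  assumes "x \<in> X" "y \<noteq> 0" "j \<in> Basis"
  shows "dy j (spray_div L) x y = (\<Sum>k\<in>Basis. chr k k j x)"
proof -
  have "dy j (spray_div L) x y = dy j (\<lambda>x y. \<Sum>b\<in>Basis. (\<Sum>k\<in>Basis. chr k k b x) * (y \<bullet> b)) x y"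
    by (rule dy_cong[OF open_W]) (use assms spray_div_eq in auto)
  then show ?thesis by (simp only: dy_linear[OF assms(3)])
qed

lemma smooth_grad:
  assumes "smooth_on X u" "i \<in> Basis"
  shows "smooth_on X (grad u i)"
  unfolding grad_def[abs_def]
  by (intro smooth_on_sum smooth_on_mult openX smooth_\<gamma>inv smooth_on_partial assms)

lemma \<gamma>_grad:
  assumes "x \<in> X" "a \<in> Basis"
  shows "(\<Sum>b\<in>Basis. \<gamma> a b x * grad u b x) = partial a u x"
proof -
  have "(\<Sum>b\<in>Basis. \<gamma> a b x * grad u b x) = (\<Sum>j\<in>Basis. (\<Sum>b\<in>Basis. \<gamma> a b x * \<gamma>inv b j x) * partial j u x)"
    unfolding grad_def sum_distrib_left sum_distrib_right by (subst sum.swap) (simp add: mult.assoc)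
  also have "\<dots> = (\<Sum>j\<in>Basis. if j = a then partial j u x else 0)"
    unfolding \<gamma>inv_def by (intro sum.cong refl) (auto simp: minv_right[OF pos\<gamma>[OF assms(1)] assms(2)])
  finally show ?thesis using assms(2) by simp
qed

text \<open>Derivatives of the inverse matrix are avoided by differentiating \<open>\<gamma>_grad\<close>.\<close>

lemma divergence_grad:
  assumes u: "smooth_on X u" and x: "x \<in> X"
  shows "(\<Sum>i\<in>Basis. partial i (grad u i) x) + (\<Sum>j\<in>Basis. grad u j x * (\<Sum>k\<in>Basis. chr k k j x))
    = (\<Sum>i\<in>Basis. \<Sum>j\<in>Basis. \<gamma>inv i j x * hess u i j x)"
proof -
  define P where "P i a b = partial i (\<gamma> a b) x" for i a b
  define w where "w b = grad u b x" for b
  define G where "G i j = \<gamma>inv i j x" for i j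
  note defs = P_def w_def G_def
  have d: "(\<Sum>b\<in>Basis. \<gamma> a b x * partial i (grad u b) x) = partial i (partial a u) x - (\<Sum>b\<in>Basis. P i a b * w b)"
    if a: "a \<in> Basis" for a i
  proof -
    have "partial i (partial a u) x = partial i (\<lambda>x. \<Sum>b\<in>Basis. \<gamma> a b x * grad u b x) x"
      by (rule partial_cong[OF openX x]) (simp add: \<gamma>_grad a)
    also have "\<dots> = (\<Sum>b\<in>Basis. partial i (\<gamma> a b) x * grad u b x + \<gamma> a b x * partial i (grad u b) x)"
    proof (rule partial_eqI[OF _ x])
      show "smooth_on X (\<lambda>x. \<Sum>b\<in>Basis. \<gamma> a b x * grad u b x)"
        by (intro smooth_on_sum smooth_on_mult openX smooth\<gamma> smooth_grad u a)
      show "((\<lambda>t. \<Sum>b\<in>Basis. \<gamma> a b (x + t *\<^sub>R i) * grad u b (x + t *\<^sub>R i)) has_real_derivative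
        (\<Sum>b\<in>Basis. partial i (\<gamma> a b) x * grad u b x + \<gamma> a b x * partial i (grad u b) x)) (at 0)"
        by (rule DERIV_sum)
          (use DERIV_mult[OF partial_DERIV[OF smooth\<gamma>[OF a] x] partial_DERIV[OF smooth_grad[OF u] x]] in \<open>simp add: algebra_simps\<close>)
    qed
    finally show ?thesis by (simp add: defs sum.distrib)
  qed
  \<comment> \<open>Applying the inverse metric to the differentiated identity isolates the
    derivative of the gradient.\<close>
  have 1: "partial i (grad u i) x = (\<Sum>a\<in>Basis. G i a * (partial i (partial a u) x - (\<Sum>b\<in>Basis. P i a b * w b)))"
    if "i \<in> Basis" for i
    using minv_apply[OF pos\<gamma>[OF x] that, of "\<lambda>b. partial i (grad u b) x"] by (simp add: d G_def \<gamma>inv_def cong: sum.cong)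
  have 2: "(\<Sum>k\<in>Basis. chr k i j x * partial k u x) = (\<Sum>l\<in>Basis. w l * (P i j l + P j i l - P l i j)) / 2"
    if "i \<in> Basis" "j \<in> Basis" for i j
  proof -
    have chr2: "2 * chr k i j x = (\<Sum>l\<in>Basis. \<gamma>inv k l x * (P i j l + P j i l - P l i j))" for k
      by (simp add: chr_def P_def)
    have "w l = (\<Sum>k\<in>Basis. \<gamma>inv k l x * partial k u x)" if "l \<in> Basis" for l
      unfolding w_def grad_def using that by (intro sum.cong refl) (simp add: \<gamma>inv_sym[OF x])
    then have "(\<Sum>l\<in>Basis. w l * (P i j l + P j i l - P l i j))
       = (\<Sum>l\<in>Basis. \<Sum>k\<in>Basis. \<gamma>inv k l x * partial k u x * (P i j l + P j i l - P l i j))"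
      by (simp add: sum_distrib_right)
    also have "\<dots> = (\<Sum>k\<in>Basis. 2 * chr k i j x * partial k u x)"
      unfolding chr2 sum_distrib_right by (subst sum.swap) (intro sum.cong refl, simp)
    finally show ?thesis by (simp add: sum_distrib_left[symmetric] mult.assoc)
  qed
  \<comment> \<open>Both sides of the claim reduce to H - T1 + T3 / 2.\<close>
  let ?T1 = "\<Sum>i\<in>Basis. \<Sum>j\<in>Basis. \<Sum>l\<in>Basis. G i j * (w l * P i j l)"
  let ?T3 = "\<Sum>i\<in>Basis. \<Sum>j\<in>Basis. \<Sum>l\<in>Basis. G i j * (w l * P l i j)"
  let ?H = "\<Sum>i\<in>Basis. \<Sum>j\<in>Basis. G i j * partial i (partial j u) x"
  have T2: "(\<Sum>i\<in>Basis. \<Sum>j\<in>Basis. \<Sum>l\<in>Basis. G i j * (w l * P j i l)) = ?T1"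
    by (subst sum.swap) (simp add: G_def \<gamma>inv_sym[OF x])
  have "G i j * hess u i j x = G i j * partial i (partial j u) x
      - ((\<Sum>l\<in>Basis. G i j * (w l * P i j l)) + (\<Sum>l\<in>Basis. G i j * (w l * P j i l))
         - (\<Sum>l\<in>Basis. G i j * (w l * P l i j))) / 2" if "i \<in> Basis" "j \<in> Basis" for i j
    unfolding hess_def 2[OF that] sum_distrib_left[symmetric] sum.distrib[symmetric] sum_subtractf[symmetric]
      distrib_left[symmetric] right_diff_distrib[symmetric] by (simp add: right_diff_distrib)
  then have "(\<Sum>i\<in>Basis. \<Sum>j\<in>Basis. G i j * hess u i j x)
      = ?H - (?T1 + (\<Sum>i\<in>Basis. \<Sum>j\<in>Basis. \<Sum>l\<in>Basis. G i j * (w l * P j i l)) - ?T3) / 2"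
    by (simp add: sum.distrib sum_subtractf sum_divide_distrib[symmetric])
  then have "(\<Sum>i\<in>Basis. \<Sum>j\<in>Basis. G i j * hess u i j x) = ?H - (?T1 + ?T1 - ?T3) / 2"
    by (simp only: T2)
  moreover have "(\<Sum>i\<in>Basis. partial i (grad u i) x) = ?H - ?T1"
    by (simp add: 1 sum_subtractf sum_distrib_left algebra_simps)
  moreover have "(\<Sum>j\<in>Basis. grad u j x * (\<Sum>k\<in>Basis. chr k k j x)) = ?T3 / 2"
  proof -
    have "(\<Sum>j\<in>Basis. grad u j x * (\<Sum>k\<in>Basis. chr k k j x))
       = (\<Sum>j\<in>Basis. \<Sum>k\<in>Basis. \<Sum>l\<in>Basis. G k l * (w j * P j k l)) / 2"
      by (simp add: chr_contract[OF x] defs sum_distrib_left sum_divide_distrib algebra_simps)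
    also have "(\<Sum>j\<in>Basis. \<Sum>k\<in>Basis. \<Sum>l\<in>Basis. G k l * (w j * P j k l)) = ?T3"
      by (subst sum.swap, subst (2) sum.swap) simp
    finally show ?thesis .
  qed
  ultimately show ?thesis unfolding G_def by (simp add: diff_divide_distrib)
qed

text \<open>The Ricci tensor is the symmetric part of q; contraction with the symmetric inverse
  metric does not see the difference from q.\<close>

lemma scalar_curv_quadratic:
  assumes ric: "\<And>x y. x \<in> X \<Longrightarrow> y \<noteq> 0 \<Longrightarrow> ricci L x y = (\<Sum>a\<in>Basis. \<Sum>b\<in>Basis. q a b x * (y \<bullet> a) * (y \<bullet> b))"
    and x: "x \<in> X" and y: "y \<noteq> 0"
  shows "scalar_curv L x y = (\<Sum>i\<in>Basis. \<Sum>j\<in>Basis. \<gamma>inv i j x * q i j x)"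
proof -
  have 1: "dy j (ricci L) x y = (\<Sum>b\<in>Basis. (q j b x + q b j x) * (y \<bullet> b))" if "(x, y) \<in> W" "j \<in> Basis" for x y j
    using dy_cong[OF openW that(1), of "ricci L" "\<lambda>x y. \<Sum>a\<in>Basis. \<Sum>b\<in>Basis. q a b x * (y \<bullet> a) * (y \<bullet> b)" j]
      ric dy_quadratic[OF that(2), where q = q] by auto
  have "ricci_tensor L i j x y = (q j i x + q i j x) / 2" if "i \<in> Basis" "j \<in> Basis" for i j
    using dy_cong[OF openW _ 1[OF _ that(2)], where k = i and x = x and y = y] x y dy_linear[OF that(1), where c = "\<lambda>b x. q j b x + q b j x"]
    by (simp add: ricci_tensor_def)
  then have "scalar_curv L x y = (\<Sum>i\<in>Basis. \<Sum>j\<in>Basis. \<gamma>inv i j x * ((q j i x + q i j x) / 2))"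
    by (simp add: scalar_curv_def fund_inv_eq[OF x y] del: eq_divide_eq_numeral1 cong: sum.cong)
  also have "\<dots> = ((\<Sum>i\<in>Basis. \<Sum>j\<in>Basis. \<gamma>inv i j x * q j i x) + (\<Sum>i\<in>Basis. \<Sum>j\<in>Basis. \<gamma>inv i j x * q i j x)) / 2"
    by (simp add: sum.distrib add_divide_distrib sum_divide_distrib distrib_left)
  also have "(\<Sum>i\<in>Basis. \<Sum>j\<in>Basis. \<gamma>inv i j x * q j i x) = (\<Sum>i\<in>Basis. \<Sum>j\<in>Basis. \<gamma>inv i j x * q i j x)"
    by (subst sum.swap) (simp add: \<gamma>inv_sym[OF x])
  finally show ?thesis by simp
qed

lemma \<gamma>inv_trace: "x \<in> X \<Longrightarrow> (\<Sum>i\<in>Basis. \<Sum>j\<in>Basis. \<gamma>inv i j x * \<gamma> i j x) = real DIM('e)"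
  unfolding \<gamma>inv_def by (rule minv_trace[OF pos\<gamma> sym\<gamma>])

lemma \<gamma>inv_posdef: "x \<in> X \<Longrightarrow> posdef (\<lambda>i j. \<gamma>inv i j x)"
  using minv_posdef[OF pos\<gamma>, of x] by (simp add: \<gamma>inv_def[abs_def])

end

subsection \<open>Warped products in coordinates\<close>

locale warped_coords =
  B: riemann_coords X \<gamma> L1 + C: finsler_coords W2 L2
  for X :: "'e::euclidean_space set" and \<gamma> L1 and W2 :: "('f::euclidean_space \<times> 'f) set" and L2 +
  fixes f :: "'e \<Rightarrow> real" and L :: "'e \<times> 'f \<Rightarrow> 'e \<times> 'f \<Rightarrow> real"
  assumes smooth_f: "smooth_on X f" and f_pos: "\<And>x. x \<in> X \<Longrightarrow> f x > 0"
    and L_warped: "\<And>x1 x2 y1 y2. x1 \<in> X \<Longrightarrow> y1 \<noteq> 0 \<Longrightarrow> (x2, y2) \<in> W2 \<Longrightarrow>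
      L (x1, x2) (y1, y2) = L1 x1 y1 + (f x1)\<^sup>2 * L2 x2 y2"
begin

definition W :: "(('e \<times> 'f) \<times> ('e \<times> 'f)) set" where
  "W = {((x1, x2), (y1, y2)). (x1, y1) \<in> B.W \<and> (x2, y2) \<in> W2}"

lemma in_W [simp]: "((x1, x2), (y1, y2)) \<in> W \<longleftrightarrow> x1 \<in> X \<and> y1 \<noteq> 0 \<and> (x2, y2) \<in> W2"
  by (auto simp: W_def)

lemma open_W: "open W"
proof -
  have "W = (\<lambda>z. (fst (fst z), fst (snd z))) -` B.W \<inter> (\<lambda>z. (snd (fst z), snd (snd z))) -` W2"
    by (auto simp: W_def)
  also have "open \<dots>"
    by (intro open_Int open_vimage B.openW C.openW continuous_intros)
  finally show ?thesis .
qed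

lemma smooth_base:
  assumes "smooth2 B.W A"
  shows "smooth2 W (\<lambda>x y. A (fst x) (fst y))"
proof -
  have "bounded_linear (\<lambda>z :: ('e \<times> 'f) \<times> ('e \<times> 'f). (fst (fst z), fst (snd z)))"
    by (intro bounded_linear_Pair bounded_linear_compose[OF bounded_linear_fst] bounded_linear_fst bounded_linear_snd)
  from smooth_on_comp_linear[OF open_W B.openW this _ assms[unfolded smooth2_def]]
  show ?thesis by (auto simp: W_def smooth2_def)
qed

lemma smooth_fibre:
  assumes "smooth2 W2 A"
  shows "smooth2 W (\<lambda>x y. A (snd x) (snd y))"
proof -
  have "bounded_linear (\<lambda>z :: ('e \<times> 'f) \<times> ('e \<times> 'f). (snd (fst z), snd (snd z)))"
    by (intro bounded_linear_Pair bounded_linear_compose[OF bounded_linear_snd] bounded_linear_fst bounded_linear_snd)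
  from smooth_on_comp_linear[OF open_W C.openW this _ assms[unfolded smooth2_def]]
  show ?thesis by (auto simp: W_def smooth2_def)
qed

lemma smooth_fun: "smooth_on X u \<Longrightarrow> smooth2 W (\<lambda>x y. u (fst x))"
  by (rule smooth_base[of "\<lambda>x y. u x"]) (auto intro!: smooth2_base[OF B.openW B.openX])

lemmas smooth_intros = smooth2_add[OF open_W] smooth2_diff[OF open_W] smooth2_mult[OF open_W]
  smooth2_const[OF open_W] smooth2_inner[OF open_W] smooth_base smooth_fibre smooth_fun

lemma DERIV_f: "x1 \<in> X \<Longrightarrow> ((\<lambda>t. f (x1 + t *\<^sub>R k)) has_real_derivative partial k f x1) (at 0)"
  by (rule partial_DERIV[OF smooth_f])

lemma smooth_warped: "smooth2 W (\<lambda>x y. L1 (fst x) (fst y) + f (fst x) * f (fst x) * L2 (snd x) (snd y))"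
  by (intro smooth_intros B.smoothL C.smoothL smooth_f)

lemma L_eq_W: "(x, y) \<in> W \<Longrightarrow> L x y = L1 (fst x) (fst y) + f (fst x) * f (fst x) * L2 (snd x) (snd y)"
  by (cases x; cases y) (simp add: L_warped power2_eq_square)

lemma smooth_L: "smooth2 W L"
  using smooth_warped by (subst smooth2_cong[OF open_W L_eq_W])

section \<open>Derivatives and fundamental tensor of the warped metric\<close>

context
  fixes x1 y1 :: 'e and x2 y2 :: 'f
  assumes x1: "x1 \<in> X" and y1: "y1 \<noteq> 0" and xy2: "(x2, y2) \<in> W2"
begin

lemma xy: "((x1, x2), (y1, y2)) \<in> W" "(x1, y1) \<in> B.W"
  using x1 y1 xy2 by auto

lemma dx_L_base: "dx (k, 0) L (x1, x2) (y1, y2) = dx k L1 x1 y1 + 2 * f x1 * partial k f x1 * L2 x2 y2"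
  by (rule dx_eqI'[OF open_W xy(1) L_eq_W smooth_warped])
    (auto intro!: derivative_eq_intros dx_DERIV[OF B.smoothL xy(2)] DERIV_f[OF x1])

lemma dx_L_fibre: "dx (0, k) L (x1, x2) (y1, y2) = (f x1)\<^sup>2 * dx k L2 x2 y2"
  by (rule dx_eqI'[OF open_W xy(1) L_eq_W smooth_warped])
    (auto intro!: derivative_eq_intros dx_DERIV[OF C.smoothL xy2] simp: power2_eq_square)

lemma dy_L_base: "dy (k, 0) L (x1, x2) (y1, y2) = dy k L1 x1 y1"
  by (rule dy_eqI'[OF open_W xy(1) L_eq_W smooth_warped])
    (auto intro!: derivative_eq_intros dy_DERIV[OF B.smoothL xy(2)])

lemma dy_L_fibre: "dy (0, k) L (x1, x2) (y1, y2) = (f x1)\<^sup>2 * dy k L2 x2 y2"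
  by (rule dy_eqI'[OF open_W xy(1) L_eq_W smooth_warped])
    (auto intro!: derivative_eq_intros dy_DERIV[OF C.smoothL xy2] simp: power2_eq_square)

end

lemma W_cases:
  assumes "(x, y) \<in> W"
  obtains "fst x \<in> X" "fst y \<noteq> 0" "(snd x, snd y) \<in> W2"
  using assms by (cases x; cases y) auto

lemma first_order_cong:
  assumes "(x, y) \<in> W"
  shows "dx (k, 0) L x y = dx k L1 (fst x) (fst y) + 2 * f (fst x) * partial k f (fst x) * L2 (snd x) (snd y)"
    and "dx (0, l) L x y = f (fst x) * f (fst x) * dx l L2 (snd x) (snd y)"
    and "dy (k, 0) L x y = dy k L1 (fst x) (fst y)"
    and "dy (0, l) L x y = f (fst x) * f (fst x) * dy l L2 (snd x) (snd y)"
  using assms dx_L_base[of "fst x" "fst y" "snd x" "snd y"] dx_L_fibre[of "fst x" "fst y" "snd x" "snd y"]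
    dy_L_base[of "fst x" "fst y" "snd x" "snd y"] dy_L_fibre[of "fst x" "fst y" "snd x" "snd y"]
  by (auto elim!: W_cases simp: power2_eq_square)

context
  fixes x1 y1 :: 'e and x2 y2 :: 'f
  assumes x1: "x1 \<in> X" and y1: "y1 \<noteq> 0" and xy2: "(x2, y2) \<in> W2"
begin

lemmas xy' = xy[OF x1 y1 xy2]

lemma dy_dx_L:
  "dy (l, 0) (dx (k, 0) L) (x1, x2) (y1, y2) = dy l (dx k L1) x1 y1"
  "dy (l, 0) (dx (0, m) L) (x1, x2) (y1, y2) = 0"
  "dy (0, n) (dx (k, 0) L) (x1, x2) (y1, y2) = 2 * f x1 * partial k f x1 * dy n L2 x2 y2"
  "dy (0, n) (dx (0, m) L) (x1, x2) (y1, y2) = (f x1)\<^sup>2 * dy n (dx m L2) x2 y2"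
proof -
  note s = smooth_intros smooth_on_partial smooth2_dx B.openW C.openW B.smoothL C.smoothL smooth_f
  note d = derivative_eq_intros dy_DERIV[OF smooth2_dx[OF B.openW B.smoothL] xy'(2)]
      dy_DERIV[OF smooth2_dx[OF C.openW C.smoothL] xy2] dy_DERIV[OF C.smoothL xy2]
  show "dy (l, 0) (dx (k, 0) L) (x1, x2) (y1, y2) = dy l (dx k L1) x1 y1"
    by (rule dy_eqI'[OF open_W xy'(1) first_order_cong(1)], assumption, (intro s)[], auto intro!: d)
  show "dy (l, 0) (dx (0, m) L) (x1, x2) (y1, y2) = 0"
    by (rule dy_eqI'[OF open_W xy'(1) first_order_cong(2)], assumption, (intro s)[], auto intro!: d)
  show "dy (0, n) (dx (k, 0) L) (x1, x2) (y1, y2) = 2 * f x1 * partial k f x1 * dy n L2 x2 y2"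
    by (rule dy_eqI'[OF open_W xy'(1) first_order_cong(1)], assumption, (intro s)[], auto intro!: d)
  show "dy (0, n) (dx (0, m) L) (x1, x2) (y1, y2) = (f x1)\<^sup>2 * dy n (dx m L2) x2 y2"
    by (rule dy_eqI'[OF open_W xy'(1) first_order_cong(2)], assumption, (intro s)[], auto intro!: d simp: power2_eq_square)
qed

lemma fund_L:
  "fund L (i, 0) (j, 0) (x1, x2) (y1, y2) = fund L1 i j x1 y1"
  "fund L (i, 0) (0, m) (x1, x2) (y1, y2) = 0"
  "fund L (0, n) (j, 0) (x1, x2) (y1, y2) = 0"
  "fund L (0, n) (0, m) (x1, x2) (y1, y2) = (f x1)\<^sup>2 * fund L2 n m x2 y2"
proof -
  note s = smooth_intros smooth2_dy B.openW C.openW B.smoothL C.smoothL smooth_f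
  have "dy (i, 0) (dy (j, 0) L) (x1, x2) (y1, y2) = dy i (dy j L1) x1 y1"
    by (rule dy_eqI'[OF open_W xy'(1) first_order_cong(3)], assumption, (intro s)[],
      auto intro!: derivative_eq_intros dy_DERIV[OF smooth2_dy[OF B.openW B.smoothL] xy'(2)])
  moreover have "dy (i, 0) (dy (0, m) L) (x1, x2) (y1, y2) = 0"
    by (rule dy_eqI'[OF open_W xy'(1) first_order_cong(4)], assumption, (intro s)[],
      auto intro!: derivative_eq_intros)
  moreover have "dy (0, n) (dy (j, 0) L) (x1, x2) (y1, y2) = 0"
    by (rule dy_eqI'[OF open_W xy'(1) first_order_cong(3)], assumption, (intro s)[],
      auto intro!: derivative_eq_intros)
  moreover have "dy (0, n) (dy (0, m) L) (x1, x2) (y1, y2) = (f x1)\<^sup>2 * dy n (dy m L2) x2 y2"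
    by (rule dy_eqI'[OF open_W xy'(1) first_order_cong(4)], assumption, (intro s)[],
      auto intro!: derivative_eq_intros dy_DERIV[OF smooth2_dy[OF C.openW C.smoothL] xy2] simp: power2_eq_square)
  ultimately show
    "fund L (i, 0) (j, 0) (x1, x2) (y1, y2) = fund L1 i j x1 y1"
    "fund L (i, 0) (0, m) (x1, x2) (y1, y2) = 0"
    "fund L (0, n) (j, 0) (x1, x2) (y1, y2) = 0"
    "fund L (0, n) (0, m) (x1, x2) (y1, y2) = (f x1)\<^sup>2 * fund L2 n m x2 y2"
    by (simp_all add: fund_def)
qed

lemma posdef_L: "posdef (\<lambda>i j. fund L i j (x1, x2) (y1, y2))"
  unfolding posdef_def
proof (intro allI impI)
  fix u :: "'e \<times> 'f" assume "u \<noteq> 0"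
  then have u: "fst u \<noteq> 0 \<or> snd u \<noteq> 0" by (auto simp: prod_eq_iff)
  let ?a = "\<Sum>i\<in>Basis. \<Sum>j\<in>Basis. fund L1 i j x1 y1 * (fst u \<bullet> i) * (fst u \<bullet> j)"
  let ?b = "\<Sum>i\<in>Basis. \<Sum>j\<in>Basis. fund L2 i j x2 y2 * (snd u \<bullet> i) * (snd u \<bullet> j)"
  have eq: "(\<Sum>i\<in>Basis. \<Sum>j\<in>Basis. fund L i j (x1, x2) (y1, y2) * (u \<bullet> i) * (u \<bullet> j)) = ?a + (f x1)\<^sup>2 * ?b"
    by (simp add: sum_Basis_prod fund_L inner_prod_def sum_distrib_left mult.assoc)
  have a: "?a \<ge> 0" "fst u \<noteq> 0 \<Longrightarrow> ?a > 0"
    using B.posdef_fund[OF xy'(2)] unfolding posdef_def by (cases "fst u = 0"; force)+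
  have b: "?b \<ge> 0" "snd u \<noteq> 0 \<Longrightarrow> ?b > 0"
    using C.posdef_fund[OF xy2] unfolding posdef_def by (cases "snd u = 0"; force)+
  have f: "(f x1)\<^sup>2 > 0" using f_pos[OF x1] by simp
  show "(\<Sum>i\<in>Basis. \<Sum>j\<in>Basis. fund L i j (x1, x2) (y1, y2) * (u \<bullet> i) * (u \<bullet> j)) > 0"
    unfolding eq
  proof (cases "fst u = 0")
    case True
    then have "(f x1)\<^sup>2 * ?b > 0" using b(2) u f by simp
    then show "0 < ?a + (f x1)\<^sup>2 * ?b" using a(1) by linarith
  next
    case False
    have "(f x1)\<^sup>2 * ?b \<ge> 0" using b(1) f by simp
    then show "0 < ?a + (f x1)\<^sup>2 * ?b" using a(2)[OF False] by linarith
  qed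
qed

text \<open>The fundamental tensor is block diagonal. The block diagonal candidate satisfies the
  equations of the inverse, and \<open>minv_eqI\<close> identifies it.\<close>

lemma fund_inv_L:
  assumes "i \<in> Basis" "n \<in> Basis" "j \<in> Basis" "m \<in> Basis"
  shows "fund_inv L (i, 0) (j, 0) (x1, x2) (y1, y2) = fund_inv L1 i j x1 y1"
    and "fund_inv L (0, n) (j, 0) (x1, x2) (y1, y2) = 0"
    and "fund_inv L (i, 0) (0, m) (x1, x2) (y1, y2) = 0"
    and "fund_inv L (0, n) (0, m) (x1, x2) (y1, y2) = fund_inv L2 n m x2 y2 / (f x1)\<^sup>2"
proof -
  have f: "f x1 \<noteq> 0" using f_pos[OF x1] by simp
  \<comment> \<open>Basis vectors of the product are (i, 0) or (0, n); as basis vectors are nonzero,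
    a vanishing component tells the two blocks apart.\<close>
  have nz: "b \<noteq> 0" if "b \<in> Basis" for b :: "'z::euclidean_space" using that by (metis nonzero_Basis)
  have r1: "(\<Sum>b\<in>Basis. fund L1 a b x1 y1 * fund_inv L1 b j x1 y1) = (if a = j then 1 else 0)" if "a \<in> Basis" for a
    unfolding fund_inv_def by (rule minv_right[OF B.posdef_fund[OF xy'(2)] that assms(3)])
  have r2: "(\<Sum>b\<in>Basis. fund L2 a b x2 y2 * fund_inv L2 b m x2 y2) = (if a = m then 1 else 0)" if "a \<in> Basis" for a
    unfolding fund_inv_def by (rule minv_right[OF C.posdef_fund[OF xy2] that assms(4)])
  have 1: "fund_inv L k (j, 0) (x1, x2) (y1, y2) = (if snd k = 0 then fund_inv L1 (fst k) j x1 y1 else 0)" if "k \<in> Basis" for k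
    unfolding fund_inv_def[of L]
  proof (rule minv_eqI[OF posdef_L _ that])
    fix i :: "'e \<times> 'f" assume i: "i \<in> Basis"
    show "(\<Sum>k\<in>Basis. fund L i k (x1, x2) (y1, y2) * (if snd k = 0 then fund_inv L1 (fst k) j x1 y1 else 0))
        = (if i = (j, 0) then 1 else 0)"
      using i assms by (cases i) (auto simp: in_Basis_prod_iff sum_Basis_prod fund_L r1 nz)
  qed (use assms in \<open>auto simp: in_Basis_prod_iff\<close>)
  have 2: "fund_inv L k (0, m) (x1, x2) (y1, y2) = (if fst k = 0 then fund_inv L2 (snd k) m x2 y2 / (f x1)\<^sup>2 else 0)" if "k \<in> Basis" for k
    unfolding fund_inv_def[of L]
  proof (rule minv_eqI[OF posdef_L _ that])
    fix i :: "'e \<times> 'f" assume i: "i \<in> Basis"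
    show "(\<Sum>k\<in>Basis. fund L i k (x1, x2) (y1, y2) * (if fst k = 0 then fund_inv L2 (snd k) m x2 y2 / (f x1)\<^sup>2 else 0))
        = (if i = (0, m) then 1 else 0)"
      using i assms f by (cases i) (auto simp: in_Basis_prod_iff sum_Basis_prod fund_L r2 nz)
  qed (use assms in \<open>auto simp: in_Basis_prod_iff\<close>)
  show "fund_inv L (i, 0) (j, 0) (x1, x2) (y1, y2) = fund_inv L1 i j x1 y1"
    "fund_inv L (0, n) (j, 0) (x1, x2) (y1, y2) = 0"
    "fund_inv L (i, 0) (0, m) (x1, x2) (y1, y2) = 0"
    "fund_inv L (0, n) (0, m) (x1, x2) (y1, y2) = fund_inv L2 n m x2 y2 / (f x1)\<^sup>2"
    using 1[of "(i, 0)"] 1[of "(0, n)"] 2[of "(i, 0)"] 2[of "(0, n)"] assms nz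
    by (auto simp: in_Basis_prod_iff)
qed

end

sublocale finsler_coords W L
proof
  show "open W" by (rule open_W)
  show "smooth2 W L" by (rule smooth_L)
  show "(x, t *\<^sub>R y) \<in> W" if "(x, y) \<in> W" "t > 0" for x y and t :: real
    using that C.cone by (cases x; cases y) auto
  show "homog 2 W L"
  proof (rule homogI)
    fix x y and t :: real assume "(x, y) \<in> W" "t > 0"
    then show "L x (t *\<^sub>R y) = t\<^sup>2 * L x y"
      using homogD[OF B.homL, of "fst x" "fst y" t] homogD[OF C.homL, of "snd x" "snd y" t] C.cone[of "snd x" "snd y" t]
      by (cases x; cases y) (auto simp: L_warped algebra_simps)
  qed
  show "posdef (\<lambda>i j. fund L i j x y)" if "(x, y) \<in> W" for x y
    using that posdef_L[of "fst x" "fst y" "snd x" "snd y"] by (auto elim!: W_cases)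
qed

section \<open>Spray of the warped product and its trace\<close>

definition dlog :: "'e \<Rightarrow> 'e \<Rightarrow> real" where
  "dlog x y = (\<Sum>k\<in>Basis. partial k f x * (y \<bullet> k)) / f x"

lemma smooth_dlog: "smooth2 B.W dlog"
  unfolding dlog_def[abs_def]
  by (intro smooth2_divide smooth2_sum smooth2_mult smooth2_inner B.openW
      smooth2_base[OF B.openW B.openX] smooth_on_partial smooth_f) (auto dest: f_pos)

text \<open>On the base the extra term is the x1-derivative of f^2 F2^2, raised by the inverse base
  metric. On the fibre it is the mixed derivative in x1 and y2: the inverse fibre block cancels the
  factor f^2, and \<open>fund_inv_dy\<close> makes the result a multiple of y2.\<close>

lemma spray_L:
  assumes x1: "x1 \<in> X" and y1: "y1 \<noteq> 0" and xy2: "(x2, y2) \<in> W2"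
  shows "i \<in> Basis \<Longrightarrow> spray L (i, 0) (x1, x2) (y1, y2) = spray L1 i x1 y1 - f x1 * B.grad f i x1 * L2 x2 y2 / 2"
    and "n \<in> Basis \<Longrightarrow> spray L (0, n) (x1, x2) (y1, y2) = spray L2 n x2 y2 + dlog x1 y1 * (y2 \<bullet> n)"
proof -
  have f: "f x1 \<noteq> 0" using f_pos[OF x1] by simp
  \<comment> \<open>\<open>fund_inv_L\<close> fixes indices of both blocks at once; those absent
    from the equation at hand are filled with an arbitrary basis vector.\<close>
  note inv = fund_inv_L(1)[OF assms _ SOME_Basis _ SOME_Basis] fund_inv_L(2)[OF assms SOME_Basis _ _ SOME_Basis]
    fund_inv_L(3)[OF assms _ SOME_Basis SOME_Basis] fund_inv_L(4)[OF assms SOME_Basis _ SOME_Basis]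
  note d = dx_L_base[OF assms] dx_L_fibre[OF assms] dy_dx_L[OF assms]
  {
    assume i: "i \<in> Basis"
    have "spray L (i, 0) (x1, x2) (y1, y2) = (\<Sum>l\<in>Basis. fund_inv L1 i l x1 y1 *
     ((\<Sum>k\<in>Basis. dy l (dx k L1) x1 y1 * (y1 \<bullet> k)) - dx l L1 x1 y1 - 2 * f x1 * partial l f x1 * L2 x2 y2)) / 4"
      using i by (simp add: spray_def sum_Basis_prod inv d inner_prod_def diff_diff_eq)
    also have "\<dots> = spray L1 i x1 y1 - (\<Sum>l\<in>Basis. fund_inv L1 i l x1 y1 * (2 * f x1 * partial l f x1 * L2 x2 y2)) / 4"
      by (simp add: spray_def sum_subtractf right_diff_distrib diff_divide_distrib)
    also have "(\<Sum>l\<in>Basis. fund_inv L1 i l x1 y1 * (2 * f x1 * partial l f x1 * L2 x2 y2)) / 4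
       = f x1 * B.grad f i x1 * L2 x2 y2 / 2"
      by (simp add: B.grad_def B.fund_inv_eq[OF x1 y1] sum_distrib_left sum_distrib_right sum_divide_distrib mult_ac)
    finally show "spray L (i, 0) (x1, x2) (y1, y2) = spray L1 i x1 y1 - f x1 * B.grad f i x1 * L2 x2 y2 / 2" .
  next
    assume n: "n \<in> Basis"
    have "spray L (0, n) (x1, x2) (y1, y2) = (\<Sum>l\<in>Basis. fund_inv L2 n l x2 y2 / (f x1)\<^sup>2 *
     ((\<Sum>k\<in>Basis. 2 * f x1 * partial k f x1 * dy l L2 x2 y2 * (y1 \<bullet> k))
       + (\<Sum>k\<in>Basis. (f x1)\<^sup>2 * dy l (dx k L2) x2 y2 * (y2 \<bullet> k)) - (f x1)\<^sup>2 * dx l L2 x2 y2)) / 4"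
      using n by (simp add: spray_def sum_Basis_prod inv d inner_prod_def)
    also have "\<dots> = (\<Sum>l\<in>Basis. fund_inv L2 n l x2 y2 * 2 * dlog x1 y1 * dy l L2 x2 y2
       + fund_inv L2 n l x2 y2 * ((\<Sum>k\<in>Basis. dy l (dx k L2) x2 y2 * (y2 \<bullet> k)) - dx l L2 x2 y2)) / 4"
    proof (intro arg_cong[where f="\<lambda>z. z / 4"] sum.cong refl)
      fix l :: 'f
      have 1: "(\<Sum>k\<in>Basis. 2 * f x1 * partial k f x1 * dy l L2 x2 y2 * (y1 \<bullet> k)) = (f x1)\<^sup>2 * (2 * dlog x1 y1 * dy l L2 x2 y2)"
      proof -
        have "(\<Sum>k\<in>Basis. 2 * f x1 * partial k f x1 * dy l L2 x2 y2 * (y1 \<bullet> k))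
            = 2 * f x1 * dy l L2 x2 y2 * (\<Sum>k\<in>Basis. partial k f x1 * (y1 \<bullet> k))"
          by (simp add: sum_distrib_left mult_ac)
        also have "(\<Sum>k\<in>Basis. partial k f x1 * (y1 \<bullet> k)) = f x1 * dlog x1 y1"
          using f by (simp add: dlog_def)
        finally show ?thesis by (simp add: power2_eq_square)
      qed
      have 2: "(\<Sum>k\<in>Basis. (f x1)\<^sup>2 * dy l (dx k L2) x2 y2 * (y2 \<bullet> k)) = (f x1)\<^sup>2 * (\<Sum>k\<in>Basis. dy l (dx k L2) x2 y2 * (y2 \<bullet> k))"
        by (simp add: sum_distrib_left mult_ac)
      show "fund_inv L2 n l x2 y2 / (f x1)\<^sup>2 *
     ((\<Sum>k\<in>Basis. 2 * f x1 * partial k f x1 * dy l L2 x2 y2 * (y1 \<bullet> k))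
       + (\<Sum>k\<in>Basis. (f x1)\<^sup>2 * dy l (dx k L2) x2 y2 * (y2 \<bullet> k)) - (f x1)\<^sup>2 * dx l L2 x2 y2)
        = fund_inv L2 n l x2 y2 * 2 * dlog x1 y1 * dy l L2 x2 y2
       + fund_inv L2 n l x2 y2 * ((\<Sum>k\<in>Basis. dy l (dx k L2) x2 y2 * (y2 \<bullet> k)) - dx l L2 x2 y2)"
        unfolding 1 2 distrib_left[symmetric] right_diff_distrib[symmetric] using f by (simp add: algebra_simps)
    qed
    also have "\<dots> = dlog x1 y1 * (\<Sum>l\<in>Basis. fund_inv L2 n l x2 y2 * dy l L2 x2 y2) / 2 + spray L2 n x2 y2"
      by (simp add: spray_def sum.distrib add_divide_distrib sum_distrib_left mult_ac)
    finally show "spray L (0, n) (x1, x2) (y1, y2) = spray L2 n x2 y2 + dlog x1 y1 * (y2 \<bullet> n)"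
      by (simp add: C.fund_inv_dy[OF xy2 n])
  }
qed

text \<open>\<open>dlog x\<close> is the differential of log f at x, linear in the vector, hence its
  own derivative.\<close>

lemma DERIV_dlog: "((\<lambda>t. dlog x1 (y1 + t *\<^sub>R k)) has_real_derivative dlog x1 k) (at 0)"
proof -
  have "dlog x1 (y1 + t *\<^sub>R k) = dlog x1 y1 + t * dlog x1 k" for t
    by (simp add: dlog_def inner_add_left distrib_left sum.distrib add_divide_distrib sum_distrib_left mult_ac)
  then show ?thesis by (auto intro!: derivative_eq_intros)
qed

lemma smooth_spray_base: "i \<in> Basis \<Longrightarrow> smooth2 W (\<lambda>x y. spray L1 i (fst x) (fst y) - f (fst x) * B.grad f i (fst x) * L2 (snd x) (snd y) / 2)"
  unfolding divide_inverse by (intro smooth_intros B.smooth_spray C.smoothL smooth_f B.smooth_grad)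

lemma smooth_spray_fibre: "n \<in> Basis \<Longrightarrow> smooth2 W (\<lambda>x y. spray L2 n (snd x) (snd y) + dlog (fst x) (fst y) * (snd y \<bullet> n))"
  by (intro smooth_intros C.smooth_spray smooth_dlog smooth_fibre[of "\<lambda>x y. y \<bullet> n"] smooth2_inner C.openW)

lemma spray_L_W:
  assumes "(x, y) \<in> W"
  shows "i \<in> Basis \<Longrightarrow> spray L (i, 0) x y = spray L1 i (fst x) (fst y) - f (fst x) * B.grad f i (fst x) * L2 (snd x) (snd y) / 2"
    and "n \<in> Basis \<Longrightarrow> spray L (0, n) x y = spray L2 n (snd x) (snd y) + dlog (fst x) (fst y) * (snd y \<bullet> n)"
  using assms spray_L[of "fst x" "fst y" "snd x" "snd y"] by (auto elim!: W_cases)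

context
  fixes x1 y1 :: 'e and x2 y2 :: 'f
  assumes x1: "x1 \<in> X" and y1: "y1 \<noteq> 0" and xy2: "(x2, y2) \<in> W2"
begin

lemmas xyW = xy[OF x1 y1 xy2]

lemma dy_spray_base:
  assumes i: "i \<in> Basis"
  shows "dy (j, 0) (spray L (i, 0)) (x1, x2) (y1, y2) = dy j (spray L1 i) x1 y1"
    and "dy (0, m) (spray L (i, 0)) (x1, x2) (y1, y2) = - (f x1 * B.grad f i x1 * dy m L2 x2 y2 / 2)"
  by (rule dy_eqI'[OF open_W xyW(1) spray_L_W(1)[OF _ i] smooth_spray_base[OF i]], assumption,
      auto intro!: derivative_eq_intros dy_DERIV[OF B.smooth_spray[OF i] xyW(2)] dy_DERIV[OF C.smoothL xy2])+

lemma dy_spray_fibre: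
  assumes n: "n \<in> Basis"
  shows "dy (j, 0) (spray L (0, n)) (x1, x2) (y1, y2) = dlog x1 j * (y2 \<bullet> n)"
    and "dy (0, m) (spray L (0, n)) (x1, x2) (y1, y2) = dy m (spray L2 n) x2 y2 + dlog x1 y1 * (m \<bullet> n)"
  by (rule dy_eqI'[OF open_W xyW(1) spray_L_W(2)[OF _ n] smooth_spray_fibre[OF n]], assumption,
      auto intro!: derivative_eq_intros dy_DERIV[OF C.smooth_spray[OF n] xy2] DERIV_dlog simp: inner_add_left)+

lemma dx_spray_base:
  assumes i: "i \<in> Basis"
  shows "dx (i, 0) (spray L (i, 0)) (x1, x2) (y1, y2) = dx i (spray L1 i) x1 y1
      - (partial i f x1 * B.grad f i x1 + f x1 * partial i (B.grad f i) x1) * L2 x2 y2 / 2"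
  by (rule dx_eqI'[OF open_W xyW(1) spray_L_W(1)[OF _ i] smooth_spray_base[OF i]], assumption,
      auto intro!: derivative_eq_intros dx_DERIV[OF B.smooth_spray[OF i] xyW(2)] DERIV_f[OF x1]
       partial_DERIV[OF B.smooth_grad[OF smooth_f i] x1] simp: algebra_simps)

lemma dx_spray_fibre:
  assumes n: "n \<in> Basis"
  shows "dx (0, n) (spray L (0, n)) (x1, x2) (y1, y2) = dx n (spray L2 n) x2 y2"
  by (rule dx_eqI'[OF open_W xyW(1) spray_L_W(2)[OF _ n] smooth_spray_fibre[OF n]], assumption,
      auto intro!: derivative_eq_intros dx_DERIV[OF C.smooth_spray[OF n] xy2])

text \<open>The base correction does not contain y1 and adds nothing to the trace. The radial fibre
  correction adds a multiple of the identity, whose trace is the fibre dimension.\<close>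

lemma spray_div_L: "spray_div L (x1, x2) (y1, y2) = spray_div L1 x1 y1 + spray_div L2 x2 y2 + real DIM('f) * dlog x1 y1"
  by (simp add: spray_div_def sum_Basis_prod dy_spray_base dy_spray_fibre sum.distrib)

end

lemma spray_div_L_W:
  "(x, y) \<in> W \<Longrightarrow> spray_div L x y = spray_div L1 (fst x) (fst y) + spray_div L2 (snd x) (snd y) + real DIM('f) * dlog (fst x) (fst y)"
  using spray_div_L[of "fst x" "fst y" "snd x" "snd y"] by (auto elim!: W_cases)

lemma smooth_spray_div_L:
  "smooth2 W (\<lambda>x y. spray_div L1 (fst x) (fst y) + spray_div L2 (snd x) (snd y) + real DIM('f) * dlog (fst x) (fst y))"
  by (intro smooth_intros B.smooth_spray_div C.smooth_spray_div smooth_dlog)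

context
  fixes x1 y1 :: 'e and x2 y2 :: 'f
  assumes x1: "x1 \<in> X" and y1: "y1 \<noteq> 0" and xy2: "(x2, y2) \<in> W2"
begin

lemmas xyW' = xy[OF x1 y1 xy2]

lemma d_spray_div_L:
  "dx (j, 0) (spray_div L) (x1, x2) (y1, y2) = dx j (spray_div L1) x1 y1 + real DIM('f) * dx j dlog x1 y1"
  "dx (0, m) (spray_div L) (x1, x2) (y1, y2) = dx m (spray_div L2) x2 y2"
  "dy (j, 0) (spray_div L) (x1, x2) (y1, y2) = dy j (spray_div L1) x1 y1 + real DIM('f) * dlog x1 j"
  "dy (0, m) (spray_div L) (x1, x2) (y1, y2) = dy m (spray_div L2) x2 y2"
proof -
  note X = dx_eqI'[OF open_W xyW'(1) spray_div_L_W smooth_spray_div_L]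
  note Y = dy_eqI'[OF open_W xyW'(1) spray_div_L_W smooth_spray_div_L]
  note d = derivative_eq_intros dx_DERIV[OF B.smooth_spray_div xyW'(2)] dx_DERIV[OF C.smooth_spray_div xy2]
    dy_DERIV[OF B.smooth_spray_div xyW'(2)] dy_DERIV[OF C.smooth_spray_div xy2] DERIV_dlog
    dx_DERIV[OF smooth_dlog xyW'(2)]
  show "dx (j, 0) (spray_div L) (x1, x2) (y1, y2) = dx j (spray_div L1) x1 y1 + real DIM('f) * dx j dlog x1 y1"
    by (rule X, assumption, auto intro!: d)
  show "dx (0, m) (spray_div L) (x1, x2) (y1, y2) = dx m (spray_div L2) x2 y2"
    by (rule X, assumption, auto intro!: d)
  show "dy (j, 0) (spray_div L) (x1, x2) (y1, y2) = dy j (spray_div L1) x1 y1 + real DIM('f) * dlog x1 j"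
    by (rule Y, assumption, auto intro!: d)
  show "dy (0, m) (spray_div L) (x1, x2) (y1, y2) = dy m (spray_div L2) x2 y2"
    by (rule Y, assumption, auto intro!: d)
qed

end

lemma dx_dlog:
  assumes "x \<in> X" "y \<noteq> 0"
  shows "dx j dlog x y = (\<Sum>k\<in>Basis. partial j (partial k f) x * (y \<bullet> k)) / f x - dlog x y * partial j f x / f x"
proof (rule dx_eqI[OF smooth_dlog])
  have f: "f x \<noteq> 0" using f_pos[OF assms(1)] by simp
  have n: "((\<lambda>t. \<Sum>k\<in>Basis. partial k f (x + t *\<^sub>R j) * (y \<bullet> k)) has_real_derivative
      (\<Sum>k\<in>Basis. partial j (partial k f) x * (y \<bullet> k))) (at 0)"
    by (intro DERIV_sum DERIV_cmult_right partial_DERIV[OF smooth_on_partial[OF smooth_f] assms(1)])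
  show "((\<lambda>t. dlog (x + t *\<^sub>R j) y) has_real_derivative
    (\<Sum>k\<in>Basis. partial j (partial k f) x * (y \<bullet> k)) / f x - dlog x y * partial j f x / f x) (at 0)"
    unfolding dlog_def using DERIV_divide[OF n DERIV_f[OF assms(1), of j]] f
    by (simp add: diff_divide_distrib mult.commute)
qed (use assms in auto)

text \<open>Along a geodesic of the base, (log f)'' + ((log f)')^2 = f'' / f. Here (log f)'' is the
  derivative of \<open>dlog\<close> along the spray y^j d/dx^j - 2 G^j d/dy^j, and f'' is the
  Hessian of f at y.\<close>

lemma dlog_hess:
  assumes "x \<in> X" "y \<noteq> 0"
  shows "(\<Sum>j\<in>Basis. (y \<bullet> j) * dx j dlog x y) - 2 * (\<Sum>j\<in>Basis. spray L1 j x y * dlog x j) + (dlog x y)\<^sup>2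
    = (\<Sum>i\<in>Basis. \<Sum>j\<in>Basis. B.hess f i j x * (y \<bullet> i) * (y \<bullet> j)) / f x"
proof -
  have f: "f x \<noteq> 0" using f_pos[OF assms(1)] by simp
  have dj: "dlog x j = partial j f x / f x" if "j \<in> Basis" for j
    using sum_Basis_delta[OF that, of "\<lambda>k. partial k f x"] by (simp add: dlog_def)
  let ?P = "\<Sum>i\<in>Basis. \<Sum>j\<in>Basis. partial i (partial j f) x * (y \<bullet> i) * (y \<bullet> j)"
  let ?G = "\<Sum>i\<in>Basis. \<Sum>j\<in>Basis. (\<Sum>k\<in>Basis. B.chr k i j x * partial k f x) * (y \<bullet> i) * (y \<bullet> j)"
  have "(\<Sum>j\<in>Basis. (y \<bullet> j) * dx j dlog x y) = (\<Sum>j\<in>Basis. (y \<bullet> j) * (\<Sum>k\<in>Basis. partial j (partial k f) x * (y \<bullet> k)) / f x)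
      - (\<Sum>j\<in>Basis. dlog x y * (partial j f x * (y \<bullet> j) / f x))"
    by (simp add: dx_dlog[OF assms] sum_subtractf[symmetric] right_diff_distrib mult_ac)
  also have "(\<Sum>j\<in>Basis. (y \<bullet> j) * (\<Sum>k\<in>Basis. partial j (partial k f) x * (y \<bullet> k)) / f x) = ?P / f x"
    by (simp add: sum_divide_distrib sum_distrib_left mult_ac)
  also have "(\<Sum>j\<in>Basis. dlog x y * (partial j f x * (y \<bullet> j) / f x)) = (dlog x y)\<^sup>2"
    by (simp only: sum_distrib_left[symmetric] sum_divide_distrib[symmetric] dlog_def power2_eq_square)
  finally have 1: "(\<Sum>j\<in>Basis. (y \<bullet> j) * dx j dlog x y) = ?P / f x - (dlog x y)\<^sup>2" .
  have "2 * (\<Sum>j\<in>Basis. spray L1 j x y * dlog x j)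
      = (\<Sum>k\<in>Basis. \<Sum>i\<in>Basis. \<Sum>j\<in>Basis. B.chr k i j x * partial k f x * (y \<bullet> i) * (y \<bullet> j)) / f x"
    by (simp add: B.spray_eq[OF assms] dj sum_distrib_left sum_distrib_right sum_divide_distrib mult_ac)
  also have "\<dots> = ?G / f x"
    unfolding sum_distrib_right by (subst sum.swap, subst (2) sum.swap) simp
  finally have 2: "2 * (\<Sum>j\<in>Basis. spray L1 j x y * dlog x j) = ?G / f x" .
  have "(\<Sum>i\<in>Basis. \<Sum>j\<in>Basis. B.hess f i j x * (y \<bullet> i) * (y \<bullet> j)) = ?P - ?G"
    unfolding B.hess_def by (simp add: left_diff_distrib sum_subtractf)
  then show ?thesis unfolding 1 2 by (simp add: diff_divide_distrib)
qed

section \<open>Ricci curvature of the warped product\<close>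

definition hess_trace :: "'e \<Rightarrow> real" where
  "hess_trace x = (\<Sum>i\<in>Basis. \<Sum>j\<in>Basis. B.\<gamma>inv i j x * B.hess f i j x)"

definition grad_norm2 :: "'e \<Rightarrow> real" where
  "grad_norm2 x = (\<Sum>i\<in>Basis. B.grad f i x * partial i f x)"

text \<open>In the combination 2 A - B + 2 C - D of the four facts below, with n2 the fibre
  dimension, the squared gradient norm times F2 squared gets the coefficient -1 - n2 + 2 = 1 - n2.
  The products of \<open>dlog\<close> with \<open>spray_div L2\<close> cancel between C and D, and
  the remaining \<open>dlog\<close> terms of B, C and D combine to the Hessian of f divided by
  f.\<close>

theorem ricci_warped:
  assumes x1: "x1 \<in> X" and y1: "y1 \<noteq> 0" and xy2: "(x2, y2) \<in> W2"
  shows "ricci L (x1, x2) (y1, y2) = ricci L1 x1 y1 + ricci L2 x2 y2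
    - real DIM('f) / f x1 * (\<Sum>i\<in>Basis. \<Sum>j\<in>Basis. B.hess f i j x1 * (y1 \<bullet> i) * (y1 \<bullet> j))
    - (f x1 * hess_trace x1 + (real DIM('f) - 1) * grad_norm2 x1) * L2 x2 y2"
proof -
  note xyW = xy[OF assms]
  have f: "f x1 \<noteq> 0" using f_pos[OF x1] by simp
  have dj: "dlog x1 j = partial j f x1 / f x1" if "j \<in> Basis" for j
    using sum_Basis_delta[OF that, of "\<lambda>k. partial k f x1"] by (simp add: dlog_def)
  let ?n = "real DIM('f)" and ?h = "dlog x1 y1" and ?L = "L2 x2 y2" and ?w = "\<lambda>i. B.grad f i x1"
  let ?D = "\<Sum>i\<in>Basis. partial i (B.grad f i) x1"
  let ?c = "\<Sum>j\<in>Basis. ?w j * (\<Sum>k\<in>Basis. B.chr k k j x1)"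
  have euler2: "(\<Sum>j\<in>Basis. (y2 \<bullet> j) * dy j L2 x2 y2) = 2 * ?L"
    using euler_homog[OF C.smoothL C.homL xy2] by simp
  have eulerS: "(\<Sum>j\<in>Basis. (y2 \<bullet> j) * dy j (spray_div L2) x2 y2) = spray_div L2 x2 y2"
    using euler_homog[OF C.smooth_spray_div C.homog_spray_div xy2] by simp
  have A: "(\<Sum>i\<in>Basis. dx i (spray L i) (x1, x2) (y1, y2)) = (\<Sum>i\<in>Basis. dx i (spray L1 i) x1 y1)
      + (\<Sum>i\<in>Basis. dx i (spray L2 i) x2 y2) - (grad_norm2 x1 + f x1 * ?D) * ?L / 2"
    by (simp add: sum_Basis_prod dx_spray_base[OF assms] dx_spray_fibre[OF assms] sum_subtractf
        grad_norm2_def sum.distrib sum_distrib_left sum_distrib_right sum_divide_distrib add_divide_distrib algebra_simps)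
  have B: "(\<Sum>j\<in>Basis. ((y1, y2) \<bullet> j) * dx j (spray_div L) (x1, x2) (y1, y2))
     = (\<Sum>j\<in>Basis. (y1 \<bullet> j) * dx j (spray_div L1) x1 y1) + (\<Sum>j\<in>Basis. (y2 \<bullet> j) * dx j (spray_div L2) x2 y2)
      + ?n * (\<Sum>j\<in>Basis. (y1 \<bullet> j) * dx j dlog x1 y1)"
    by (simp add: sum_Basis_prod inner_prod_def d_spray_div_L[OF assms] sum.distrib distrib_left sum_distrib_left mult_ac)
  \<comment> \<open>The contracted Christoffel symbols enter through the vertical derivative of the
    base trace; with the divergence of the gradient in A they give the trace of the Hessian.\<close>
  have C: "(\<Sum>j\<in>Basis. spray L j (x1, x2) (y1, y2) * dy j (spray_div L) (x1, x2) (y1, y2))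
     = (\<Sum>j\<in>Basis. spray L1 j x1 y1 * dy j (spray_div L1) x1 y1)
      + (\<Sum>j\<in>Basis. spray L2 j x2 y2 * dy j (spray_div L2) x2 y2)
      + ?n * (\<Sum>j\<in>Basis. spray L1 j x1 y1 * dlog x1 j) - f x1 * ?c * ?L / 2
      - ?n * grad_norm2 x1 * ?L / 2 + ?h * spray_div L2 x2 y2"
  proof -
    have 1: "(\<Sum>j\<in>Basis. f x1 * ?w j * ?L / 2 * (dy j (spray_div L1) x1 y1 + ?n * dlog x1 j))
       = f x1 * ?c * ?L / 2 + ?n * grad_norm2 x1 * ?L / 2"
    proof -
      have "f x1 * ?w j * ?L / 2 * (dy j (spray_div L1) x1 y1 + ?n * dlog x1 j)
        = f x1 * ?L / 2 * (?w j * (\<Sum>k\<in>Basis. B.chr k k j x1)) + ?n * ?L / 2 * (?w j * partial j f x1)"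
        if "j \<in> Basis" for j
        unfolding B.dy_spray_div[OF x1 y1 that] dj[OF that] using f by (simp add: algebra_simps)
      then have "(\<Sum>j\<in>Basis. f x1 * ?w j * ?L / 2 * (dy j (spray_div L1) x1 y1 + ?n * dlog x1 j))
        = (\<Sum>j\<in>Basis. f x1 * ?L / 2 * (?w j * (\<Sum>k\<in>Basis. B.chr k k j x1)) + ?n * ?L / 2 * (?w j * partial j f x1))"
        by (intro sum.cong refl)
      also have "\<dots> = f x1 * ?L / 2 * ?c + ?n * ?L / 2 * grad_norm2 x1"
        by (simp only: sum.distrib sum_distrib_left[symmetric] grad_norm2_def)
      also have "\<dots> = f x1 * ?c * ?L / 2 + ?n * grad_norm2 x1 * ?L / 2"
        by (simp only: times_divide_eq_left mult.assoc mult.commute[of ?L])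
      finally show ?thesis .
    qed
    have "(\<Sum>j\<in>Basis. spray L j (x1, x2) (y1, y2) * dy j (spray_div L) (x1, x2) (y1, y2))
     = (\<Sum>j\<in>Basis. spray L1 j x1 y1 * dy j (spray_div L1) x1 y1) + ?n * (\<Sum>j\<in>Basis. spray L1 j x1 y1 * dlog x1 j)
      - (\<Sum>j\<in>Basis. f x1 * ?w j * ?L / 2 * (dy j (spray_div L1) x1 y1 + ?n * dlog x1 j))
      + ((\<Sum>j\<in>Basis. spray L2 j x2 y2 * dy j (spray_div L2) x2 y2)
      + ?h * (\<Sum>j\<in>Basis. (y2 \<bullet> j) * dy j (spray_div L2) x2 y2))"
    proof -
      have "(s - q) * (d + ?n * e) = s * d + ?n * (s * e) - q * (d + ?n * e)" for s q d e
        by (simp add: algebra_simps)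
      then have base: "(\<Sum>j\<in>Basis. (spray L1 j x1 y1 - f x1 * ?w j * ?L / 2) * (dy j (spray_div L1) x1 y1 + ?n * dlog x1 j))
        = (\<Sum>j\<in>Basis. spray L1 j x1 y1 * dy j (spray_div L1) x1 y1) + ?n * (\<Sum>j\<in>Basis. spray L1 j x1 y1 * dlog x1 j)
        - (\<Sum>j\<in>Basis. f x1 * ?w j * ?L / 2 * (dy j (spray_div L1) x1 y1 + ?n * dlog x1 j))"
        by (simp only: sum_subtractf sum.distrib sum_distrib_left)
      have fib: "(\<Sum>j\<in>Basis. (spray L2 j x2 y2 + ?h * (y2 \<bullet> j)) * dy j (spray_div L2) x2 y2)
        = (\<Sum>j\<in>Basis. spray L2 j x2 y2 * dy j (spray_div L2) x2 y2) + ?h * (\<Sum>j\<in>Basis. (y2 \<bullet> j) * dy j (spray_div L2) x2 y2)"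
        by (simp add: distrib_right sum.distrib sum_distrib_left mult.assoc)
      show ?thesis unfolding base[symmetric] fib[symmetric]
        by (simp add: sum_Basis_prod spray_L[OF assms] d_spray_div_L[OF assms] cong: sum.cong)
    qed
    then show ?thesis unfolding 1 eulerS by simp
  qed
  have D: "(\<Sum>i\<in>Basis. \<Sum>j\<in>Basis. dy j (spray L i) (x1, x2) (y1, y2) * dy i (spray L j) (x1, x2) (y1, y2))
     = (\<Sum>i\<in>Basis. \<Sum>j\<in>Basis. dy j (spray L1 i) x1 y1 * dy i (spray L1 j) x1 y1)
      + (\<Sum>i\<in>Basis. \<Sum>j\<in>Basis. dy j (spray L2 i) x2 y2 * dy i (spray L2 j) x2 y2)
      - 2 * grad_norm2 x1 * ?L + 2 * ?h * spray_div L2 x2 y2 + ?n * ?h\<^sup>2"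
  proof -
    \<comment> \<open>The two off-diagonal blocks multiply each other, and Euler's identity for F2
      squared evaluates the sum over the fibre. The product occurs twice, once for each order of the
      blocks.\<close>
    have cross: "(\<Sum>i\<in>Basis. \<Sum>j\<in>Basis. (f x1 * ?w i * dy j L2 x2 y2 / 2) * (dlog x1 i * (y2 \<bullet> j))) = grad_norm2 x1 * ?L"
    proof -
      have "(\<Sum>j\<in>Basis. (f x1 * ?w i * dy j L2 x2 y2 / 2) * (dlog x1 i * (y2 \<bullet> j)))
         = ?w i * partial i f x1 / 2 * (\<Sum>j\<in>Basis. (y2 \<bullet> j) * dy j L2 x2 y2)" if "i \<in> Basis" for i
        unfolding dj[OF that] sum_distrib_left using f by (intro sum.cong refl) simp
      then show ?thesis unfolding euler2 by (simp add: grad_norm2_def sum_distrib_right mult.assoc)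
    qed
    then have cross': "(\<Sum>j\<in>Basis. \<Sum>i\<in>Basis. (dlog x1 i * (y2 \<bullet> j)) * (f x1 * ?w i * dy j L2 x2 y2 / 2)) = grad_norm2 x1 * ?L"
      by (subst sum.swap) (simp add: mult_ac)
    have delta: "(\<Sum>j\<in>Basis. dy j (spray L2 i) x2 y2 * (?h * (i \<bullet> j))) = ?h * dy i (spray L2 i) x2 y2"
      "(\<Sum>j\<in>Basis. ?h * (j \<bullet> i) * dy i (spray L2 j) x2 y2) = ?h * dy i (spray L2 i) x2 y2"
      "(\<Sum>j\<in>Basis. ?h * (j \<bullet> i) * (?h * (i \<bullet> j))) = ?h\<^sup>2"
      if "i \<in> Basis" for i
      using sum_Basis_delta[OF that, of "\<lambda>j. ?h * dy j (spray L2 i) x2 y2"]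
        sum_Basis_delta[OF that, of "\<lambda>j. ?h * dy i (spray L2 j) x2 y2"]
        sum_Basis_delta[OF that, of "\<lambda>j. ?h * ?h * (i \<bullet> j)"] that
      by (simp_all add: mult_ac inner_commute power2_eq_square)
    have fib: "(\<Sum>i\<in>Basis. \<Sum>j\<in>Basis. (dy j (spray L2 i) x2 y2 + ?h * (j \<bullet> i)) * (dy i (spray L2 j) x2 y2 + ?h * (i \<bullet> j)))
      = (\<Sum>i\<in>Basis. \<Sum>j\<in>Basis. dy j (spray L2 i) x2 y2 * dy i (spray L2 j) x2 y2) + 2 * ?h * spray_div L2 x2 y2 + ?n * ?h\<^sup>2"
    proof -
      have "(\<Sum>j\<in>Basis. (dy j (spray L2 i) x2 y2 + ?h * (j \<bullet> i)) * (dy i (spray L2 j) x2 y2 + ?h * (i \<bullet> j)))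
        = (\<Sum>j\<in>Basis. dy j (spray L2 i) x2 y2 * dy i (spray L2 j) x2 y2) + 2 * ?h * dy i (spray L2 i) x2 y2 + ?h\<^sup>2"
        if "i \<in> Basis" for i
        by (simp only: distrib_left distrib_right sum.distrib delta[OF that] mult_2 add.assoc)
      then show ?thesis
        by (simp add: sum.distrib spray_div_def sum_distrib_left cong: sum.cong)
    qed
    show ?thesis
      by (simp add: sum_Basis_prod dy_spray_base[OF assms] dy_spray_fibre[OF assms] sum.distrib sum_negf fib
          cross[unfolded times_divide_eq_left] cross'[unfolded times_divide_eq_right])
  qed
  have E: "?D = hess_trace x1 - ?c"
    using B.divergence_grad[OF smooth_f x1] by (simp add: hess_trace_def)
  have H: "?n / f x1 * (\<Sum>i\<in>Basis. \<Sum>j\<in>Basis. B.hess f i j x1 * (y1 \<bullet> i) * (y1 \<bullet> j)) =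
     ?n * ((\<Sum>j\<in>Basis. (y1 \<bullet> j) * dx j dlog x1 y1) - 2 * (\<Sum>j\<in>Basis. spray L1 j x1 y1 * dlog x1 j) + ?h\<^sup>2)"
    unfolding dlog_hess[OF x1 y1] by simp
  show ?thesis
    unfolding ricci_eq[OF xyW(1)] B.ricci_eq[OF xyW(2)] C.ricci_eq[OF xy2] A B C D E H
    by (simp add: algebra_simps add_divide_distrib diff_divide_distrib)
qed

text \<open>\<open>grad_norm2\<close> is the inverse metric evaluated on df, and the inverse of a
  positive definite matrix is positive definite.\<close>

lemma grad_norm2_nonneg:
  assumes "x \<in> X"
  shows "grad_norm2 x \<ge> 0"
    and "grad_norm2 x = 0 \<Longrightarrow> i \<in> Basis \<Longrightarrow> partial i f x = 0"
proof -
  have eq: "grad_norm2 x = (\<Sum>i\<in>Basis. \<Sum>j\<in>Basis. B.\<gamma>inv i j x * partial i f x * partial j f x)"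
    by (simp add: grad_norm2_def B.grad_def sum_distrib_left sum_distrib_right mult_ac)
  have *: "\<exists>i\<in>Basis. partial i f x \<noteq> 0 \<Longrightarrow> grad_norm2 x > 0"
    unfolding eq by (rule posdef_sum_pos[OF B.\<gamma>inv_posdef[OF assms]])
  show "grad_norm2 x \<ge> 0"
  proof (cases "\<exists>i\<in>Basis. partial i f x \<noteq> 0")
    case False
    then show ?thesis by (simp add: eq)
  qed (use * in force)
  show "grad_norm2 x = 0 \<Longrightarrow> i \<in> Basis \<Longrightarrow> partial i f x = 0" using * by force
qed

text \<open>Scaling \<open>y1\<close> by \<open>2\<close> while fixing \<open>y2\<close> separates the two blocks of the Einstein equation.\<close>

lemma einstein_split:
  assumes ein: "\<And>y1. y1 \<noteq> 0 \<Longrightarrow> ricci L (x1, x2) (y1, y2) = c * L (x1, x2) (y1, y2)"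
    and x1: "x1 \<in> X" and y1: "y1 \<noteq> 0" and xy2: "(x2, y2) \<in> W2"
  shows "ricci L1 x1 y1 = c * L1 x1 y1
      + real DIM('f) / f x1 * (\<Sum>i\<in>Basis. \<Sum>j\<in>Basis. B.hess f i j x1 * (y1 \<bullet> i) * (y1 \<bullet> j))"
    and "ricci L2 x2 y2 = (c * (f x1)\<^sup>2 + f x1 * hess_trace x1 + (real DIM('f) - 1) * grad_norm2 x1) * L2 x2 y2"
proof -
  define a where "a y = ricci L1 x1 y - c * L1 x1 y
      - real DIM('f) / f x1 * (\<Sum>i\<in>Basis. \<Sum>j\<in>Basis. B.hess f i j x1 * (y \<bullet> i) * (y \<bullet> j))" for y
  define b where "b = ricci L2 x2 y2 - (c * (f x1)\<^sup>2 + f x1 * hess_trace x1 + (real DIM('f) - 1) * grad_norm2 x1) * L2 x2 y2"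
  have ab: "a y + b = 0" if "y \<noteq> 0" for y
    using ein[OF that] unfolding ricci_warped[OF x1 that xy2] L_warped[OF x1 that xy2] a_def b_def
    by (simp add: algebra_simps)
  have "a (2 *\<^sub>R y1) = 4 * a y1"
  proof -
    have "(\<Sum>i\<in>Basis. \<Sum>j\<in>Basis. B.hess f i j x1 * (2 *\<^sub>R y1 \<bullet> i) * (2 *\<^sub>R y1 \<bullet> j))
       = 4 * (\<Sum>i\<in>Basis. \<Sum>j\<in>Basis. B.hess f i j x1 * (y1 \<bullet> i) * (y1 \<bullet> j))"
      by (simp add: sum_distrib_left mult_ac)
    then show ?thesis
      using homogD[OF B.homog_ricci, of x1 y1 2] homogD[OF B.homL, of x1 y1 2] x1 y1
      by (simp add: a_def algebra_simps)
  qed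
  \<comment> \<open>The two instances read a + b = 0 and 4 a + b = 0.\<close>
  then have "a y1 = 0" "b = 0" using ab[OF y1] ab[of "2 *\<^sub>R y1"] y1 by simp_all
  then show "ricci L1 x1 y1 = c * L1 x1 y1
      + real DIM('f) / f x1 * (\<Sum>i\<in>Basis. \<Sum>j\<in>Basis. B.hess f i j x1 * (y1 \<bullet> i) * (y1 \<bullet> j))"
    "ricci L2 x2 y2 = (c * (f x1)\<^sup>2 + f x1 * hess_trace x1 + (real DIM('f) - 1) * grad_norm2 x1) * L2 x2 y2"
    by (simp_all add: a_def b_def)
qed

text \<open>By the separated base equation the Ricci curvature of the base is the quadratic form c g
  + (n2 / f) Hess f, with n2 the fibre dimension; its trace by the base metric is the scalar
  curvature.\<close>

lemma scalar_curv_base: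
  assumes ein: "\<And>x1 y1. x1 \<in> X \<Longrightarrow> y1 \<noteq> 0 \<Longrightarrow> ricci L (x1, x2) (y1, y2) = c x1 * L (x1, x2) (y1, y2)"
    and x1: "x1 \<in> X" and y1: "y1 \<noteq> 0" and xy2: "(x2, y2) \<in> W2"
  shows "scalar_curv L1 x1 y1 = real DIM('e) * c x1 + real DIM('f) / f x1 * hess_trace x1"
proof -
  have "scalar_curv L1 x1 y1 = (\<Sum>i\<in>Basis. \<Sum>j\<in>Basis. B.\<gamma>inv i j x1 * (c x1 * \<gamma> i j x1 + real DIM('f) / f x1 * B.hess f i j x1))"
  proof (rule B.scalar_curv_quadratic[OF _ x1 y1])
    fix x :: 'e and y :: 'e assume x: "x \<in> X" "y \<noteq> 0"
    show "ricci L1 x y = (\<Sum>a\<in>Basis. \<Sum>b\<in>Basis. (c x * \<gamma> a b x + real DIM('f) / f x * B.hess f a b x) * (y \<bullet> a) * (y \<bullet> b))"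
    proof -
      have "ricci L1 x y = c x * L1 x y
        + real DIM('f) / f x * (\<Sum>i\<in>Basis. \<Sum>j\<in>Basis. B.hess f i j x * (y \<bullet> i) * (y \<bullet> j))"
        by (rule einstein_split(1)[OF _ x xy2]) (rule ein[OF x(1)])
      then show ?thesis
        unfolding B.L_eq[OF x] by (simp add: sum_distrib_left sum.distrib distrib_right mult.assoc)
    qed
  qed
  also have "\<dots> = c x1 * (\<Sum>i\<in>Basis. \<Sum>j\<in>Basis. B.\<gamma>inv i j x1 * \<gamma> i j x1) + real DIM('f) / f x1 * hess_trace x1"
    unfolding hess_trace_def sum_distrib_left sum.distrib[symmetric] by (intro sum.cong refl) (simp add: distrib_left mult_ac)
  finally show ?thesis by (simp add: B.\<gamma>inv_trace[OF x1])
qed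

text \<open>The trace of the spray is the trace on the fibre plus terms linear in y1, so two
  vertical derivatives leave only the fibre.\<close>

lemma E_curv_warped:
  assumes "\<And>i j x y. i \<in> Basis \<Longrightarrow> j \<in> Basis \<Longrightarrow> (x, y) \<in> W2 \<Longrightarrow> E_curv L2 i j x y = 0"
    and xy: "(x, y) \<in> W" and i: "i \<in> Basis" and j: "j \<in> Basis"
  shows "E_curv L i j x y = 0"
proof -
  have E: "E_curv M i j x y = dy i (dy j (spray_div M)) x y / 2" for M :: "'z::euclidean_space \<Rightarrow> 'z \<Rightarrow> real" and i j x y
    by (simp add: E_curv_def spray_div_def[abs_def])
  have "dy i (dy j (spray_div L)) x y = 0"
  proof (cases "snd j = 0")
    case True
    then obtain k where k: "j = (k, 0)" "k \<in> Basis" using j by (auto simp: Basis_prod_def)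
    have *: "dy j (spray_div L) x y = (\<Sum>l\<in>Basis. B.chr l l k (fst x)) + real DIM('f) * dlog (fst x) k" if "(x, y) \<in> W" for x y
      using d_spray_div_L(3)[of "fst x" "fst y" "snd x" "snd y" k] B.dy_spray_div[of "fst x" "fst y" k] that k
      by (auto elim!: W_cases)
    have "dy i (dy j (spray_div L)) x y = dy i (\<lambda>x y. (\<Sum>l\<in>Basis. B.chr l l k (fst x)) + real DIM('f) * dlog (fst x) k) x y"
      by (rule dy_cong[OF open_W xy *])
    then show ?thesis by (simp add: dy_def[of i "\<lambda>x y. (\<Sum>l\<in>Basis. B.chr l l k (fst x)) + real DIM('f) * dlog (fst x) k"])
  next
    case False
    then obtain m where m: "j = (0, m)" "m \<in> Basis" using j by (auto simp: Basis_prod_def)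
    have *: "dy j (spray_div L) x y = dy m (spray_div L2) (snd x) (snd y)" if "(x, y) \<in> W" for x y
      using d_spray_div_L(4)[of "fst x" "fst y" "snd x" "snd y" m] that m by (auto elim!: W_cases)
    have xy2: "(snd x, snd y) \<in> W2" using xy by (auto elim: W_cases)
    note sm = smooth2_dy[OF C.openW C.smooth_spray_div]
    show ?thesis
    proof (rule dy_eqI'[OF open_W xy * smooth_fibre[OF sm]], assumption)
      \<comment> \<open>For a base index i the fibre direction \<open>snd i\<close> is zero and so
        is the derivative along it.\<close>
      have "dy (snd i) (dy m (spray_div L2)) (snd x) (snd y) = 0"
      proof (cases "snd i = 0")
        case True
        then show ?thesis using dy_expand[OF sm xy2, of "snd i"] by simp
      next
        case False
        then have "snd i \<in> Basis" using i by (auto simp: Basis_prod_def)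
        then show ?thesis using assms(1)[OF _ m(2) xy2] by (simp add: E)
      qed
      then show "((\<lambda>t. dy m (spray_div L2) (snd x) (snd (y + t *\<^sub>R i))) has_real_derivative 0) (at 0)"
        using dy_DERIV[OF sm xy2, of m "snd i"] by simp
    qed
  qed
  then show ?thesis by (simp add: E)
qed

end

subsection \<open>Hopf's strong maximum principle\<close>

text \<open>One-variable calculus along lines through x: a positive second derivative would make the
  first derivative positive just to the right of x, and the mean value theorem would produce a
  larger value.\<close>

lemma local_max_derivatives:
  fixes u :: "'e::euclidean_space \<Rightarrow> real"
  assumes S: "open S" "x \<in> S" and u: "smooth_on S u" and max: "\<And>y. y \<in> S \<Longrightarrow> u y \<le> u x"
  shows "partial k u x = 0"
    and "(\<Sum>i\<in>Basis. \<Sum>j\<in>Basis. (v \<bullet> i) * (v \<bullet> j) * partial i (partial j u) x) \<le> 0"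
proof -
  have near: "\<exists>d>0. \<forall>t. \<bar>t\<bar> < d \<longrightarrow> x + t *\<^sub>R v \<in> S" for v
  proof -
    have "open ((\<lambda>t::real. x + t *\<^sub>R v) -` S)"
      by (intro open_vimage S continuous_intros)
    moreover have "0 \<in> (\<lambda>t::real. x + t *\<^sub>R v) -` S" using S(2) by simp
    ultimately obtain d where "d > 0" "ball 0 d \<subseteq> (\<lambda>t::real. x + t *\<^sub>R v) -` S"
      using open_contains_ball by blast
    then show ?thesis by (auto simp: subset_iff)
  qed
  have first: "frechet_derivative u (at x) v = 0" for v
  proof -
    obtain d where d: "d > 0" "\<And>t. \<bar>t\<bar> < d \<Longrightarrow> x + t *\<^sub>R v \<in> S" using near by blast
    have "((\<lambda>t. u (x + t *\<^sub>R v)) has_real_derivative frechet_derivative u (at x) v) (at 0)"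
      using smooth_on_DERIV_line[OF u, of x 0 v] S(2) by simp
    then show ?thesis
      by (rule DERIV_local_max[OF _ d(1)]) (use max d(2) in auto)
  qed
  then show "partial k u x = 0" by (simp add: partial_def)
  let ?h = "\<lambda>z. frechet_derivative u (at z) v"
  have "(\<Sum>i\<in>Basis. \<Sum>j\<in>Basis. (v \<bullet> i) * (v \<bullet> j) * partial i (partial j u) x)
     = (\<Sum>i\<in>Basis. (v \<bullet> i) * partial i (\<lambda>x. \<Sum>j\<in>Basis. (v \<bullet> j) * partial j u x) x)"
    by (simp add: partial_sum[OF S(1) smooth_on_partial[OF u] S(2)] sum_distrib_left mult.assoc)
  also have "\<dots> = (\<Sum>i\<in>Basis. (v \<bullet> i) * partial i ?h x)"
    by (intro sum.cong refl arg_cong[where f="\<lambda>z. _ * z"] partial_cong[OF S])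
      (simp add: frechet_derivative_partial[OF u])
  also have "\<dots> = frechet_derivative ?h (at x) v"
    by (rule frechet_derivative_partial[OF smooth_on_derivative[OF u] S(2), symmetric])
  finally have eq: "(\<Sum>i\<in>Basis. \<Sum>j\<in>Basis. (v \<bullet> i) * (v \<bullet> j) * partial i (partial j u) x) = frechet_derivative ?h (at x) v" .
  show "(\<Sum>i\<in>Basis. \<Sum>j\<in>Basis. (v \<bullet> i) * (v \<bullet> j) * partial i (partial j u) x) \<le> 0"
  proof (rule ccontr)
    assume "\<not> ?thesis"
    then have pos: "frechet_derivative ?h (at x) v > 0" unfolding eq by simp
    have "((\<lambda>t. ?h (x + t *\<^sub>R v)) has_real_derivative frechet_derivative ?h (at x) v) (at 0)"
      using smooth_on_DERIV_line[OF smooth_on_derivative[OF u, of v], of x 0 v] S(2) by simp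
    from DERIV_pos_inc_right[OF this pos] obtain e where e: "e > 0" "\<And>t. t > 0 \<Longrightarrow> t < e \<Longrightarrow> ?h (x + t *\<^sub>R v) > 0"
      using first by auto
    obtain d where d: "d > 0" "\<And>t. \<bar>t\<bar> < d \<Longrightarrow> x + t *\<^sub>R v \<in> S" using near by blast
    define t where "t = min d e / 2"
    have t: "0 < t" "t < d" "t < e" using d(1) e(1) by (auto simp: t_def)
    have "\<exists>s>0. s < t \<and> u (x + t *\<^sub>R v) - u (x + 0 *\<^sub>R v) = (t - 0) * ?h (x + s *\<^sub>R v)"
      by (rule MVT2[OF t(1), of "\<lambda>s. u (x + s *\<^sub>R v)"], rule smooth_on_DERIV_line[OF u]) (use d(2) t in auto)
    then obtain s where s: "s > 0" "s < t" "u (x + t *\<^sub>R v) - u x = t * ?h (x + s *\<^sub>R v)" by auto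
    have "?h (x + s *\<^sub>R v) > 0" using e(2) s t by auto
    then have "u (x + t *\<^sub>R v) > u x" using s(3) t(1) by (smt (verit) mult_pos_pos)
    moreover have "u (x + t *\<^sub>R v) \<le> u x" using max d(2) t by auto
    ultimately show False by simp
  qed
qed

text \<open>Second order elliptic operators without a term of order zero. The sign in front of b
  matches the Christoffel term of the Hessian.\<close>

locale elliptic =
  fixes X :: "'e::euclidean_space set" and a :: "'e \<Rightarrow> 'e \<Rightarrow> 'e \<Rightarrow> real" and b :: "'e \<Rightarrow> 'e \<Rightarrow> real"
  assumes openX: "open X"
    and cont_a: "\<And>i j. i \<in> Basis \<Longrightarrow> j \<in> Basis \<Longrightarrow> continuous_on X (a i j)"
    and cont_b: "\<And>k. k \<in> Basis \<Longrightarrow> continuous_on X (b k)"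
    and pos_a: "\<And>x. x \<in> X \<Longrightarrow> posdef (\<lambda>i j. a i j x)"
    and sym_a: "\<And>x i j. x \<in> X \<Longrightarrow> i \<in> Basis \<Longrightarrow> j \<in> Basis \<Longrightarrow> a i j x = a j i x"
begin

definition op :: "('e \<Rightarrow> real) \<Rightarrow> 'e \<Rightarrow> real" where
  "op u x = (\<Sum>i\<in>Basis. \<Sum>j\<in>Basis. a i j x * partial i (partial j u) x) - (\<Sum>k\<in>Basis. b k x * partial k u x)"

text \<open>Hopf's comparison function without the customary constant exp (- alpha R^2) subtracted;
  a constant does not change the value of the operator.\<close>

definition barrier :: "real \<Rightarrow> 'e \<Rightarrow> 'e \<Rightarrow> real" where
  "barrier \<alpha> z x = exp (- \<alpha> * ((x - z) \<bullet> (x - z)))"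

lemma smooth_barrier: "open S \<Longrightarrow> smooth_on S (barrier \<alpha> z)"
proof -
  assume S: "open S"
  have "smooth_on S (\<lambda>x. exp (- \<alpha> * (\<Sum>i\<in>Basis. (x \<bullet> i - z \<bullet> i) * (x \<bullet> i - z \<bullet> i))))"
    by (intro smooth_on_exp smooth_on_mult smooth_on_const smooth_on_sum smooth_on_diff S smooth_on_linear
        bounded_linear_inner_left)
  moreover have "(\<lambda>x. exp (- \<alpha> * (\<Sum>i\<in>Basis. (x \<bullet> i - z \<bullet> i) * (x \<bullet> i - z \<bullet> i)))) = barrier \<alpha> z"
    by (rule ext, unfold barrier_def euclidean_inner[of "_ - z" "_ - z"]) (simp add: inner_diff_left)
  ultimately show ?thesis by simp
qed

lemma partial_barrier: "partial k (barrier \<alpha> z) x = - 2 * \<alpha> * ((x - z) \<bullet> k) * barrier \<alpha> z x"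
  by (rule partial_eqI[OF smooth_barrier[of UNIV]])
    (auto intro!: derivative_eq_intros has_derivative_inner simp: barrier_def has_field_derivative_def algebra_simps inner_commute)

lemma partial2_barrier:
  "partial i (partial j (barrier \<alpha> z)) x = (4 * \<alpha>\<^sup>2 * ((x - z) \<bullet> i) * ((x - z) \<bullet> j) - 2 * \<alpha> * (i \<bullet> j)) * barrier \<alpha> z x"
proof (rule partial_eqI[OF smooth_on_partial[OF smooth_barrier[of UNIV]]])
  have d: "((\<lambda>t. barrier \<alpha> z (x + t *\<^sub>R i)) has_real_derivative partial i (barrier \<alpha> z) x) (at 0)"
    by (rule partial_DERIV[OF smooth_barrier[of UNIV]]) auto
  have l: "((\<lambda>t. - 2 * \<alpha> * ((x + t *\<^sub>R i - z) \<bullet> j)) has_real_derivative - 2 * \<alpha> * (i \<bullet> j)) (at 0)"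
    by (auto intro!: derivative_eq_intros simp: inner_add_left inner_diff_left)
  show "((\<lambda>t. partial j (barrier \<alpha> z) (x + t *\<^sub>R i)) has_real_derivative
    (4 * \<alpha>\<^sup>2 * ((x - z) \<bullet> i) * ((x - z) \<bullet> j) - 2 * \<alpha> * (i \<bullet> j)) * barrier \<alpha> z x) (at 0)"
    unfolding partial_barrier using DERIV_mult[OF l d]
    by (rule DERIV_cong) (simp add: partial_barrier algebra_simps power2_eq_square)
qed auto

text \<open>Displays the dependence on alpha: where the matrix a is positive definite and x differs
  from z, the quadratic term is positive and wins over the linear one for large alpha.\<close>

lemma op_barrier:
  "op (barrier \<alpha> z) x = barrier \<alpha> z x * (4 * \<alpha>\<^sup>2 * (\<Sum>i\<in>Basis. \<Sum>j\<in>Basis. a i j x * ((x - z) \<bullet> i) * ((x - z) \<bullet> j))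
    - 2 * \<alpha> * ((\<Sum>i\<in>Basis. \<Sum>j\<in>Basis. a i j x * (i \<bullet> j)) - (\<Sum>k\<in>Basis. b k x * ((x - z) \<bullet> k))))"
proof -
  have "(\<Sum>i\<in>Basis. \<Sum>j\<in>Basis. a i j x * partial i (partial j (barrier \<alpha> z)) x)
     = barrier \<alpha> z x * 4 * \<alpha>\<^sup>2 * (\<Sum>i\<in>Basis. \<Sum>j\<in>Basis. a i j x * ((x - z) \<bullet> i) * ((x - z) \<bullet> j))
     - barrier \<alpha> z x * 2 * \<alpha> * (\<Sum>i\<in>Basis. \<Sum>j\<in>Basis. a i j x * (i \<bullet> j))"
    unfolding partial2_barrier sum_distrib_left sum_subtractf[symmetric]
    by (intro sum.cong refl) (simp add: algebra_simps)
  moreover have "(\<Sum>k\<in>Basis. b k x * partial k (barrier \<alpha> z) x) = - barrier \<alpha> z x * 2 * \<alpha> * (\<Sum>k\<in>Basis. b k x * ((x - z) \<bullet> k))"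
    unfolding partial_barrier sum_distrib_left by (intro sum.cong refl) (simp add: algebra_simps)
  ultimately show ?thesis unfolding op_def by (simp add: algebra_simps)
qed

text \<open>At a maximum the first order part vanishes and the second derivatives are negative
  semidefinite.\<close>

lemma op_at_max_nonpos:
  assumes "open S" "S \<subseteq> X" "x \<in> S" "smooth_on S u" "\<And>y. y \<in> S \<Longrightarrow> u y \<le> u x"
  shows "op u x \<le> 0"
proof -
  note lm = local_max_derivatives[OF assms(1,3,4,5)]
  have "(\<Sum>i\<in>Basis. \<Sum>j\<in>Basis. a i j x * partial i (partial j u) x) \<le> 0"
    by (rule posdef_trace_nonpos[OF pos_a sym_a]) (use assms lm(2) in auto)
  then show ?thesis by (simp add: op_def lm(1))
qed

lemma op_add_scaled:
  assumes "smooth_on X u" "smooth_on X v" "x \<in> X"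
  shows "op (\<lambda>x. u x + \<epsilon> * v x) x = op u x + \<epsilon> * op v x"
proof -
  have p: "partial k (\<lambda>x. u x + \<epsilon> * v x) x = partial k u x + \<epsilon> * partial k v x"
    if "smooth_on X u" "smooth_on X v" "x \<in> X" for k u v x
    by (rule partial_eqI[OF _ that(3)])
      (auto intro!: smooth_on_add smooth_on_mult smooth_on_const openX that derivative_eq_intros
        partial_DERIV[OF that(1,3)] partial_DERIV[OF that(2,3)])
  have "partial i (partial j (\<lambda>x. u x + \<epsilon> * v x)) x = partial i (partial j u) x + \<epsilon> * partial i (partial j v) x" for i j
  proof -
    have "partial i (partial j (\<lambda>x. u x + \<epsilon> * v x)) x = partial i (\<lambda>x. partial j u x + \<epsilon> * partial j v x) x"
      by (rule partial_cong[OF openX assms(3)]) (rule p[OF assms(1,2)])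
    also have "\<dots> = partial i (partial j u) x + \<epsilon> * partial i (partial j v) x"
      by (rule p[OF smooth_on_partial smooth_on_partial]) (rule assms)+
    finally show ?thesis .
  qed
  then show ?thesis
    by (simp add: op_def p[OF assms] sum.distrib sum_distrib_left algebra_simps)
qed

text \<open>Adding a small multiple of the barrier to \<open>u\<close> makes the operator positive near \<open>x1\<close> and keeps the
  maximum over a small ball around \<open>x1\<close> away from its boundary.\<close>

lemma no_interior_touching:
  assumes u: "smooth_on X u" "\<And>x. x \<in> X \<Longrightarrow> op u x \<ge> 0" and M: "\<And>x. x \<in> X \<Longrightarrow> u x \<le> u x1"
    and x1: "x1 \<in> X" "dist x1 z = R" "R > 0"
    and ball: "\<And>x. x \<in> X \<Longrightarrow> dist x z \<le> R \<Longrightarrow> x \<noteq> x1 \<Longrightarrow> u x < u x1"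
  shows False
proof -
  obtain \<rho>' where \<rho>': "\<rho>' > 0" "cball x1 \<rho>' \<subseteq> X" using openX x1(1) open_contains_cball by blast
  \<comment> \<open>A radius of at most R / 2 keeps z outside the small ball, so that x - z does not
    vanish on it.\<close>
  define \<rho> where "\<rho> = min \<rho>' (R / 2)"
  have \<rho>: "\<rho> > 0" "\<rho> < R" "cball x1 \<rho> \<subseteq> X" using \<rho>' x1(3) by (auto simp: \<rho>_def)
  let ?K = "cball x1 \<rho>"
  let ?A = "\<lambda>x. \<Sum>i\<in>Basis. \<Sum>j\<in>Basis. a i j x * ((x - z) \<bullet> i) * ((x - z) \<bullet> j)"
  let ?B = "\<lambda>x. (\<Sum>i\<in>Basis. \<Sum>j\<in>Basis. a i j x * (i \<bullet> j)) - (\<Sum>k\<in>Basis. b k x * ((x - z) \<bullet> k))"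
  have K: "compact ?K" "?K \<noteq> {}" using \<rho> by auto
  have nz: "x - z \<noteq> 0" if "x \<in> ?K" for x
    using that x1(2) \<rho> by auto
  have cA: "continuous_on ?K ?A"
    by (intro continuous_intros continuous_on_subset[OF cont_a \<rho>(3)]) auto
  have cB: "continuous_on ?K ?B"
    by (intro continuous_intros continuous_on_subset[OF cont_a \<rho>(3)] continuous_on_subset[OF cont_b \<rho>(3)]) auto
  obtain xa where xa: "xa \<in> ?K" "\<And>x. x \<in> ?K \<Longrightarrow> ?A xa \<le> ?A x"
    using continuous_attains_inf[OF K cA] by blast
  obtain xb where xb: "xb \<in> ?K" "\<And>x. x \<in> ?K \<Longrightarrow> ?B x \<le> ?B xb"
    using continuous_attains_sup[OF K cB] by blast
  define c where "c = ?A xa"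
  define C where "C = \<bar>?B xb\<bar> + 1"
  have c: "c > 0"
    using pos_a[of xa] xa(1) \<rho>(3) nz[OF xa(1)] unfolding c_def posdef_def by blast
  have C: "C > 0" by (simp add: C_def)
  \<comment> \<open>This makes 4 alpha^2 c = 4 alpha C, twice the bound 2 alpha C of the linear
    term.\<close>
  define \<alpha> where "\<alpha> = C / c"
  have \<alpha>: "\<alpha> > 0" using c C by (simp add: \<alpha>_def)
  let ?e = "barrier \<alpha> z"
  have e_pos: "?e x > 0" for x by (simp add: barrier_def)
  have op_e: "op ?e x > 0" if x: "x \<in> ?K" for x
  proof -
    have 1: "4 * \<alpha>\<^sup>2 * ?A x \<ge> 4 * \<alpha>\<^sup>2 * c" using xa(2)[OF x] by (simp add: c_def mult_left_mono)
    have "?B x \<le> C" using xb(2)[OF x] by (simp add: C_def)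
    then have 2: "2 * \<alpha> * ?B x \<le> 2 * \<alpha> * C" using \<alpha> by simp
    have "4 * \<alpha>\<^sup>2 * c - 2 * \<alpha> * C = 2 * \<alpha> * C"
      using c by (simp add: \<alpha>_def power2_eq_square)
    then have "4 * \<alpha>\<^sup>2 * ?A x - 2 * \<alpha> * ?B x > 0" using 1 2 \<alpha> C by (smt (verit) mult_pos_pos)
    then show ?thesis unfolding op_barrier using e_pos by (rule mult_pos_pos[rotated])
  qed
  \<comment> \<open>On this part of the small sphere u is strictly below its maximum, since x1 is
    the only point of the touching ball in X where the maximum is attained. Compactness gives a
    uniform gap.\<close>
  let ?T = "sphere x1 \<rho> \<inter> cball z R"
  have subT: "?T \<subseteq> X" using \<rho>(3) by auto
  obtain \<delta> where \<delta>: "\<delta> > 0" "\<And>x. x \<in> ?T \<Longrightarrow> u x \<le> u x1 - \<delta>"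
  proof (cases "?T = {}")
    case True
    \<comment> \<open>There is no point to compare, so any positive gap serves.\<close>
    then show ?thesis by (intro that[of 1]) auto
  next
    case False
    have "compact ?T" by (intro compact_Int_closed) auto
    moreover have "continuous_on ?T u"
      by (rule continuous_on_subset[OF smooth_on_imp_continuous_on[OF u(1)] subT])
    ultimately obtain xt where xt: "xt \<in> ?T" "\<And>x. x \<in> ?T \<Longrightarrow> u x \<le> u xt"
      using continuous_attains_sup[OF _ False] by blast
    have "u xt < u x1" using xt(1) \<rho> subT by (intro ball) (auto simp: dist_commute)
    then show ?thesis using xt(2) by (intro that[of "u x1 - u xt"]) auto
  qed
  \<comment> \<open>The barrier is at most 1, so adding this multiple uses up at most half of the
    gap.\<close>
  define w where "w x = u x + (\<delta> / 2) * ?e x" for x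
  have sw: "smooth_on X w" unfolding w_def[abs_def]
    by (intro smooth_on_add smooth_on_mult smooth_on_const openX u smooth_barrier)
  \<comment> \<open>Outside the touching ball the barrier is smaller than at x1, which settles the
    rest of the small sphere.\<close>
  have ex: "?e x < ?e x1 \<longleftrightarrow> dist x z > R" for x
  proof -
    have "?e x < ?e x1 \<longleftrightarrow> (x1 - z) \<bullet> (x1 - z) < (x - z) \<bullet> (x - z)"
      using \<alpha> by (simp add: barrier_def)
    also have "\<dots> \<longleftrightarrow> dist x1 z < dist x z" by (simp add: dist_norm norm_lt)
    finally show ?thesis using x1(2) by simp
  qed
  have sphere: "w x < w x1" if x: "x \<in> sphere x1 \<rho>" for x
  proof (cases "dist x z \<le> R")
    case True
    then have "x \<in> ?T" using x by (simp add: dist_commute)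
    then have "u x \<le> u x1 - \<delta>" by (rule \<delta>(2))
    moreover have "?e x \<le> 1" using \<alpha> by (simp add: barrier_def)
    then have "\<delta> / 2 * ?e x \<le> \<delta> / 2" using \<delta>(1) by simp
    moreover have "\<delta> / 2 * ?e x1 > 0" using \<delta>(1) e_pos by simp
    ultimately show ?thesis unfolding w_def using \<delta>(1) by linarith
  next
    case False
    then have "?e x < ?e x1" using ex by simp
    then have "\<delta> / 2 * ?e x < \<delta> / 2 * ?e x1" using \<delta>(1) by simp
    moreover have "u x \<le> u x1" using x \<rho>(3) by (intro M) auto
    ultimately show ?thesis unfolding w_def by linarith
  qed
  obtain y where y: "y \<in> ?K" "\<And>x. x \<in> ?K \<Longrightarrow> w x \<le> w y"
    using continuous_attains_sup[OF K continuous_on_subset[OF smooth_on_imp_continuous_on[OF sw] \<rho>(3)]] by blast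
  have "w x1 \<le> w y" using \<rho> by (intro y(2)) simp
  then have "y \<notin> sphere x1 \<rho>" using sphere[of y] by auto
  then have yb: "y \<in> ball x1 \<rho>" using y(1) by auto
  have yX: "y \<in> X" using y(1) \<rho>(3) by auto
  have "op w y \<le> 0"
    by (rule op_at_max_nonpos[of "ball x1 \<rho>"]) (use yb y(2) \<rho>(3) in \<open>auto intro!: smooth_on_subset[OF sw]\<close>)
  moreover have "op w y = op u y + \<delta> / 2 * op ?e y"
    unfolding w_def[abs_def] by (rule op_add_scaled[OF u(1) smooth_barrier[OF openX] yX])
  moreover have "\<delta> / 2 * op ?e y > 0" using op_e[OF y(1)] \<delta>(1) by simp
  ultimately show False using u(2)[OF yX] by linarith
qed

text \<open>If u were smaller at some z near x0, the maximum point nearest to z would lie on the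
  boundary of a ball that contains no other maximum point, and \<open>no_interior_touching\<close>
  excludes this.\<close>

theorem strong_maximum_principle:
  assumes u: "smooth_on X u" "\<And>x. x \<in> X \<Longrightarrow> op u x \<ge> 0" and x0: "x0 \<in> X" and M: "\<And>x. x \<in> X \<Longrightarrow> u x \<le> u x0"
  shows "\<exists>e>0. ball x0 e \<subseteq> X \<and> (\<forall>x\<in>ball x0 e. u x = u x0)"
proof -
  obtain r3 where r3: "r3 > 0" "cball x0 r3 \<subseteq> X" using openX x0 open_contains_cball by blast
  \<comment> \<open>For z within r of x0, every point within r of z lies within 2 r of x0, hence in
    X.\<close>
  define r where "r = r3 / 2"
  have r: "r > 0" "cball x0 (2 * r) \<subseteq> X" using r3 by (auto simp: r_def)
  have "u z = u x0" if z: "z \<in> ball x0 r" for z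
  proof (rule ccontr)
    assume "u z \<noteq> u x0"
    define K where "K = {x \<in> cball x0 (2 * r). u x = u x0}"
    have "continuous_on (cball x0 (2 * r)) u"
      by (rule continuous_on_subset[OF smooth_on_imp_continuous_on[OF u(1)] r(2)])
    then have "closed K" unfolding K_def
      by (intro continuous_closed_preimage_constant) auto
    moreover have "x0 \<in> K" using r by (simp add: K_def)
    ultimately obtain x1 where x1: "x1 \<in> K" "\<And>y. y \<in> K \<Longrightarrow> dist z x1 \<le> dist z y"
      using distance_attains_inf[of K z] by blast
    have ux1: "u x1 = u x0" "x1 \<in> X" using x1(1) r(2) by (auto simp: K_def)
    have neq: "z \<noteq> x1" using ux1 \<open>u z \<noteq> u x0\<close> by auto
    have zr: "dist z x1 < r" using x1(2)[OF \<open>x0 \<in> K\<close>] z by (simp add: dist_commute)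
    \<comment> \<open>Halving the ball about z makes the contact strict: the smaller ball is
      internally tangent at x1 and meets the larger sphere nowhere else.\<close>
    define m where "m = midpoint z x1"
    define R where "R = dist z x1 / 2"
    have mR: "dist z m = R" "dist x1 m = R" by (simp_all add: m_def R_def dist_midpoint)
    show False
    proof (rule no_interior_touching[OF u _ ux1(2) mR(2)])
      show "R > 0" using neq by (simp add: R_def)
      show "u x \<le> u x1" if "x \<in> X" for x using M[OF that] ux1 by simp
      fix x assume x: "x \<in> X" "dist x m \<le> R" "x \<noteq> x1"
      have xz: "dist z x \<le> 2 * R" using dist_triangle[of z x m] mR x(2) by (simp add: dist_commute)
      have "dist x0 x \<le> dist x0 z + dist z x" by (rule dist_triangle)
      then have xc: "x \<in> cball x0 (2 * r)" using xz z zr by (simp add: R_def)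
      have "u x \<noteq> u x1"
      proof
        assume "u x = u x1"
        then have "x \<in> K" using xc ux1 by (simp add: K_def)
        then have "dist z x \<ge> 2 * R" using x1(2) by (simp add: R_def)
        then have eq: "dist z x = 2 * R" using xz by simp
        then have dm: "dist x m = R" using dist_triangle[of z x m] mR x(2) by (simp add: dist_commute)
        \<comment> \<open>Equality in the triangle inequality puts x on the ray from z through m, at
          the position of x1.\<close>
        have "norm ((m - z) + (x - m)) = norm (m - z) + norm (x - m)"
          using eq dm mR by (simp add: dist_norm norm_minus_commute)
        then have "norm (m - z) *\<^sub>R (x - m) = norm (x - m) *\<^sub>R (m - z)"
          by (rule norm_triangle_eq[THEN iffD1])
        then have "R *\<^sub>R (x - m) = R *\<^sub>R (m - z)" using dm mR by (simp add: dist_norm norm_minus_commute)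
        then have "x - m = m - z" using \<open>R > 0\<close> by simp
        then have "x = 2 *\<^sub>R m - z" by (simp add: algebra_simps scaleR_2)
        also have "\<dots> = x1" by (simp add: m_def midpoint_def)
        finally show False using x(3) by simp
      qed
      moreover have "u x \<le> u x1" using M[OF x(1)] ux1 by simp
      ultimately show "u x < u x1" by simp
    qed
  qed
  moreover have "ball x0 r \<subseteq> X" using r by (auto intro: order_trans[rotated])
  ultimately show ?thesis using r(1) by blast
qed

end

subsection \<open>Charts and tangent vectors\<close>

lemma tvec_eqI:
  assumes "((h \<circ> cinv c) has_derivative D) (at (cmap c p))"
  shows "tvec c p y h = D y"
proof -
  have "(h \<circ> cinv c) differentiable (at (cmap c p))" using assms by (rule differentiableI)
  moreover have "frechet_derivative (h \<circ> cinv c) (at (cmap c p)) = D"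
    by (rule frechet_derivative_at[OF assms, symmetric])
  ultimately show ?thesis by (simp add: tvec_def)
qed

locale manifold =
  fixes A :: "('a::{t2_space,second_countable_topology}, 'e::euclidean_space) chart set"
  assumes manifold: "smooth_manifold A"
begin

lemma chart:
  assumes "c \<in> A"
  shows open_cdom: "open (cdom c)" and open_cimage: "open (cimage c)"
    and cinv_cmap: "p \<in> cdom c \<Longrightarrow> cinv c (cmap c p) = p"
    and cmap_cinv: "x \<in> cimage c \<Longrightarrow> cmap c (cinv c x) = x"
    and cinv_in: "x \<in> cimage c \<Longrightarrow> cinv c x \<in> cdom c"
    and continuous_cmap: "continuous_on (cdom c) (cmap c)"
    and continuous_cinv: "continuous_on (cimage c) (cinv c)"
proof -
  have *: "open (cdom c)" "open (cimage c)" "homeomorphism (cdom c) (cimage c) (cmap c) (cinv c)"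
    using manifold assms unfolding smooth_manifold_def by blast+
  then show "open (cdom c)" "open (cimage c)" "p \<in> cdom c \<Longrightarrow> cinv c (cmap c p) = p"
    "continuous_on (cdom c) (cmap c)" "continuous_on (cimage c) (cinv c)"
    by (auto simp: homeomorphism_def)
  show "x \<in> cimage c \<Longrightarrow> cmap c (cinv c x) = x" "x \<in> cimage c \<Longrightarrow> cinv c x \<in> cdom c"
    by (simp_all add: f_inv_into_f inv_into_into)
qed

lemma ex_chart: "\<exists>c\<in>A. p \<in> cdom c"
  using manifold unfolding smooth_manifold_def by blast

lemma chart_at: "chart_at A p \<in> A" "p \<in> cdom (chart_at A p)"
proof -
  have "chart_at A p \<in> A \<and> p \<in> cdom (chart_at A p)"
    unfolding chart_at_def by (rule someI_ex) (use ex_chart in blast)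
  then show "chart_at A p \<in> A" "p \<in> cdom (chart_at A p)" by auto
qed

lemma open_overlap:
  assumes c: "c \<in> A" and U: "open U" "U \<subseteq> cdom c"
  shows "open (cmap c ` U)"
proof -
  have "cmap c ` U = cimage c \<inter> cinv c -` U"
    using U(2) cinv_cmap[OF c] cmap_cinv[OF c] by (force simp: image_iff)
  then show ?thesis
    using continuous_open_preimage[OF continuous_cinv[OF c] open_cimage[OF c] U(1)] by simp
qed

lemma components_tvec:
  assumes c: "c \<in> A" and p: "p \<in> cdom c"
  shows "components c (tvec c p y) = y"
proof -
  have "tvec c p y (\<lambda>q. cmap c q \<bullet> i) = y \<bullet> i" for i
  proof -
    have d: "((\<lambda>x. x \<bullet> i) has_derivative (\<lambda>v. v \<bullet> i)) (at (cmap c p))"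
      by (auto intro!: derivative_eq_intros)
    have "(((\<lambda>q. cmap c q \<bullet> i) \<circ> cinv c) has_derivative (\<lambda>v. v \<bullet> i)) (at (cmap c p))"
      by (rule has_derivative_transform_within_open[OF d open_cimage[OF c]]) (use p cmap_cinv[OF c] in auto)
    then show ?thesis by (rule tvec_eqI)
  qed
  then show ?thesis by (simp add: components_def euclidean_representation)
qed

lemma tvec_scale: "tvec c p (t *\<^sub>R y) = (\<lambda>h. t * tvec c p y h)"
  using linear_frechet_derivative[THEN linear_cmul] by (force simp: tvec_def)

lemma tvec_0: "tvec c p 0 = (\<lambda>_. 0)"
  using tvec_scale[of c p 0 0] by simp

lemma tvec_eq_0_iff: "c \<in> A \<Longrightarrow> p \<in> cdom c \<Longrightarrow> tvec c p y = (\<lambda>_. 0) \<longleftrightarrow> y = 0"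
  using components_tvec[of c p y] tvec_0[of c p] by (auto simp: components_def)

lemma tvec_in_tspace: "c \<in> A \<Longrightarrow> p \<in> cdom c \<Longrightarrow> tvec c p y \<in> tspace A p"
  unfolding tspace_def by blast

lemma tvec_in_slit: "c \<in> A \<Longrightarrow> p \<in> cdom c \<Longrightarrow> tvec c p y \<in> slit A p \<longleftrightarrow> y \<noteq> 0"
  unfolding slit_def using tvec_in_tspace tvec_eq_0_iff by auto

lemma locdom_slit:
  assumes c: "c \<in> A"
  shows "locdom c (slit A) = cimage c \<times> (- {0})"
proof -
  have "x \<in> cimage c \<Longrightarrow> tvec c (cinv c x) y \<in> slit A (cinv c x) \<longleftrightarrow> y \<noteq> 0" for x y
    by (rule tvec_in_slit[OF c cinv_in[OF c]])
  then show ?thesis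
    unfolding locdom_def by (simp add: set_eq_iff split_paired_all cong: conj_cong del: image_iff)
qed

text \<open>The Jacobian at p of the change of coordinates from c to d.\<close>

definition transition :: "('a, 'e) chart \<Rightarrow> ('a, 'e) chart \<Rightarrow> 'a \<Rightarrow> 'e \<Rightarrow> 'e" where
  "transition c d p = frechet_derivative (cmap d \<circ> cinv c) (at (cmap c p))"

lemma tangent_chain:
  assumes c: "c \<in> A" "p \<in> cdom c" and d: "d \<in> A" "p \<in> cdom d"
    and h: "((h \<circ> cinv d) has_derivative D) (at (cmap d p))"
  shows "((h \<circ> cinv c) has_derivative D \<circ> transition c d p) (at (cmap c p))"
proof -
  let ?S = "cmap c ` (cdom c \<inter> cdom d)"
  have S: "open ?S" "cmap c p \<in> ?S"
    using c d by (auto intro!: open_overlap open_Int open_cdom)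
  have "smooth_on ?S (cmap d \<circ> cinv c)"
    using manifold c(1) d(1) unfolding smooth_manifold_def by blast
  from smooth_on_has_derivative[OF this S(2)]
  have t: "((cmap d \<circ> cinv c) has_derivative transition c d p) (at (cmap c p))"
    by (simp add: transition_def)
  have "(cmap d \<circ> cinv c) (cmap c p) = cmap d p" by (simp add: cinv_cmap c)
  with diff_chain_at[OF t] h
  have "((h \<circ> cinv d) \<circ> (cmap d \<circ> cinv c) has_derivative D \<circ> transition c d p) (at (cmap c p))" by simp
  then show ?thesis
    by (rule has_derivative_transform_within_open[OF _ S]) (use cinv_cmap c(1) d(1) in auto)
qed

text \<open>Equality of operators also concerns functions that are not differentiable. The chain
  rule in both directions shows that differentiability at p does not depend on the chart, so the
  default value 0 is taken on the same functions.\<close>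

lemma tvec_transition:
  assumes c: "c \<in> A" "p \<in> cdom c" and d: "d \<in> A" "p \<in> cdom d"
  shows "tvec c p y = tvec d p (transition c d p y)"
proof
  fix h
  show "tvec c p y h = tvec d p (transition c d p y) h"
  proof (cases "(h \<circ> cinv d) differentiable (at (cmap d p))")
    case True
    from tvec_eqI[OF tangent_chain[OF c d this[unfolded frechet_derivative_works]]] True
    show ?thesis by (simp add: tvec_def)
  next
    case False
    then have "\<not> (h \<circ> cinv c) differentiable (at (cmap c p))"
      using tangent_chain[OF d c] unfolding differentiable_def by blast
    then show ?thesis using False by (simp add: tvec_def)
  qed
qed

text \<open>Injectivity holds because a tangent vector determines its components; surjectivity then
  follows by dimension.\<close>

lemma transition_linear:
  assumes c: "c \<in> A" "p \<in> cdom c" and d: "d \<in> A" "p \<in> cdom d"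
  shows "linear (transition c d p)" "surj (transition c d p)"
proof -
  have "smooth_on (cmap c ` (cdom c \<inter> cdom d)) (cmap d \<circ> cinv c)"
    using manifold c(1) d(1) unfolding smooth_manifold_def by blast
  from smooth_on_has_derivative[OF this, of "cmap c p"]
  show l: "linear (transition c d p)"
    unfolding transition_def using c d by (auto dest!: has_derivative_linear)
  have "inj (transition c d p)"
    unfolding linear_injective_0[OF l]
  proof (intro allI impI)
    fix y assume "transition c d p y = 0"
    then have "tvec c p y = (\<lambda>_. 0)" using tvec_transition[OF assms, of y] by (simp add: tvec_0)
    then show "y = 0" using tvec_eq_0_iff[OF c] by simp
  qed
  then show "surj (transition c d p)" using l linear_injective_imp_surjective by blast
qed

lemma smooth_fun_chart: "smooth_fun A u \<Longrightarrow> c \<in> A \<Longrightarrow> smooth_on (cimage c) (u \<circ> cinv c)"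
  by (simp add: smooth_fun_def)

lemma tvec_smooth_fun:
  assumes u: "smooth_fun A u" and c: "c \<in> A" "p \<in> cdom c"
  shows "tvec c p y u = frechet_derivative (u \<circ> cinv c) (at (cmap c p)) y"
  using smooth_on_has_derivative[OF smooth_fun_chart[OF u c(1)], of "cmap c p"] c(2)
  by (auto simp: tvec_def differentiable_def)

lemma smooth_fun_continuous:
  assumes u: "smooth_fun A u"
  shows "continuous_on UNIV u"
proof -
  have "continuous_on (cdom c) u" if c: "c \<in> A" for c
  proof -
    have "continuous_on (cdom c) ((u \<circ> cinv c) \<circ> cmap c)"
      by (intro continuous_on_compose continuous_cmap[OF c] smooth_on_imp_continuous_on smooth_fun_chart u c)
    then show ?thesis by (rule continuous_on_eq) (simp add: cinv_cmap[OF c])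
  qed
  then have "continuous_on (\<Union>c\<in>A. cdom c) u"
    by (intro continuous_on_open_UN open_cdom)
  moreover have "(\<Union>c\<in>A. cdom c) = UNIV" using manifold by (simp add: smooth_manifold_def)
  ultimately show ?thesis by simp
qed

text \<open>The square of F is carried into coordinates because all curvature operators are
  expressed through it.\<close>

lemma finsler_coords:
  assumes F: "finsler_metric_on A (slit A) F" and c: "c \<in> A"
  shows "finsler_coords (cimage c \<times> (- {0})) (sqloc c F)"
proof
  have dom: "locdom c (slit A) = cimage c \<times> (- {0})" by (rule locdom_slit[OF c])
  show o: "open (cimage c \<times> (- {0 :: 'e}))" by (intro open_Times open_cimage[OF c]) auto
  show "(x, t *\<^sub>R y) \<in> cimage c \<times> (- {0})" if "(x, y) \<in> cimage c \<times> (- {0 :: 'e})" "t > 0" for x y and t :: real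
    using that by auto
  have "smooth_on (cimage c \<times> (- {0})) (\<lambda>(x, y). loc c F x y)"
    using F c unfolding finsler_metric_on_def dom[symmetric] by blast
  then have "smooth2 (cimage c \<times> (- {0})) (loc c F)" by (simp add: smooth2_def case_prod_beta')
  from smooth2_mult[OF o this this]
  show "smooth2 (cimage c \<times> (- {0})) (sqloc c F)" by (simp add: sqloc_def[abs_def] power2_eq_square)
  show "homog 2 (cimage c \<times> (- {0})) (sqloc c F)"
  proof (rule homogI)
    fix x y :: 'e and t :: real assume "(x, y) \<in> cimage c \<times> (- {0})" "t > 0"
    then have "F (cinv c x) (tvec c (cinv c x) (t *\<^sub>R y)) = t * F (cinv c x) (tvec c (cinv c x) y)"
      using F tvec_in_tspace[OF c cinv_in[OF c]] unfolding tvec_scale finsler_metric_on_def by auto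
    then show "sqloc c F x (t *\<^sub>R y) = t\<^sup>2 * sqloc c F x y"
      by (simp add: sqloc_def loc_def power_mult_distrib)
  qed
  show "posdef (\<lambda>i j. fund (sqloc c F) i j x y)" if "(x, y) \<in> cimage c \<times> (- {0})" for x y
    using F c that unfolding finsler_metric_on_def dom[symmetric] posdef_def by blast
qed

lemma slit_tvec:
  assumes c: "c \<in> A" "p \<in> cdom c" and v: "v \<in> slit A p"
  obtains y where "y \<noteq> 0" "v = tvec c p y"
proof -
  obtain d y where d: "d \<in> A" "p \<in> cdom d" "v = tvec d p y"
    using v unfolding slit_def tspace_def by blast
  then have "v = tvec c p (transition d c p y)" using tvec_transition[OF d(1,2) c] by simp
  moreover from this have "transition d c p y \<noteq> 0" using v tvec_in_slit[OF c] by metis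
  ultimately show ?thesis using that by blast
qed

lemma components_slit: "c \<in> A \<Longrightarrow> p \<in> cdom c \<Longrightarrow> v \<in> slit A p \<Longrightarrow> components c v \<noteq> 0"
  by (metis slit_tvec components_tvec)

lemma ex_slit: "\<exists>v. v \<in> slit A p"
  using tvec_in_slit[OF chart_at] nonzero_Basis SOME_Basis by blast

end

section \<open>Gradient and trace of the Hessian on a Riemannian manifold\<close>

locale riemannian_manifold = manifold A
  for A :: "('a::{t2_space,second_countable_topology}, 'e::euclidean_space) chart set" +
  fixes g :: "'a \<Rightarrow> 'a tvec \<Rightarrow> 'a tvec \<Rightarrow> real"
  assumes riemannian: "riemannian_metric A g"
begin

lemma gloc:
  assumes "c \<in> A" "x \<in> cimage c"
  shows gloc_bilinear: "bilinear (\<lambda>u v. gloc c g u v x)"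
    and gloc_sym: "gloc c g u v x = gloc c g v u x"
    and gloc_pos: "u \<noteq> 0 \<Longrightarrow> gloc c g u u x > 0"
  using riemannian assms unfolding riemannian_metric_def by blast+

lemma gloc_expand:
  assumes "c \<in> A" "x \<in> cimage c"
  shows "gloc c g u v x = (\<Sum>a\<in>Basis. \<Sum>b\<in>Basis. gloc c g a b x * (u \<bullet> a) * (v \<bullet> b))"
proof -
  note b = gloc_bilinear[OF assms]
  have "gloc c g u v x = gloc c g (\<Sum>a\<in>Basis. (u \<bullet> a) *\<^sub>R a) (\<Sum>b\<in>Basis. (v \<bullet> b) *\<^sub>R b) x"
    by (simp add: euclidean_representation)
  also have "\<dots> = (\<Sum>(a, b)\<in>Basis \<times> Basis. gloc c g ((u \<bullet> a) *\<^sub>R a) ((v \<bullet> b) *\<^sub>R b) x)"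
    by (rule bilinear_sum[OF b])
  also have "\<dots> = (\<Sum>a\<in>Basis. \<Sum>b\<in>Basis. gloc c g a b x * (u \<bullet> a) * (v \<bullet> b))"
    by (simp add: sum.cartesian_product[symmetric] bilinear_lmul[OF b] bilinear_rmul[OF b] mult_ac)
  finally show ?thesis .
qed

lemma gloc_nonneg: "c \<in> A \<Longrightarrow> x \<in> cimage c \<Longrightarrow> gloc c g u u x \<ge> 0"
  using gloc_pos[of c x u] bilinear_lzero[OF gloc_bilinear[of c x], of u] by (cases "u = 0") auto

lemma sqloc_riem:
  assumes "c \<in> A" "x \<in> cimage c"
  shows "sqloc c (riem_norm g) x y = gloc c g y y x"
  using gloc_nonneg[OF assms, of y] by (simp add: sqloc_def loc_def riem_norm_def gloc_def)

lemma smooth_gloc: "c \<in> A \<Longrightarrow> smooth_on (cimage c) (gloc c g u v)"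
  using riemannian unfolding riemannian_metric_def by blast

lemma riemann_coords:
  assumes c: "c \<in> A"
  shows "riemann_coords (cimage c) (gloc c g) (sqloc c (riem_norm g))"
proof
  show "posdef (\<lambda>i j. gloc c g i j x)" if "x \<in> cimage c" for x
    unfolding posdef_def using gloc_pos[OF c that] gloc_expand[OF c that] by metis
  show "sqloc c (riem_norm g) x y = (\<Sum>a\<in>Basis. \<Sum>b\<in>Basis. gloc c g a b x * (y \<bullet> a) * (y \<bullet> b))"
    if "x \<in> cimage c" for x y
    by (simp add: sqloc_riem[OF c that] gloc_expand[OF c that, of y y])
qed (use c open_cimage smooth_gloc gloc_sym in auto)

definition gradc :: "('a, 'e) chart \<Rightarrow> ('a \<Rightarrow> real) \<Rightarrow> 'e \<Rightarrow> 'e" where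
  "gradc c u x = (\<Sum>i\<in>Basis. (\<Sum>j\<in>Basis. ginv c g i j x * partial j (u \<circ> cinv c) x) *\<^sub>R i)"

lemma gloc_gradc:
  assumes c: "c \<in> A" and x: "x \<in> cimage c" and u: "smooth_on (cimage c) (u \<circ> cinv c)"
  shows "gloc c g (gradc c u x) v x = frechet_derivative (u \<circ> cinv c) (at x) v"
proof -
  interpret R: riemann_coords "cimage c" "gloc c g" "sqloc c (riem_norm g)" by (rule riemann_coords[OF c])
  have comp: "gradc c u x \<bullet> i = R.grad (u \<circ> cinv c) i x" if "i \<in> Basis" for i
    using that by (simp add: gradc_def R.grad_def R.\<gamma>inv_def ginv_def)
  have "gloc c g (gradc c u x) v x = gloc c g v (gradc c u x) x" by (rule gloc_sym[OF c x])
  also have "\<dots> = (\<Sum>a\<in>Basis. (v \<bullet> a) * (\<Sum>b\<in>Basis. gloc c g a b x * R.grad (u \<circ> cinv c) b x))"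
    unfolding gloc_expand[OF c x, of v "gradc c u x"] by (simp add: comp sum_distrib_left mult_ac cong: sum.cong)
  also have "\<dots> = frechet_derivative (u \<circ> cinv c) (at x) v"
    by (simp add: R.\<gamma>_grad[OF x] frechet_derivative_partial[OF u x])
  finally show ?thesis .
qed

definition grad2 :: "('a, 'e) chart \<Rightarrow> ('a \<Rightarrow> real) \<Rightarrow> 'a \<Rightarrow> real" where
  "grad2 c u p = gloc c g (gradc c u (cmap c p)) (gradc c u (cmap c p)) (cmap c p)"

text \<open>The gradient is characterised by \<open>g (grad u) v = du v\<close>, which does not mention the chart.\<close>

lemma grad2_chart_independent:
  assumes u: "smooth_fun A u" and c: "c \<in> A" "p \<in> cdom c" and d: "d \<in> A" "p \<in> cdom d"
  shows "grad2 c u p = grad2 d u p"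
proof -
  let ?T = "transition c d p" and ?U = "gradc c u (cmap c p)" and ?V = "gradc d u (cmap d p)"
  have g: "gloc c g v w (cmap c p) = gloc d g (?T v) (?T w) (cmap d p)" for v w
    using c d by (simp add: gloc_def cinv_cmap tvec_transition[OF c d])
  have du: "frechet_derivative (u \<circ> cinv c) (at (cmap c p)) v = frechet_derivative (u \<circ> cinv d) (at (cmap d p)) (?T v)" for v
    by (metis tvec_smooth_fun[OF u c] tvec_smooth_fun[OF u d] tvec_transition[OF c d])
  have pd: "cmap d p \<in> cimage d" "cmap c p \<in> cimage c" using c d by auto
  note b = gloc_bilinear[OF d(1) pd(1)]
  have eq: "gloc d g (?T ?U - ?V) (?T v) (cmap d p) = 0" for v
  proof -
    have "gloc d g (?T ?U) (?T v) (cmap d p) = gloc d g ?V (?T v) (cmap d p)"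
      using gloc_gradc[OF c(1) pd(2) smooth_fun_chart[OF u c(1)], of v]
        gloc_gradc[OF d(1) pd(1) smooth_fun_chart[OF u d(1)], of "?T v"] by (simp add: g du)
    then show ?thesis using bilinear_lsub[OF b] by simp
  qed
  \<comment> \<open>Surjectivity makes the difference of the two gradients an admissible test
    vector.\<close>
  obtain v where v: "?T ?U - ?V = ?T v"
    by (rule surjE[OF transition_linear(2)[OF c d]])
  have "gloc d g (?T ?U - ?V) (?T ?U - ?V) (cmap d p) = 0" using eq[of v] unfolding v .
  then have "?T ?U = ?V" using gloc_pos[OF d(1) pd(1), of "?T ?U - ?V"] by force
  then show ?thesis by (simp add: grad2_def g)
qed

lemma riem_norm_gradient:
  "(riem_norm g p (gradient A g u p))\<^sup>2 = grad2 (chart_at A p) u p" "riem_norm g p (gradient A g u p) \<ge> 0"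
proof -
  let ?c = "chart_at A p"
  note c = chart_at[of p]
  have "g p (gradient A g u p) (gradient A g u p) = grad2 ?c u p"
    by (simp add: gradient_def Let_def grad2_def gloc_def cinv_cmap[OF c] gradc_def)
  moreover have "grad2 ?c u p \<ge> 0" unfolding grad2_def using c by (intro gloc_nonneg) auto
  ultimately show "(riem_norm g p (gradient A g u p))\<^sup>2 = grad2 ?c u p" "riem_norm g p (gradient A g u p) \<ge> 0"
    by (simp_all add: riem_norm_def)
qed

lemma finsler_riem_norm: "finsler_metric_on A (slit A) (riem_norm g)"
  unfolding finsler_metric_on_def
proof (intro conjI ballI allI impI)
  fix p v assume v: "v \<in> tspace A p"
  then obtain c y where cy: "c \<in> A" "p \<in> cdom c" "v = tvec c p y" unfolding tspace_def by blast
  have loc: "g p (tvec c p u) (tvec c p w) = gloc c g u w (cmap c p)" for u w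
    by (simp add: gloc_def cinv_cmap cy)
  have x: "cmap c p \<in> cimage c" using cy by auto
  show "riem_norm g p v \<ge> 0"
    using gloc_nonneg[OF cy(1) x, of y] by (simp add: riem_norm_def cy(3) loc)
  fix t :: real assume t: "t > 0"
  note b = gloc_bilinear[OF cy(1) x]
  show "riem_norm g p (\<lambda>h. t * v h) = t * riem_norm g p v"
    unfolding cy(3) tvec_scale[symmetric] riem_norm_def loc
    using t by (simp add: bilinear_lmul[OF b] bilinear_rmul[OF b] real_sqrt_mult)
next
  fix c assume c: "c \<in> A"
  interpret R: riemann_coords "cimage c" "gloc c g" "sqloc c (riem_norm g)" by (rule riemann_coords[OF c])
  have loc: "loc c (riem_norm g) x y = sqrt (\<Sum>a\<in>Basis. \<Sum>b\<in>Basis. gloc c g a b x * (y \<bullet> a) * (y \<bullet> b))" if "x \<in> cimage c" for x y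
    using gloc_expand[OF c that, of y y] by (simp add: loc_def riem_norm_def gloc_def)
  have "continuous_on (cimage c \<times> UNIV) (\<lambda>z. sqrt (\<Sum>a\<in>Basis. \<Sum>b\<in>Basis. gloc c g a b (fst z) * (snd z \<bullet> a) * (snd z \<bullet> b)))"
    by (intro continuous_intros continuous_on_compose2[OF smooth_on_imp_continuous_on[OF smooth_gloc[OF c]]]) auto
  then show "continuous_on (cimage c \<times> UNIV) (\<lambda>(x, y). loc c (riem_norm g) x y)"
    by (rule continuous_on_eq) (auto simp: loc)
  have "smooth_on R.W (\<lambda>z. sqrt (sqloc c (riem_norm g) (fst z) (snd z)))"
  proof (intro smooth_on_sqrt R.openW R.smoothL[unfolded smooth2_def])
    fix z assume "z \<in> R.W"
    then have "fst z \<in> cimage c" "snd z \<noteq> 0" by (simp_all add: mem_Times_iff del: image_iff)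
    then show "sqloc c (riem_norm g) (fst z) (snd z) > 0" using sqloc_riem[OF c] gloc_pos[OF c] by simp
  qed
  moreover have "sqrt (sqloc c (riem_norm g) (fst z) (snd z)) = (\<lambda>(x, y). loc c (riem_norm g) x y) z" if "z \<in> R.W" for z
    using that gloc_nonneg[OF c] by (auto simp: sqloc_riem[OF c] loc_def riem_norm_def gloc_def)
  ultimately show "smooth_on (locdom c (slit A)) (\<lambda>(x, y). loc c (riem_norm g) x y)"
    unfolding locdom_slit[OF c] by (metis (no_types, lifting) R.openW smooth_on_cong)
  show "case z of (x, y) \<Rightarrow> \<forall>u. u \<noteq> 0 \<longrightarrow> (\<Sum>i\<in>Basis. \<Sum>j\<in>Basis. fund (sqloc c (riem_norm g)) i j x y * (u \<bullet> i) * (u \<bullet> j)) > 0"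
    if "z \<in> locdom c (slit A)" for z
    using R.posdef_fund that unfolding locdom_slit[OF c] posdef_def by blast
qed

text \<open>Keeps one chart c on its whole image, whereas \<open>laplacian\<close> is minus this
  quantity in the chart chosen at each single point.\<close>

definition hess_tr :: "('a, 'e) chart \<Rightarrow> ('a \<Rightarrow> real) \<Rightarrow> 'e \<Rightarrow> real" where
  "hess_tr c u x = (\<Sum>i\<in>Basis. \<Sum>j\<in>Basis. ginv c g i j x * hessian c g u i j x)"

lemma laplacian_eq: "laplacian A g u p = - hess_tr (chart_at A p) u (cmap (chart_at A p) p)"
  by (simp add: laplacian_def hess_tr_def Let_def)

text \<open>The leading coefficients are the inverse metric, the first order coefficients the
  Christoffel symbols traced by it; this puts the maximum principle at disposal in each
  chart.\<close>

lemma elliptic_hess_tr: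
  assumes c: "c \<in> A"
  shows "elliptic (cimage c) (ginv c g) (\<lambda>k x. \<Sum>i\<in>Basis. \<Sum>j\<in>Basis. ginv c g i j x * christoffel c g k i j x)"
    and "hess_tr c u x = elliptic.op (ginv c g) (\<lambda>k x. \<Sum>i\<in>Basis. \<Sum>j\<in>Basis. ginv c g i j x * christoffel c g k i j x) (u \<circ> cinv c) x"
proof -
  interpret R: riemann_coords "cimage c" "gloc c g" "sqloc c (riem_norm g)" by (rule riemann_coords[OF c])
  have G: "ginv c g = R.\<gamma>inv" by (intro ext) (simp add: ginv_def R.\<gamma>inv_def)
  have Ch: "christoffel c g = R.chr" by (intro ext) (simp add: christoffel_def R.chr_def G)
  show ell: "elliptic (cimage c) (ginv c g) (\<lambda>k x. \<Sum>i\<in>Basis. \<Sum>j\<in>Basis. ginv c g i j x * christoffel c g k i j x)"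
    unfolding G Ch
  proof
    show "continuous_on (cimage c) (\<lambda>x. \<Sum>i\<in>Basis. \<Sum>j\<in>Basis. R.\<gamma>inv i j x * R.chr k i j x)" if "k \<in> Basis" for k
      using that by (intro smooth_on_imp_continuous_on smooth_on_sum smooth_on_mult R.openX R.smooth_\<gamma>inv R.smooth_chr)
  qed (use R.openX R.smooth_\<gamma>inv smooth_on_imp_continuous_on R.\<gamma>inv_posdef R.\<gamma>inv_sym in auto)
  have "(\<Sum>i\<in>Basis. \<Sum>j\<in>Basis. R.\<gamma>inv i j x * (\<Sum>k\<in>Basis. R.chr k i j x * partial k (u \<circ> cinv c) x))
     = (\<Sum>i\<in>Basis. \<Sum>j\<in>Basis. \<Sum>k\<in>Basis. R.\<gamma>inv i j x * R.chr k i j x * partial k (u \<circ> cinv c) x)"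
    by (simp add: sum_distrib_left mult.assoc)
  also have "\<dots> = (\<Sum>k\<in>Basis. (\<Sum>i\<in>Basis. \<Sum>j\<in>Basis. R.\<gamma>inv i j x * R.chr k i j x) * partial k (u \<circ> cinv c) x)"
    unfolding sum_distrib_right by (subst (2) sum.swap, subst sum.swap) simp
  finally show "hess_tr c u x = elliptic.op (ginv c g) (\<lambda>k x. \<Sum>i\<in>Basis. \<Sum>j\<in>Basis. ginv c g i j x * christoffel c g k i j x) (u \<circ> cinv c) x"
    unfolding elliptic.op_def[OF ell]
    unfolding hess_tr_def hessian_def G Ch
    by (simp add: right_diff_distrib sum_subtractf)
qed

lemma hess_tr_minus:
  assumes c: "c \<in> A" and x: "x \<in> cimage c" and u: "smooth_fun A u"
  shows "hess_tr c (\<lambda>p. - u p) x = - hess_tr c u x"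
proof -
  let ?u = "u \<circ> cinv c"
  have s: "smooth_on (cimage c) ?u" by (rule smooth_fun_chart[OF u c])
  have p: "partial k (\<lambda>x. - v x) x = - partial k v x" if "smooth_on (cimage c) v" "x \<in> cimage c" for k v x
    by (rule partial_eqI[OF smooth_on_minus[OF open_cimage[OF c] that(1)] that(2)])
      (intro DERIV_minus partial_DERIV[OF that])
  have o: "(\<lambda>p. - u p) \<circ> cinv c = (\<lambda>x. - ?u x)" by (simp add: o_def)
  have "partial i (partial j (\<lambda>x. - ?u x)) x = - partial i (partial j ?u) x" for i j
  proof -
    have "partial i (partial j (\<lambda>x. - ?u x)) x = partial i (\<lambda>x. - partial j ?u x) x"
      by (rule partial_cong[OF open_cimage[OF c] x]) (rule p[OF s])
    also have "\<dots> = - partial i (partial j ?u) x" by (rule p[OF smooth_on_partial[OF s] x])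
    finally show ?thesis .
  qed
  then have "hessian c g (\<lambda>p. - u p) i j x = - hessian c g u i j x" for i j
    unfolding hessian_def o p[OF s x] by (simp add: sum_negf)
  then show ?thesis by (simp add: hess_tr_def sum_negf)
qed

lemma smooth_fun_minus: "smooth_fun A u \<Longrightarrow> smooth_fun A (\<lambda>p. - u p)"
  unfolding smooth_fun_def o_def using smooth_on_minus[OF open_cimage] by auto

text \<open>The sign is required in every chart, since the maximum principle acts on a neighbourhood
  inside one chart. Continuity of u makes the set of maximum points closed, and connectedness
  concludes.\<close>

theorem subharmonic_max_constant:
  assumes u: "smooth_fun A u" and sub: "\<And>c x. c \<in> A \<Longrightarrow> x \<in> cimage c \<Longrightarrow> hess_tr c u x \<ge> 0"
    and max: "\<And>p. u p \<le> u p0"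
  shows "u p = u p0"
proof -
  let ?Z = "{p. u p = u p0}"
  have "\<exists>T. open T \<and> p \<in> T \<and> T \<subseteq> ?Z" if p: "p \<in> ?Z" for p
  proof -
    obtain c where c: "c \<in> A" "p \<in> cdom c" using ex_chart by blast
    interpret E: elliptic "cimage c" "ginv c g" "\<lambda>k x. \<Sum>i\<in>Basis. \<Sum>j\<in>Basis. ginv c g i j x * christoffel c g k i j x"
      by (rule elliptic_hess_tr(1)[OF c(1)])
    have xp: "(u \<circ> cinv c) (cmap c p) = u p0" using p by (simp add: cinv_cmap c)
    have op: "E.op (u \<circ> cinv c) x \<ge> 0" if "x \<in> cimage c" for x
      using sub[OF c(1) that] elliptic_hess_tr(2)[OF c(1), of u x] by simp
    have le: "(u \<circ> cinv c) x \<le> (u \<circ> cinv c) (cmap c p)" for x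
      unfolding xp using max by simp
    from E.strong_maximum_principle[OF smooth_fun_chart[OF u c(1)] op imageI[OF c(2)] le]
    obtain e where e: "e > 0" "ball (cmap c p) e \<subseteq> cimage c"
      and const: "\<And>x. x \<in> ball (cmap c p) e \<Longrightarrow> (u \<circ> cinv c) x = (u \<circ> cinv c) (cmap c p)"
      by blast
    let ?T = "cdom c \<inter> cmap c -` ball (cmap c p) e"
    have "open ?T" by (rule continuous_open_preimage[OF continuous_cmap[OF c(1)] open_cdom[OF c(1)]]) simp
    moreover have "p \<in> ?T" using c e(1) by simp
    moreover have "u q = u p0" if "q \<in> ?T" for q
      using const[of "cmap c q"] cinv_cmap[OF c(1), of q] that xp by simp
    then have "?T \<subseteq> ?Z" by blast
    ultimately show ?thesis by blast
  qed
  then have "open ?Z" by (subst open_subopen) blast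
  moreover have "open (- ?Z)"
  proof -
    have "open (u -` (- {u p0}))"
      by (rule open_vimage) (use smooth_fun_continuous[OF u] in auto)
    moreover have "u -` (- {u p0}) = - ?Z" by auto
    ultimately show ?thesis by simp
  qed
  moreover have "connected (UNIV :: 'a set)" using manifold by (simp add: smooth_manifold_def)
  ultimately have "?Z \<inter> UNIV = {} \<or> (- ?Z) \<inter> UNIV = {}" by (intro connectedD) auto
  then show ?thesis by auto
qed

end

subsection \<open>Product charts\<close>

lemma continuous_on_map_prod:
  assumes "continuous_on S f" "continuous_on T h"
  shows "continuous_on (S \<times> T) (map_prod f h)"
proof -
  have "continuous_on (S \<times> T) (\<lambda>z. (f (fst z), h (snd z)))"
    by (intro continuous_on_Pair continuous_on_compose2[OF assms(1)] continuous_on_compose2[OF assms(2)]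
        continuous_on_fst continuous_on_snd continuous_on_id) auto
  then show ?thesis by (simp add: map_prod_def case_prod_beta')
qed

lemma prod_chart_simps [simp]:
  "cdom (prod_chart c d) = cdom c \<times> cdom d" "cmap (prod_chart c d) (p, q) = (cmap c p, cmap d q)"
  "cmap (prod_chart c d) ` (U \<times> V) = cmap c ` U \<times> cmap d ` V"
  by (auto simp: prod_chart_def map_prod_def image_iff split: prod.splits)

locale manifold_product = M1: manifold A1 + M2: manifold A2
  for A1 :: "('a::{t2_space,second_countable_topology}, 'e::euclidean_space) chart set"
    and A2 :: "('b::{t2_space,second_countable_topology}, 'f::euclidean_space) chart set"
begin

lemma cinv_prod:
  assumes "c \<in> A1" "d \<in> A2" "x1 \<in> cimage c" "x2 \<in> cimage d"
  shows "cinv (prod_chart c d) (x1, x2) = (cinv c x1, cinv d x2)"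
proof (rule inv_into_f_eq)
  have i: "inj_on (cmap c) (cdom c)" "inj_on (cmap d) (cdom d)"
    using M1.cinv_cmap[OF assms(1)] M2.cinv_cmap[OF assms(2)] by (metis inj_onI)+
  then show "inj_on (cmap (prod_chart c d)) (cdom (prod_chart c d))"
    by (auto simp: inj_on_def)
  show "(cinv c x1, cinv d x2) \<in> cdom (prod_chart c d)"
    using M1.cinv_in[OF assms(1,3)] M2.cinv_in[OF assms(2,4)] by simp
  show "cmap (prod_chart c d) (cinv c x1, cinv d x2) = (x1, x2)"
    using M1.cmap_cinv[OF assms(1,3)] M2.cmap_cinv[OF assms(2,4)] by simp
qed

lemmas cinv_prod' = cinv_prod[unfolded prod_chart_simps(1)]

text \<open>A function of one factor is differentiable in the product chart exactly when it is so in
  its own chart: compose with the projection in one direction, restrict to a slice in the other.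
  This settles the default value 0.\<close>

lemma pushforward_tvec:
  assumes c: "c \<in> A1" "p \<in> cdom c" and d: "d \<in> A2" "q \<in> cdom d"
  shows "pushforward fst (tvec (prod_chart c d) (p, q) (y1, y2)) = tvec c p y1"
    and "pushforward snd (tvec (prod_chart c d) (p, q) (y1, y2)) = tvec d q y2"
proof -
  let ?C = "prod_chart c d" and ?x = "(cmap c p, cmap d q)"
  have o: "open (cimage c \<times> cimage d)" "?x \<in> cimage c \<times> cimage d"
    using c d M1.open_cimage M2.open_cimage by (auto intro!: open_Times)
  have 1: "tvec ?C (p, q) (y1, y2) (h \<circ> fst) = tvec c p y1 h" for h
  proof (cases "(h \<circ> cinv c) differentiable (at (cmap c p))")
    case True
    let ?D = "frechet_derivative (h \<circ> cinv c) (at (cmap c p))"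
    have "((h \<circ> cinv c) has_derivative ?D) (at (fst ?x))" using True by (simp add: frechet_derivative_works)
    from diff_chain_at[OF has_derivative_fst[OF has_derivative_ident] this]
    have "((h \<circ> cinv c) \<circ> fst has_derivative ?D \<circ> fst) (at ?x)" by (simp add: o_def)
    then have "((h \<circ> fst \<circ> cinv ?C) has_derivative ?D \<circ> fst) (at ?x)"
      by (rule has_derivative_transform_within_open[OF _ o]) (use c d in \<open>auto simp: cinv_prod'\<close>)
    then have "tvec ?C (p, q) (y1, y2) (h \<circ> fst) = ?D y1" using tvec_eqI[of "h \<circ> fst" ?C _ "(p, q)"] by simp
    then show ?thesis using True by (simp add: tvec_def)
  next
    case False
    have "\<not> (h \<circ> fst \<circ> cinv ?C) differentiable (at ?x)"
    proof
      assume "(h \<circ> fst \<circ> cinv ?C) differentiable (at ?x)"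
      then obtain D where D: "((h \<circ> fst \<circ> cinv ?C) has_derivative D) (at ?x)" by (auto simp: differentiable_def)
      have "((\<lambda>x. (x, cmap d q)) has_derivative (\<lambda>v. (v, 0))) (at (cmap c p))" by (auto intro!: derivative_eq_intros)
      from diff_chain_at[OF this D]
      have "((h \<circ> cinv c) has_derivative D \<circ> (\<lambda>v. (v, 0))) (at (cmap c p))"
        by (rule has_derivative_transform_within_open[OF _ M1.open_cimage[OF c(1)]])
          (use c d in \<open>auto simp: cinv_prod'\<close>)
      then show False using False by (auto simp: differentiable_def)
    qed
    then show ?thesis using False by (simp add: tvec_def)
  qed
  have 2: "tvec ?C (p, q) (y1, y2) (h \<circ> snd) = tvec d q y2 h" for h
  proof (cases "(h \<circ> cinv d) differentiable (at (cmap d q))")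
    case True
    let ?D = "frechet_derivative (h \<circ> cinv d) (at (cmap d q))"
    have "((h \<circ> cinv d) has_derivative ?D) (at (snd ?x))" using True by (simp add: frechet_derivative_works)
    from diff_chain_at[OF has_derivative_snd[OF has_derivative_ident] this]
    have "((h \<circ> cinv d) \<circ> snd has_derivative ?D \<circ> snd) (at ?x)" by (simp add: o_def)
    then have "((h \<circ> snd \<circ> cinv ?C) has_derivative ?D \<circ> snd) (at ?x)"
      by (rule has_derivative_transform_within_open[OF _ o]) (use c d in \<open>auto simp: cinv_prod'\<close>)
    then have "tvec ?C (p, q) (y1, y2) (h \<circ> snd) = ?D y2" using tvec_eqI[of "h \<circ> snd" ?C _ "(p, q)"] by simp
    then show ?thesis using True by (simp add: tvec_def)
  next
    case False
    have "\<not> (h \<circ> snd \<circ> cinv ?C) differentiable (at ?x)"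
    proof
      assume "(h \<circ> snd \<circ> cinv ?C) differentiable (at ?x)"
      then obtain D where D: "((h \<circ> snd \<circ> cinv ?C) has_derivative D) (at ?x)" by (auto simp: differentiable_def)
      have "((\<lambda>x. (cmap c p, x)) has_derivative (\<lambda>v. (0, v))) (at (cmap d q))" by (auto intro!: derivative_eq_intros)
      from diff_chain_at[OF this D]
      have "((h \<circ> cinv d) has_derivative D \<circ> (\<lambda>v. (0, v))) (at (cmap d q))"
        by (rule has_derivative_transform_within_open[OF _ M2.open_cimage[OF d(1)]])
          (use c d in \<open>auto simp: cinv_prod'\<close>)
      then show False using False by (auto simp: differentiable_def)
    qed
    then show ?thesis using False by (simp add: tvec_def)
  qed
  show "pushforward fst (tvec ?C (p, q) (y1, y2)) = tvec c p y1" "pushforward snd (tvec ?C (p, q) (y1, y2)) = tvec d q y2"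
    using 1 2 by (auto simp: pushforward_def)
qed

lemma prod_manifold: "smooth_manifold (prod_atlas A1 A2)"
  unfolding smooth_manifold_def
proof (intro conjI ballI)
  have "connected (UNIV :: 'a set)" "connected (UNIV :: 'b set)"
    using M1.manifold M2.manifold by (auto simp: smooth_manifold_def)
  then have "connected ((UNIV :: 'a set) \<times> (UNIV :: 'b set))" by (rule connected_Times)
  then show "connected (UNIV :: ('a \<times> 'b) set)" by simp
  show "(\<Union>c\<in>prod_atlas A1 A2. cdom c) = UNIV"
  proof -
    have "pq \<in> (\<Union>c\<in>prod_atlas A1 A2. cdom c)" for pq
    proof -
      obtain c d where "c \<in> A1" "fst pq \<in> cdom c" "d \<in> A2" "snd pq \<in> cdom d" using M1.ex_chart M2.ex_chart by metis
      then have "prod_chart c d \<in> prod_atlas A1 A2" "pq \<in> cdom (prod_chart c d)"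
        unfolding prod_atlas_def by (blast, simp add: mem_Times_iff)
      then show ?thesis by blast
    qed
    then show ?thesis by auto
  qed
next
  fix C assume "C \<in> prod_atlas A1 A2"
  then obtain c d where C: "C = prod_chart c d" and c: "c \<in> A1" and d: "d \<in> A2" by (auto simp: prod_atlas_def)
  show "open (cdom C)" "open (cimage C)"
    unfolding C prod_chart_simps using c d by (auto intro!: open_Times M1.open_cdom M2.open_cdom M1.open_cimage M2.open_cimage)
  have h: "homeomorphism (cdom C) (cimage C) (map_prod (cmap c) (cmap d)) (map_prod (cinv c) (cinv d))"
    unfolding C prod_chart_simps
  proof (rule homeomorphismI)
    show "continuous_on (cdom c \<times> cdom d) (map_prod (cmap c) (cmap d))"
      by (rule continuous_on_map_prod[OF M1.continuous_cmap[OF c] M2.continuous_cmap[OF d]])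
    show "continuous_on (cimage c \<times> cimage d) (map_prod (cinv c) (cinv d))"
      by (rule continuous_on_map_prod[OF M1.continuous_cinv[OF c] M2.continuous_cinv[OF d]])
  qed (use M1.cinv_cmap[OF c] M2.cinv_cmap[OF d] in auto)
  show "homeomorphism (cdom C) (cimage C) (cmap C) (cinv C)"
  proof (rule homeomorphism_cong[OF h refl refl])
    show "cmap C z = map_prod (cmap c) (cmap d) z" for z by (simp add: C prod_chart_def)
    fix z assume "z \<in> cimage C"
    then show "cinv C z = map_prod (cinv c) (cinv d) z"
      using c d unfolding C by (cases z) (auto simp: cinv_prod')
  qed
next
  fix C C' assume "C \<in> prod_atlas A1 A2" "C' \<in> prod_atlas A1 A2"
  then obtain c d c' d' where C: "C = prod_chart c d" and C': "C' = prod_chart c' d'"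
    and c: "c \<in> A1" "c' \<in> A1" and d: "d \<in> A2" "d' \<in> A2" by (auto simp: prod_atlas_def)
  let ?S1 = "cmap c ` (cdom c \<inter> cdom c')" and ?S2 = "cmap d ` (cdom d \<inter> cdom d')"
  have S: "cmap C ` (cdom C \<inter> cdom C') = ?S1 \<times> ?S2"
    unfolding C C' by (simp add: Times_Int_Times)
  have o: "open ?S1" "open ?S2"
    using c d by (auto intro!: M1.open_overlap M2.open_overlap open_Int M1.open_cdom M2.open_cdom)
  then have oS: "open (?S1 \<times> ?S2)" by (rule open_Times)
  have s: "smooth_on ?S1 (cmap c' \<circ> cinv c)" "smooth_on ?S2 (cmap d' \<circ> cinv d)"
    using M1.manifold M2.manifold c d unfolding smooth_manifold_def by blast+
  have sm: "smooth_on (?S1 \<times> ?S2) (\<lambda>z. ((cmap c' \<circ> cinv c) (fst z), (cmap d' \<circ> cinv d) (snd z)))"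
    by (intro smooth_on_Pair oS smooth_on_comp_linear[OF oS o(1) bounded_linear_fst _ s(1)]
        smooth_on_comp_linear[OF oS o(2) bounded_linear_snd _ s(2)]) auto
  have eq: "((cmap c' \<circ> cinv c) (fst z), (cmap d' \<circ> cinv d) (snd z)) = (cmap C' \<circ> cinv C) z" if "z \<in> ?S1 \<times> ?S2" for z
    using that c d by (auto simp: C C' cinv_prod' M1.cinv_cmap M2.cinv_cmap)
  show "smooth_on (cmap C ` (cdom C \<inter> cdom C')) (cmap C' \<circ> cinv C)"
    unfolding S by (rule smooth_on_cong[OF oS eq, THEN iffD1, OF _ sm])
qed

end

text \<open>Some direction v in \<open>D p\<close> is required for uniqueness: with no direction
  every real number would satisfy the description.\<close>

lemma scal_eqI:
  assumes "v \<in> D p" "\<And>v. v \<in> D p \<Longrightarrow> scal_dir A F p v = s"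
  shows "scal A D F p = s"
  unfolding scal_def by (rule the_equality) (use assms in auto)

subsection \<open>Finsler warped products with Riemannian base\<close>

locale warped_product = M1: riemannian_manifold A1 g1 + manifold_product A1 A2
  for A1 :: "('a::{t2_space,second_countable_topology}, 'e::euclidean_space) chart set"
    and g1 and A2 :: "('b::{t2_space,second_countable_topology}, 'f::euclidean_space) chart set" +
  fixes F2 :: "'b \<Rightarrow> 'b tvec \<Rightarrow> real" and f :: "'a \<Rightarrow> real"
  assumes finsler2: "finsler_metric_on A2 (slit A2) F2"
    and smooth_f: "smooth_fun A1 f" and f_pos: "\<And>p. f p > 0"
begin

abbreviation "A \<equiv> prod_atlas A1 A2"
abbreviation "D \<equiv> warped_dom A1 A2"
abbreviation "F \<equiv> warped_metric (riem_norm g1) F2 f"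

sublocale MP: manifold A
  by unfold_locales (rule prod_manifold)

lemma loc_warped:
  assumes "c \<in> A1" "d \<in> A2" "x1 \<in> cimage c" "x2 \<in> cimage d"
  shows "loc (prod_chart c d) F (x1, x2) (y1, y2)
    = sqrt ((loc c (riem_norm g1) x1 y1)\<^sup>2 + (f (cinv c x1))\<^sup>2 * (loc d F2 x2 y2)\<^sup>2)"
  unfolding loc_def warped_metric_def
  using assms M1.cinv_in M2.cinv_in
  by (simp add: cinv_prod[OF assms] cinv_prod'[OF assms] pushforward_tvec)

lemma sqloc_warped:
  assumes "c \<in> A1" "d \<in> A2" "x1 \<in> cimage c" "x2 \<in> cimage d"
  shows "sqloc (prod_chart c d) F (x1, x2) (y1, y2) = sqloc c (riem_norm g1) x1 y1 + ((f \<circ> cinv c) x1)\<^sup>2 * sqloc d F2 x2 y2"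
  unfolding sqloc_def loc_warped[OF assms] by simp

lemma tvec_in_D:
  assumes "c \<in> A1" "p \<in> cdom c" "d \<in> A2" "q \<in> cdom d"
  shows "tvec (prod_chart c d) (p, q) (y1, y2) \<in> D (p, q) \<longleftrightarrow> y1 \<noteq> 0 \<and> y2 \<noteq> 0"
proof -
  have "prod_chart c d \<in> A" using assms unfolding prod_atlas_def by blast
  then have "tvec (prod_chart c d) (p, q) (y1, y2) \<in> tspace A (p, q)"
    by (rule MP.tvec_in_tspace) (use assms in simp)
  then show ?thesis
    using assms by (simp add: warped_dom_def pushforward_tvec M1.tvec_in_slit M2.tvec_in_slit)
qed

lemma locdom_warped:
  assumes "c \<in> A1" "d \<in> A2"
  shows "((x1, x2), (y1, y2)) \<in> locdom (prod_chart c d) D \<longleftrightarrow> x1 \<in> cimage c \<and> x2 \<in> cimage d \<and> y1 \<noteq> 0 \<and> y2 \<noteq> 0"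
proof (cases "x1 \<in> cimage c \<and> x2 \<in> cimage d")
  case True
  then show ?thesis
    using assms tvec_in_D[OF assms(1) M1.cinv_in[OF assms(1)] assms(2) M2.cinv_in[OF assms(2)], of x1 x2 y1 y2]
    by (simp add: locdom_def cinv_prod' del: image_iff)
qed (auto simp: locdom_def simp del: image_iff)

lemma warped_coords:
  assumes c: "c \<in> A1" and d: "d \<in> A2"
  shows "warped_coords (cimage c) (gloc c g1) (sqloc c (riem_norm g1)) (cimage d \<times> (- {0})) (sqloc d F2)
    (f \<circ> cinv c) (sqloc (prod_chart c d) F)"
proof (intro warped_coords.intro warped_coords_axioms.intro)
  show "riemann_coords (cimage c) (gloc c g1) (sqloc c (riem_norm g1))" by (rule M1.riemann_coords[OF c])
  show "finsler_coords (cimage d \<times> (- {0})) (sqloc d F2)" by (rule M2.finsler_coords[OF finsler2 d])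
  show "smooth_on (cimage c) (f \<circ> cinv c)" by (rule M1.smooth_fun_chart[OF smooth_f c])
  show "(f \<circ> cinv c) x > 0" for x by (simp add: f_pos)
  show "sqloc (prod_chart c d) F (x1, x2) (y1, y2) = sqloc c (riem_norm g1) x1 y1 + ((f \<circ> cinv c) x1)\<^sup>2 * sqloc d F2 x2 y2"
    if "x1 \<in> cimage c" "y1 \<noteq> 0" "(x2, y2) \<in> cimage d \<times> (- {0})" for x1 x2 y1 y2
    using sqloc_warped[OF c d that(1), of x2 y1 y2] that(3) by (simp del: image_iff)
qed

text \<open>The vector may be given in another chart. That both components are nonzero is expressed
  by pushforwards, hence survives the transition to C.\<close>

lemma D_cases:
  assumes v: "v \<in> D (p, q)" and C: "C \<in> A" "(p, q) \<in> cdom C"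
  obtains c d y1 y2 where "C = prod_chart c d" "c \<in> A1" "p \<in> cdom c" "d \<in> A2" "q \<in> cdom d"
    "y1 \<noteq> 0" "y2 \<noteq> 0" "v = tvec C (p, q) (y1, y2)"
proof -
  obtain c d where C_eq: "C = prod_chart c d" "c \<in> A1" "d \<in> A2" using C(1) by (auto simp: prod_atlas_def)
  then have cd: "p \<in> cdom c" "q \<in> cdom d" using C(2) by auto
  obtain C' y where C': "C' \<in> A" "(p, q) \<in> cdom C'" "v = tvec C' (p, q) y"
    using v unfolding warped_dom_def tspace_def by blast
  obtain y1 y2 where y: "MP.transition C' C (p, q) y = (y1, y2)" by fastforce
  have "v = tvec C (p, q) (y1, y2)" using MP.tvec_transition[OF C'(1,2) C] C'(3) y by simp
  moreover from this have "y1 \<noteq> 0 \<and> y2 \<noteq> 0"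
    using v tvec_in_D[OF C_eq(2) cd(1) C_eq(3) cd(2), of y1 y2] C_eq(1) by simp
  ultimately show ?thesis using that C_eq cd by blast
qed

lemma grad2_eq:
  assumes c: "c \<in> A1" and d: "d \<in> A2" and p: "p \<in> cdom c"
  shows "M1.grad2 c f p = warped_coords.grad_norm2 (gloc c g1) (f \<circ> cinv c) (cmap c p)"
proof -
  interpret C: warped_coords "cimage c" "gloc c g1" "sqloc c (riem_norm g1)" "cimage d \<times> (- {0})" "sqloc d F2"
    "f \<circ> cinv c" "sqloc (prod_chart c d) F" by (rule warped_coords[OF c d])
  have x: "cmap c p \<in> cimage c" using p by simp
  have comp: "M1.gradc c f x \<bullet> i = C.B.grad (f \<circ> cinv c) i x" if "i \<in> Basis" for i x
    using that by (simp add: M1.gradc_def C.B.grad_def C.B.\<gamma>inv_def ginv_def)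
  show ?thesis
    unfolding M1.grad2_def M1.gloc_gradc[OF c x C.smooth_f] frechet_derivative_partial[OF C.smooth_f x] C.grad_norm2_def
    by (intro sum.cong refl) (simp add: comp)
qed

lemma hess_tr_eq:
  assumes c: "c \<in> A1" and d: "d \<in> A2"
  shows "M1.hess_tr c f x = warped_coords.hess_trace (gloc c g1) (f \<circ> cinv c) x"
proof -
  interpret C: warped_coords "cimage c" "gloc c g1" "sqloc c (riem_norm g1)" "cimage d \<times> (- {0})" "sqloc d F2"
    "f \<circ> cinv c" "sqloc (prod_chart c d) F" by (rule warped_coords[OF c d])
  have G: "ginv c g1 = C.B.\<gamma>inv" by (intro ext) (simp add: ginv_def C.B.\<gamma>inv_def)
  have Ch: "christoffel c g1 = C.B.chr" by (intro ext) (simp add: christoffel_def C.B.chr_def G)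
  show ?thesis
    by (simp add: M1.hess_tr_def C.hess_trace_def hessian_def C.B.hess_def G Ch)
qed

text \<open>Since the gradient vanishes on the whole chart, the first partial derivatives are
  identically zero there and can be differentiated once more. Serves the case of equal dimensions in
  the last curvature condition.\<close>

lemma hess_tr_zero:
  assumes grad: "\<And>c p. c \<in> A1 \<Longrightarrow> p \<in> cdom c \<Longrightarrow> M1.grad2 c f p = 0" and c: "c \<in> A1" and x: "x \<in> cimage c"
  shows "M1.hess_tr c f x = 0"
proof -
  obtain d where d: "d \<in> A2" using M2.ex_chart by blast
  interpret C: warped_coords "cimage c" "gloc c g1" "sqloc c (riem_norm g1)" "cimage d \<times> (- {0})" "sqloc d F2"
    "f \<circ> cinv c" "sqloc (prod_chart c d) F" by (rule warped_coords[OF c d])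
  have z: "partial i (f \<circ> cinv c) x = 0" if "x \<in> cimage c" "i \<in> Basis" for i x
  proof -
    have "C.grad_norm2 x = 0"
      using grad[OF c M1.cinv_in[OF c that(1)]] grad2_eq[OF c d M1.cinv_in[OF c that(1)]] M1.cmap_cinv[OF c that(1)] by simp
    then show ?thesis by (rule C.grad_norm2_nonneg(2)[OF that(1)]) (rule that(2))
  qed
  have "C.B.hess (f \<circ> cinv c) i j x = 0" if "j \<in> Basis" for i j
  proof -
    have "partial i (partial j (f \<circ> cinv c)) x = partial i (\<lambda>x. 0) x"
      by (rule partial_cong[OF C.B.openX x]) (rule z[OF _ that])
    then have "partial i (partial j (f \<circ> cinv c)) x = 0" by (simp add: partial_def[of i "\<lambda>x. 0"])
    then show ?thesis by (simp add: C.B.hess_def z[OF x])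
  qed
  then show ?thesis by (simp add: hess_tr_eq[OF c d] C.hess_trace_def)
qed

text \<open>Smoothness is inherited from the squared metric, which is positive on the domain of
  regularity, by taking the square root.\<close>

lemma finsler_warped: "finsler_metric_on A D F"
  unfolding finsler_metric_on_def
proof (intro conjI ballI allI impI)
  fix pq v assume v: "v \<in> tspace A pq"
  show "F pq v \<ge> 0" by (simp add: warped_metric_def)
  fix t :: real assume t: "t > 0"
  obtain p q where pq: "pq = (p, q)" by fastforce
  obtain C y where C: "C \<in> A" "pq \<in> cdom C" "v = tvec C pq y" using v unfolding tspace_def by blast
  obtain c d where cd: "C = prod_chart c d" "c \<in> A1" "d \<in> A2" using C(1) by (auto simp: prod_atlas_def)
  have dom: "p \<in> cdom c" "q \<in> cdom d" using C(2) cd pq by auto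
  have 1: "pushforward fst v \<in> tspace A1 p" "pushforward snd v \<in> tspace A2 q"
    using cd dom unfolding C(3) cd(1) pq
    by (cases y; simp add: pushforward_tvec M1.tvec_in_tspace M2.tvec_in_tspace)+
  have "riem_norm g1 p (\<lambda>h. t * pushforward fst v h) = t * riem_norm g1 p (pushforward fst v)"
    using M1.finsler_riem_norm 1(1) t unfolding finsler_metric_on_def by blast
  moreover have "F2 q (\<lambda>h. t * pushforward snd v h) = t * F2 q (pushforward snd v)"
    using finsler2 1(2) t unfolding finsler_metric_on_def by blast
  moreover have "pushforward fst (\<lambda>h. t * v h) = (\<lambda>h. t * pushforward fst v h)"
    "pushforward snd (\<lambda>h. t * v h) = (\<lambda>h. t * pushforward snd v h)"
    by (auto simp: pushforward_def)
  ultimately have "F pq (\<lambda>h. t * v h) = sqrt (t\<^sup>2 * ((riem_norm g1 p (pushforward fst v))\<^sup>2 + (f p)\<^sup>2 * (F2 q (pushforward snd v))\<^sup>2))"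
    by (simp add: warped_metric_def pq power_mult_distrib algebra_simps)
  then show "F pq (\<lambda>h. t * v h) = t * F pq v"
    using t by (simp add: warped_metric_def pq real_sqrt_mult)
next
  fix C assume "C \<in> A"
  then obtain c d where C: "C = prod_chart c d" and c: "c \<in> A1" and d: "d \<in> A2" by (auto simp: prod_atlas_def)
  interpret W: warped_coords "cimage c" "gloc c g1" "sqloc c (riem_norm g1)" "cimage d \<times> (- {0})" "sqloc d F2"
    "f \<circ> cinv c" "sqloc (prod_chart c d) F" by (rule warped_coords[OF c d])
  have W: "locdom C D = W.W"
    unfolding C by (auto simp: set_eq_iff split_paired_all locdom_warped[OF c d] simp del: image_iff)
  have l1: "continuous_on (cimage c \<times> UNIV) (\<lambda>z. loc c (riem_norm g1) (fst z) (snd z))"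
    using M1.finsler_riem_norm c unfolding finsler_metric_on_def by (simp add: case_prod_beta')
  have l2: "continuous_on (cimage d \<times> UNIV) (\<lambda>z. loc d F2 (fst z) (snd z))"
    using finsler2 d unfolding finsler_metric_on_def by (simp add: case_prod_beta')
  let ?S = "(cimage c \<times> cimage d) \<times> (UNIV :: ('e \<times> 'f) set)"
  have k1: "continuous_on ?S (\<lambda>z. loc c (riem_norm g1) (fst (fst z)) (fst (snd z)))"
    using continuous_on_compose2[OF l1, of ?S "\<lambda>z. (fst (fst z), fst (snd z))"]
    by (force intro!: continuous_intros)
  have k2: "continuous_on ?S (\<lambda>z. loc d F2 (snd (fst z)) (snd (snd z)))"
    using continuous_on_compose2[OF l2, of ?S "\<lambda>z. (snd (fst z), snd (snd z))"]
    by (force intro!: continuous_intros)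
  have k3: "continuous_on ?S (\<lambda>z. (f \<circ> cinv c) (fst (fst z)))"
    using continuous_on_compose2[OF smooth_on_imp_continuous_on[OF W.smooth_f], of ?S "\<lambda>z. fst (fst z)"]
    by (force intro!: continuous_intros)
  have "continuous_on ?S (\<lambda>z. sqrt ((loc c (riem_norm g1) (fst (fst z)) (fst (snd z)))\<^sup>2
    + ((f \<circ> cinv c) (fst (fst z)))\<^sup>2 * (loc d F2 (snd (fst z)) (snd (snd z)))\<^sup>2))"
    by (intro continuous_on_real_sqrt continuous_on_add continuous_on_mult continuous_on_power k1 k2 k3)
  moreover have "cimage C \<times> (UNIV :: ('e \<times> 'f) set) = ?S" by (simp add: C)
  ultimately show "continuous_on (cimage C \<times> UNIV) (\<lambda>(x, y). loc C F x y)"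
    by (auto simp: C loc_warped[OF c d] case_prod_beta' simp del: image_iff elim!: continuous_on_eq)
  have pos: "sqloc C F (fst z) (snd z) > 0" if "z \<in> W.W" for z
  proof (rule W.L_pos[folded C])
    show "(fst z, snd z) \<in> W.W" using that by simp
    show "snd z \<noteq> 0" using that by (auto simp: W.W_def zero_prod_def)
  qed
  have sm: "smooth_on W.W (\<lambda>z. sqrt (sqloc C F (fst z) (snd z)))"
    using W.smoothL unfolding smooth2_def C[symmetric] by (intro smooth_on_sqrt W.openW pos)
  have eq: "sqrt (sqloc C F (fst z) (snd z)) = (\<lambda>(x, y). loc C F x y) z" if "z \<in> W.W" for z
    by (simp add: sqloc_def case_prod_beta' loc_def warped_metric_def)
  show "smooth_on (locdom C D) (\<lambda>(x, y). loc C F x y)"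
    unfolding W by (rule smooth_on_cong[OF W.openW eq, THEN iffD1, OF _ sm])
  show "case z of (x, y) \<Rightarrow> \<forall>u. u \<noteq> 0 \<longrightarrow> (\<Sum>i\<in>Basis. \<Sum>j\<in>Basis. fund (sqloc C F) i j x y * (u \<bullet> i) * (u \<bullet> j)) > 0"
    if "z \<in> locdom C D" for z
    using W.posdef_fund that unfolding W posdef_def C[symmetric] by blast
qed

lemma weakly_berwald_warped:
  assumes "weakly_berwald_on A2 (slit A2) F2"
  shows "weakly_berwald_on A D F"
  unfolding weakly_berwald_on_def
proof (intro ballI, clarify)
  fix C x y and i j :: "'e \<times> 'f"
  assume "C \<in> A" and xy: "(x, y) \<in> locdom C D" and i: "i \<in> Basis" and j: "j \<in> Basis"
  then obtain c d where C: "C = prod_chart c d" and c: "c \<in> A1" and d: "d \<in> A2" by (auto simp: prod_atlas_def)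
  interpret W: warped_coords "cimage c" "gloc c g1" "sqloc c (riem_norm g1)" "cimage d \<times> (- {0})" "sqloc d F2"
    "f \<circ> cinv c" "sqloc (prod_chart c d) F" by (rule warped_coords[OF c d])
  show "E_curv (sqloc C F) i j x y = 0"
    unfolding C
  proof (rule W.E_curv_warped[OF _ _ i j])
    show "E_curv (sqloc d F2) i j x y = 0" if "i \<in> Basis" "j \<in> Basis" "(x, y) \<in> cimage d \<times> (- {0})" for i j x y
      using assms d that unfolding weakly_berwald_on_def M2.locdom_slit[OF d, symmetric] by blast
    show "(x, y) \<in> W.W"
      using xy unfolding C by (cases x; cases y) (simp add: locdom_warped[OF c d] del: image_iff)
  qed
qed

text \<open>The factor of proportionality \<open>lam\<close> cannot depend on the fibre point, since the base equation does not contain it, and the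
  resulting coefficient \<open>\<mu>\<close> in the fibre equation is a function of the base point and of the fibre
  point alone at once, hence constant.\<close>

lemma einstein_reduction:
  assumes ein: "einstein_on A D F"
  obtains l \<mu> where
    "\<And>p. scal A1 (slit A1) (riem_norm g1) p = real DIM('e) * l p - real DIM('f) / f p * laplacian A1 g1 f p"
    "\<And>q. scal A2 (slit A2) F2 q = real DIM('f) * \<mu>" "\<And>p q. scal A D F (p, q) = (real DIM('e) + real DIM('f)) * l p"
    "\<And>c p. c \<in> A1 \<Longrightarrow> p \<in> cdom c \<Longrightarrow>
      \<mu> = l p * (f p)\<^sup>2 + f p * M1.hess_tr c f (cmap c p) + (real DIM('f) - 1) * M1.grad2 c f p"
    "positive_scal_on A2 (slit A2) F2 \<Longrightarrow> \<mu> > 0" "\<And>p. positive_scal_on A D F \<Longrightarrow> l p > 0"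
proof -
  obtain lam where lam: "\<And>C x y. C \<in> A \<Longrightarrow> (x, y) \<in> locdom C D \<Longrightarrow> ricci (sqloc C F) x y = lam (cinv C x) * sqloc C F x y"
    using ein unfolding einstein_on_def sqloc_def by blast
  let ?m = "real DIM('e)" and ?n = "real DIM('f)"
  \<comment> \<open>The charts stay arbitrary, so that the equations obtained in different charts
    can be compared.\<close>
  have local: "scalar_curv (sqloc c (riem_norm g1)) (cmap c p) y1 = ?m * lam (p, q) + ?n / f p * M1.hess_tr c f (cmap c p) \<and>
      ricci (sqloc d F2) (cmap d q) y2
        = (lam (p, q) * (f p)\<^sup>2 + f p * M1.hess_tr c f (cmap c p) + (?n - 1) * M1.grad2 c f p) * sqloc d F2 (cmap d q) y2 \<and>
      scalar_curv (sqloc (prod_chart c d) F) (cmap c p, cmap d q) (y1, y2) = (?m + ?n) * lam (p, q)"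
    if c: "c \<in> A1" "p \<in> cdom c" and d: "d \<in> A2" "q \<in> cdom d" and y: "y1 \<noteq> 0" "y2 \<noteq> 0" for c d p q y1 y2
  proof -
    interpret W: warped_coords "cimage c" "gloc c g1" "sqloc c (riem_norm g1)" "cimage d \<times> (- {0})" "sqloc d F2"
      "f \<circ> cinv c" "sqloc (prod_chart c d) F" by (rule warped_coords[OF c(1) d(1)])
    have C: "prod_chart c d \<in> A" using c d unfolding prod_atlas_def by blast
    have W: "ricci (sqloc (prod_chart c d) F) x y = lam (cinv (prod_chart c d) x) * sqloc (prod_chart c d) F x y" if "(x, y) \<in> W.W" for x y
      using that by (intro lam[OF C]) (cases x; cases y, simp add: locdom_warped[OF c(1) d(1)] del: image_iff)
    have x: "cmap c p \<in> cimage c" "(cmap d q, y2) \<in> cimage d \<times> (- {0})" using c d y by auto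
    have inW: "((cmap c p, cmap d q), (y1, y2)) \<in> W.W" using x y by simp
    have ein: "ricci (sqloc (prod_chart c d) F) (x1, cmap d q) (y, y2)
       = lam (cinv c x1, q) * sqloc (prod_chart c d) F (x1, cmap d q) (y, y2)" if "x1 \<in> cimage c" "y \<noteq> 0" for x1 y
    proof -
      have "cinv (prod_chart c d) (x1, cmap d q) = (cinv c x1, q)"
        using cinv_prod[OF c(1) d(1) that(1)] d M2.cinv_cmap[OF d] by simp
      then show ?thesis using W[of "(x1, cmap d q)" "(y, y2)"] that x(2) by simp
    qed
    have ip: "cinv c (cmap c p) = p" by (rule M1.cinv_cmap[OF c])
    have "scalar_curv (sqloc c (riem_norm g1)) (cmap c p) y1 = ?m * lam (p, q) + ?n / f p * M1.hess_tr c f (cmap c p)"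
      using W.scalar_curv_base[OF ein x(1) y(1) x(2)] by (simp add: ip hess_tr_eq[OF c(1) d(1)])
    moreover have "ricci (sqloc d F2) (cmap d q) y2
        = (lam (p, q) * (f p)\<^sup>2 + f p * M1.hess_tr c f (cmap c p) + (?n - 1) * M1.grad2 c f p) * sqloc d F2 (cmap d q) y2"
      using W.einstein_split(2)[OF ein[OF x(1)] x(1) y(1) x(2)]
      by (simp add: ip hess_tr_eq[OF c(1) d(1)] grad2_eq[OF c(1) d(1) c(2)])
    moreover have "scalar_curv (sqloc (prod_chart c d) F) (cmap c p, cmap d q) (y1, y2) = (?m + ?n) * lam (p, q)"
      using W.scalar_curv_einstein[OF W inW] cinv_prod[OF c(1) d(1) x(1), of "cmap d q"] c d
      by (simp add: ip M2.cinv_cmap[OF d])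
    ultimately show ?thesis by blast
  qed
  obtain y1 :: 'e where y1: "y1 \<noteq> 0" using nonzero_Basis SOME_Basis by blast
  obtain y2 :: 'f where y2: "y2 \<noteq> 0" using nonzero_Basis SOME_Basis by blast
  \<comment> \<open>A reference point of the fibre, at which the Einstein factor is read off as a
    function of the base point.\<close>
  fix q0 :: 'b
  define l where "l p = lam (p, q0)" for p
  have lam_l: "lam (p, q) = l p" for p q
  proof -
    obtain c d d0 where "c \<in> A1" "p \<in> cdom c" "d \<in> A2" "q \<in> cdom d" "d0 \<in> A2" "q0 \<in> cdom d0"
      using M1.ex_chart M2.ex_chart by metis
    then have "?m * lam (p, q) = ?m * lam (p, q0)"
      using local[of c p d q y1 y2] local[of c p d0 q0 y1 y2] y1 y2 by simp
    then show ?thesis by (simp add: l_def)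
  qed
  define nu where "nu c p = l p * (f p)\<^sup>2 + f p * M1.hess_tr c f (cmap c p) + (?n - 1) * M1.grad2 c f p" for c p
  \<comment> \<open>Positivity allows F2 squared to be cancelled from two instances of the fibre
    equation.\<close>
  have L2: "sqloc d F2 (cmap d q) y > 0" if "d \<in> A2" "q \<in> cdom d" "y \<noteq> 0" for d q y
  proof -
    interpret C: finsler_coords "cimage d \<times> (- {0})" "sqloc d F2" by (rule M2.finsler_coords[OF finsler2 that(1)])
    show ?thesis using that by (intro C.L_pos) auto
  qed
  have ric2: "ricci (sqloc d F2) (cmap d q) y = nu c p * sqloc d F2 (cmap d q) y"
    if "c \<in> A1" "p \<in> cdom c" "d \<in> A2" "q \<in> cdom d" "y \<noteq> 0" for c d p q y
    using local[OF that(1-4) y1 that(5)] unfolding nu_def lam_l by blast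
  fix p0 :: 'a
  define \<mu> where "\<mu> = nu (chart_at A1 p0) p0"
  have nu_mu: "nu c p = \<mu>" if "c \<in> A1" "p \<in> cdom c" for c p
  proof -
    note d = M2.chart_at[of q0]
    show ?thesis
      using ric2[OF that d y2] ric2[OF M1.chart_at[of p0] d y2] L2[OF d y2] by (simp add: \<mu>_def)
  qed
  have sc2: "scalar_curv (sqloc d F2) (cmap d q) y = ?n * \<mu>" if d: "d \<in> A2" "q \<in> cdom d" and y: "y \<noteq> 0" for d q y
  proof -
    interpret C: finsler_coords "cimage d \<times> (- {0})" "sqloc d F2" by (rule M2.finsler_coords[OF finsler2 d(1)])
    show ?thesis
    proof (rule C.scalar_curv_einstein)
      fix x z assume xz: "(x, z) \<in> cimage d \<times> (- {0 :: 'f})"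
      then obtain q where "q \<in> cdom d" "x = cmap d q" "z \<noteq> 0" by auto
      then show "ricci (sqloc d F2) x z = \<mu> * sqloc d F2 x z"
        using ric2[OF M1.chart_at[of p0] d(1)] by (simp add: \<mu>_def)
    qed (use d y in auto)
  qed
  have dir1: "scal_dir A1 (riem_norm g1) p v = ?m * l p - ?n / f p * laplacian A1 g1 f p" if v: "v \<in> slit A1 p" for p v
  proof -
    note c = M1.chart_at[of p] and d = M2.chart_at[of q0]
    show ?thesis
      using local[OF c d M1.components_slit[OF c v] y2] by (simp add: scal_dir_def Let_def M1.laplacian_eq lam_l)
  qed
  have dir2: "scal_dir A2 F2 q v = ?n * \<mu>" if v: "v \<in> slit A2 q" for q v
    using sc2[OF M2.chart_at M2.components_slit[OF M2.chart_at v]] by (simp add: scal_dir_def Let_def)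
  have dir: "scal_dir A F (p, q) v = (?m + ?n) * l p" if v: "v \<in> D (p, q)" for p q v
  proof -
    let ?C = "chart_at A (p, q)"
    note C = MP.chart_at[of "(p, q)"]
    obtain c d y1 y2 where *: "?C = prod_chart c d" "c \<in> A1" "p \<in> cdom c" "d \<in> A2" "q \<in> cdom d"
      "y1 \<noteq> 0" "y2 \<noteq> 0" "v = tvec ?C (p, q) (y1, y2)" by (rule D_cases[OF v C])
    have "components ?C v = (y1, y2)" unfolding *(8) by (rule MP.components_tvec[OF C])
    then show ?thesis
      using local[OF *(2-7)] *(1) by (simp add: scal_dir_def Let_def lam_l)
  qed
  obtain v1 v2 where v12: "v1 \<in> slit A1 p0" "v2 \<in> slit A2 q0" using M1.ex_slit M2.ex_slit by blast
  have exD: "\<exists>v. v \<in> D (p, q)" for p q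
    using tvec_in_D[OF M1.chart_at M2.chart_at, of p q y1 y2] y1 y2 by blast
  show ?thesis
  proof (rule that[of l \<mu>])
    show "scal A1 (slit A1) (riem_norm g1) p = ?m * l p - ?n / f p * laplacian A1 g1 f p" for p
      using M1.ex_slit[of p] dir1 scal_eqI by metis
    show "scal A2 (slit A2) F2 q = ?n * \<mu>" for q
      using M2.ex_slit[of q] dir2 scal_eqI by metis
    show "scal A D F (p, q) = (?m + ?n) * l p" for p q
      using exD[of p q] dir scal_eqI by metis
    show "\<mu> = l p * (f p)\<^sup>2 + f p * M1.hess_tr c f (cmap c p) + (?n - 1) * M1.grad2 c f p"
      if "c \<in> A1" "p \<in> cdom c" for c p
      using nu_mu[OF that] by (simp add: nu_def)
    show "\<mu> > 0" if "positive_scal_on A2 (slit A2) F2"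
      using that dir2[OF v12(2)] v12(2) unfolding positive_scal_on_def by (metis of_nat_0_less_iff DIM_positive zero_less_mult_pos)
    show "l p > 0" if "positive_scal_on A D F" for p
    proof -
      obtain v where "v \<in> D (p, q0)" using exD by blast
      then have "(?m + ?n) * l p > 0" using that dir unfolding positive_scal_on_def by metis
      then show ?thesis by (simp add: zero_less_mult_iff not_less[symmetric])
    qed
  qed
qed

end

text \<open>Here \<open>\<Delta>\<close> and \<open>N\<close> stand for the Laplacian of \<open>f\<close> and the squared norm of its gradient, \<open>l\<close> and
  \<open>\<mu>\<close> for the Einstein factors of the product and of the fibre.\<close>

lemma laplacian_sign:
  fixes m n :: real and f \<Delta> N l :: "'a \<Rightarrow> real"
  assumes m: "m \<ge> 2" and n: "n \<ge> 2" and f: "\<And>p. f p > 0" and l: "\<And>p. l p > 0" and \<mu>: "\<mu> > 0" and N: "\<And>p. N p \<ge> 0"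
    and eq: "\<And>p. \<mu> = l p * (f p)\<^sup>2 - f p * \<Delta> p + (n - 1) * N p"
    and harmonic: "(\<And>p. N p = 0) \<Longrightarrow> (\<And>p. \<Delta> p = 0)"
    and cases: "(\<forall>p. sqrt (N p) \<ge> sqrt (n * \<mu> / (n * (n - 1))))
      \<or> (\<forall>p. (m + n) * l p \<le> m * l p - n / f p * \<Delta> p)
      \<or> (\<forall>p. (m + n) * l p - n * \<mu> \<ge> m * l p - n / f p * \<Delta> p) \<and> (\<forall>p. n * \<mu> / ((m + n) * l p) \<ge> n / (m + n))
      \<or> (\<forall>p. (m + n) * l p - n * \<mu> / (f p)\<^sup>2 \<ge> m * l p - n / f p * \<Delta> p)
      \<or> (\<forall>p. m * l p - n / f p * \<Delta> p \<le> 0)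
      \<or> (\<forall>p. m * l p - n / f p * \<Delta> p \<ge> m * (n * \<mu>) / (n * (f p)\<^sup>2))"
  shows "(\<forall>p. \<Delta> p \<ge> 0) \<or> (\<forall>p. \<Delta> p \<le> 0)"
proof -
  have nonneg: "\<Delta> p \<ge> 0" if "f p * \<Delta> p \<ge> 0" for p using that f[of p] by (simp add: zero_le_mult_iff)
  have nonpos: "\<Delta> p \<le> 0" if "f p * \<Delta> p \<le> 0" for p using that f[of p] by (simp add: mult_le_0_iff)
  have f2: "(f p)\<^sup>2 * (n / f p * \<Delta> p) = n * (f p * \<Delta> p)" for p using f[of p] by (simp add: power2_eq_square)
  have f2p: "(f p)\<^sup>2 > 0" for p using f[of p] by simp
  have nN: "(n - 1) * N p \<ge> 0" for p using n N by simp
  from cases show ?thesis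
  proof (elim disjE conjE)
    \<comment> \<open>The gradient term alone reaches mu, so f times the Laplacian must compensate
      the positive term l f^2.\<close>
    assume *: "\<forall>p. sqrt (N p) \<ge> sqrt (n * \<mu> / (n * (n - 1)))"
    have "\<Delta> p \<ge> 0" for p
    proof (rule nonneg)
      have "N p \<ge> n * \<mu> / (n * (n - 1))" using * by simp
      then have "N p \<ge> \<mu> / (n - 1)" using n by simp
      then have "(n - 1) * N p \<ge> \<mu>" using n by (simp add: pos_divide_le_eq mult.commute)
      moreover have "l p * (f p)\<^sup>2 > 0" using l f2p by simp
      ultimately show "f p * \<Delta> p \<ge> 0" using eq[of p] by linarith
    qed
    then show ?thesis by blast
  next
    assume *: "\<forall>p. (m + n) * l p \<le> m * l p - n / f p * \<Delta> p"
    have "\<Delta> p \<le> 0" for p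
    proof (rule nonpos)
      have "n / f p * \<Delta> p \<le> - (n * l p)" using *[rule_format, of p] by (simp add: algebra_simps)
      also have "\<dots> \<le> 0" using n l[of p] by simp
      finally have "(f p)\<^sup>2 * (n / f p * \<Delta> p) \<le> 0" by (rule mult_nonneg_nonpos[OF less_imp_le[OF f2p]])
      then show "f p * \<Delta> p \<le> 0" unfolding f2 using n by (simp add: mult_le_0_iff)
    qed
    then show ?thesis by blast
  next
    \<comment> \<open>The quotient condition says l <= mu; the other one gives n Delta / f >= n (mu
      - l).\<close>
    assume *: "\<forall>p. (m + n) * l p - n * \<mu> \<ge> m * l p - n / f p * \<Delta> p" and **: "\<forall>p. n * \<mu> / ((m + n) * l p) \<ge> n / (m + n)"
    have "\<Delta> p \<ge> 0" for p
    proof (rule nonneg)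
      have "n / (m + n) * l p \<le> n * \<mu> / ((m + n) * l p) * l p"
        using **[rule_format, of p] l[of p] by (intro mult_right_mono) auto
      also have "\<dots> = n / (m + n) * \<mu>" using l[of p] by simp
      finally have "l p \<le> \<mu>" using m n by (simp add: divide_simps)
      then have "n * (l p - \<mu>) \<le> 0" using n by (simp add: mult_le_0_iff)
      moreover have "n * (l p - \<mu>) \<ge> - (n / f p * \<Delta> p)" using *[rule_format, of p] by (simp add: algebra_simps)
      ultimately have "n / f p * \<Delta> p \<ge> 0" by linarith
      then have "(f p)\<^sup>2 * (n / f p * \<Delta> p) \<ge> 0" by (rule mult_nonneg_nonneg[OF less_imp_le[OF f2p]])
      then show "f p * \<Delta> p \<ge> 0" unfolding f2 using n by (simp add: zero_le_mult_iff)
    qed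
    then show ?thesis by blast
  next
    \<comment> \<open>After multiplication by f^2 / n the condition reads l f^2 - mu >= - f Delta.
      The fibre equation says l f^2 - mu = f Delta - (n - 1) N, so 2 f Delta >= (n - 1) N.\<close>
    assume *: "\<forall>p. (m + n) * l p - n * \<mu> / (f p)\<^sup>2 \<ge> m * l p - n / f p * \<Delta> p"
    have "\<Delta> p \<ge> 0" for p
    proof (rule nonneg)
      have "n * l p - n * \<mu> / (f p)\<^sup>2 \<ge> - (n / f p * \<Delta> p)" using *[rule_format, of p] by (simp add: algebra_simps)
      then have "(f p)\<^sup>2 * (n * l p - n * \<mu> / (f p)\<^sup>2) \<ge> (f p)\<^sup>2 * (- (n / f p * \<Delta> p))"
        using f2p[of p] by (intro mult_left_mono) auto
      moreover have "(f p)\<^sup>2 * (n * l p - n * \<mu> / (f p)\<^sup>2) = n * (l p * (f p)\<^sup>2 - \<mu>)"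
        using f2p[of p] by (simp add: field_simps)
      ultimately have "n * (l p * (f p)\<^sup>2 - \<mu>) \<ge> n * (- (f p * \<Delta> p))"
        using f2[of p] by simp
      then have "l p * (f p)\<^sup>2 - \<mu> \<ge> - (f p * \<Delta> p)"
        by (rule mult_left_le_imp_le) (use n in simp)
      then show "f p * \<Delta> p \<ge> 0" using eq[of p] nN[of p] by linarith
    qed
    then show ?thesis by blast
  next
    assume *: "\<forall>p. m * l p - n / f p * \<Delta> p \<le> 0"
    have "\<Delta> p \<ge> 0" for p
    proof (rule nonneg)
      have "m * l p > 0" using m l[of p] by simp
      then have "n / f p * \<Delta> p \<ge> 0" using *[rule_format, of p] by linarith
      then have "(f p)\<^sup>2 * (n / f p * \<Delta> p) \<ge> 0" by (rule mult_nonneg_nonneg[OF less_imp_le[OF f2p]])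
      then show "f p * \<Delta> p \<ge> 0" unfolding f2 using n by (simp add: zero_le_mult_iff)
    qed
    then show ?thesis by blast
  next
    assume *: "\<forall>p. m * l p - n / f p * \<Delta> p \<ge> m * (n * \<mu>) / (n * (f p)\<^sup>2)"
    \<comment> \<open>The condition times f^2 is m l f^2 - n f Delta >= m mu. Substituting m times
      the fibre equation cancels m l f^2 and leaves the difference of the dimensions as a
      factor.\<close>
    have key: "(m - n) * (f p * \<Delta> p) \<ge> m * ((n - 1) * N p)" for p
    proof -
      have "(f p)\<^sup>2 * (m * l p - n / f p * \<Delta> p) \<ge> (f p)\<^sup>2 * (m * (n * \<mu>) / (n * (f p)\<^sup>2))"
        using *[rule_format, of p] f2p[of p] by (intro mult_left_mono) auto
      moreover have "(f p)\<^sup>2 * (m * (n * \<mu>) / (n * (f p)\<^sup>2)) = m * \<mu>" using f[of p] n by simp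
      moreover have "(f p)\<^sup>2 * (m * l p - n / f p * \<Delta> p) = m * (l p * (f p)\<^sup>2) - n * (f p * \<Delta> p)"
        unfolding right_diff_distrib f2 by simp
      ultimately have 1: "m * (l p * (f p)\<^sup>2) - n * (f p * \<Delta> p) \<ge> m * \<mu>" by simp
      have "m * \<mu> = m * (l p * (f p)\<^sup>2) - m * (f p * \<Delta> p) + m * ((n - 1) * N p)"
        by (subst eq[of p]) (simp only: distrib_left right_diff_distrib)
      then show ?thesis using 1 unfolding left_diff_distrib by linarith
    qed
    have key0: "(m - n) * (f p * \<Delta> p) \<ge> 0" for p
      using key[of p] nN[of p] m by (smt (verit) mult_nonneg_nonneg)
    consider "m > n" | "m < n" | "m = n" by linarith
    then show ?thesis
    proof cases
      case 1
      then have "\<Delta> p \<ge> 0" for p using key0[of p] by (intro nonneg) (simp add: zero_le_mult_iff)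
      then show ?thesis by blast
    next
      case 2
      then have "\<Delta> p \<le> 0" for p using key0[of p] by (intro nonpos) (simp add: zero_le_mult_iff)
      then show ?thesis by blast
    next
      case 3
      have "N p = 0" for p
      proof -
        have "m * ((n - 1) * N p) \<le> 0" using key[of p] 3 by simp
        then have "N p \<le> 0" using m n by (simp add: mult_le_0_iff)
        then show ?thesis using N[of p] by simp
      qed
      then show ?thesis using harmonic by simp
    qed
  qed
qed

text \<open>The Laplacian is minus the trace of the Hessian, so a maximum goes with a nonpositive
  Laplacian and a minimum with a nonnegative one. With the opposite extremum the sign by itself does
  not force constancy, as 1 + |x|^2 on Euclidean space shows. On a compact base both extrema exist,
  so the matching one is available.\<close>

theorem theorem13:
  fixes A1 :: "('a::{t2_space,second_countable_topology}, 'e::euclidean_space) chart set"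
    and A2 :: "('b::{t2_space,second_countable_topology}, 'f::euclidean_space) chart set"
    and g1 :: "'a \<Rightarrow> 'a tvec \<Rightarrow> 'a tvec \<Rightarrow> real"
    and F2 :: "'b \<Rightarrow> 'b tvec \<Rightarrow> real"
    and f :: "'a \<Rightarrow> real"
    and n1 n2 :: real
    and A :: "('a \<times> 'b, 'e \<times> 'f) chart set"
    and D :: "'a \<times> 'b \<Rightarrow> ('a \<times> 'b) tvec set"
    and F :: "'a \<times> 'b \<Rightarrow> ('a \<times> 'b) tvec \<Rightarrow> real"
    and S1 :: "'a \<Rightarrow> real" and S2 :: "'b \<Rightarrow> real" and S :: "'a \<times> 'b \<Rightarrow> real"
  defines "n1 \<equiv> real DIM('e)" and "n2 \<equiv> real DIM('f)"
    and "A \<equiv> prod_atlas A1 A2"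
    and "D \<equiv> warped_dom A1 A2"
    and "F \<equiv> warped_metric (riem_norm g1) F2 f"
    and "S1 \<equiv> scal A1 (slit A1) (riem_norm g1)"
    and "S2 \<equiv> scal A2 (slit A2) F2"
    and "S \<equiv> scal A D F"
  assumes "DIM('e) \<ge> 2" and "DIM('f) \<ge> 2"
    and "smooth_manifold A1" and "riemannian_metric A1 g1"
    and "smooth_manifold A2" and "finsler_metric_on A2 (slit A2) F2"
    and "weakly_berwald_on A2 (slit A2) F2" and "positive_scal_on A2 (slit A2) F2"
    and "smooth_fun A1 f" and "\<forall>p. f p > 0"
    and "einstein_on A D F" and "positive_scal_on A D F"
    and conditions:
      "(\<exists>q. \<forall>p. riem_norm g1 p (gradient A1 g1 f p) \<ge> sqrt (S2 q / (n2 * (n2 - 1))))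
       \<or> (\<forall>p q. S (p, q) \<le> S1 p)
       \<or> ((\<forall>p q. S (p, q) - S2 q \<ge> S1 p) \<and> (\<forall>p q. S2 q / S (p, q) \<ge> n2 / (n1 + n2)))
       \<or> (\<forall>p q. S (p, q) - S2 q / (f p)\<^sup>2 \<ge> S1 p)
       \<or> (\<forall>p. S1 p \<le> 0)
       \<or> (\<forall>p q. S1 p \<ge> n1 * S2 q / (n2 * (f p)\<^sup>2))"
  shows "((\<forall>p. laplacian A1 g1 f p \<ge> 0) \<or> (\<forall>p. laplacian A1 g1 f p \<le> 0)) \<and>
    (compact (UNIV :: 'a set)
       \<or> (\<forall>p. laplacian A1 g1 f p \<le> 0) \<and> (\<exists>p0. \<forall>p. f p \<le> f p0)
       \<or> (\<forall>p. laplacian A1 g1 f p \<ge> 0) \<and> (\<exists>p0. \<forall>p. f p0 \<le> f p)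
     \<longrightarrow> (\<exists>r. \<forall>p. f p = r) \<and>
         smooth_manifold A \<and> finsler_metric_on A D F \<and> weakly_berwald_on A D F \<and>
         riemannian_product A1 (riem_norm g1) A2 F2 f)"
proof -
  interpret P: warped_product A1 g1 A2 F2 f
    by unfold_locales (use assms in auto)
  note folds = A_def[symmetric] D_def[symmetric] F_def[symmetric]
  obtain l \<mu> where S1: "\<And>p. S1 p = n1 * l p - n2 / f p * laplacian A1 g1 f p"
    and S2: "\<And>q. S2 q = n2 * \<mu>" and S: "\<And>p q. S (p, q) = (n1 + n2) * l p"
    and eq: "\<And>c p. c \<in> A1 \<Longrightarrow> p \<in> cdom c \<Longrightarrow>
      \<mu> = l p * (f p)\<^sup>2 + f p * P.M1.hess_tr c f (cmap c p) + (n2 - 1) * P.M1.grad2 c f p"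
    and \<mu>: "\<mu> > 0" and l: "\<And>p. l p > 0"
  proof (rule P.einstein_reduction)
    show "einstein_on P.A P.D P.F" using assms by simp
    fix l \<mu>
    assume "\<And>p. scal A1 (slit A1) (riem_norm g1) p = real DIM('e) * l p - real DIM('f) / f p * laplacian A1 g1 f p"
      "\<And>q. scal A2 (slit A2) F2 q = real DIM('f) * \<mu>" "\<And>p q. scal P.A P.D P.F (p, q) = (real DIM('e) + real DIM('f)) * l p"
      "\<And>c p. c \<in> A1 \<Longrightarrow> p \<in> cdom c \<Longrightarrow>
        \<mu> = l p * (f p)\<^sup>2 + f p * P.M1.hess_tr c f (cmap c p) + (real DIM('f) - 1) * P.M1.grad2 c f p"
      "positive_scal_on A2 (slit A2) F2 \<Longrightarrow> \<mu> > 0" "\<And>p. positive_scal_on P.A P.D P.F \<Longrightarrow> l p > 0"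
    then show thesis
      using assms by (intro that[of l \<mu>]) (auto simp: S1_def S2_def S_def n1_def n2_def A_def D_def F_def)
  qed
  define N where "N p = (riem_norm g1 p (gradient A1 g1 f p))\<^sup>2" for p
  have sqrtN: "riem_norm g1 p (gradient A1 g1 f p) = sqrt (N p)" for p
    using P.M1.riem_norm_gradient(2)[of p f] by (simp add: N_def)
  have N: "P.M1.grad2 c f p = N p" if "c \<in> A1" "p \<in> cdom c" for c p
    unfolding N_def P.M1.riem_norm_gradient(1)
    by (rule P.M1.grad2_chart_independent[OF assms(17) that P.M1.chart_at])
  \<comment> \<open>Chart independence is read off from the fibre equation: in any two charts
    \<open>eq\<close> holds with the same mu, l, f and gradient norm, so the one remaining term
    agrees as well.\<close>
  have hess: "P.M1.hess_tr c f (cmap c p) = - laplacian A1 g1 f p" if "c \<in> A1" "p \<in> cdom c" for c p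
  proof -
    note c0 = P.M1.chart_at[of p]
    have "f p * P.M1.hess_tr c f (cmap c p) = f p * P.M1.hess_tr (chart_at A1 p) f (cmap (chart_at A1 p) p)"
      using eq[OF that, unfolded N[OF that]] eq[OF c0, unfolded N[OF c0]] by linarith
    then show ?thesis using P.f_pos[of p] by (simp add: P.M1.laplacian_eq)
  qed
  have sign: "(\<forall>p. laplacian A1 g1 f p \<ge> 0) \<or> (\<forall>p. laplacian A1 g1 f p \<le> 0)"
  proof (rule laplacian_sign[of n1 n2 f l \<mu> N])
    show "n1 \<ge> 2" "n2 \<ge> 2" using assms by simp_all
    show "N p \<ge> 0" for p by (simp add: N_def)
    show "\<mu> = l p * (f p)\<^sup>2 - f p * laplacian A1 g1 f p + (n2 - 1) * N p" for p
      using eq[OF P.M1.chart_at] hess[OF P.M1.chart_at] N[OF P.M1.chart_at] by simp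
    show "laplacian A1 g1 f p = 0" if "\<And>p. N p = 0" for p
    proof -
      note c0 = P.M1.chart_at[of p]
      have "P.M1.hess_tr (chart_at A1 p) f (cmap (chart_at A1 p) p) = 0"
        by (rule P.hess_tr_zero[OF _ c0(1)]) (use N that c0 in auto)
      then show ?thesis by (simp add: P.M1.laplacian_eq)
    qed
    show "(\<forall>p. sqrt (N p) \<ge> sqrt (n2 * \<mu> / (n2 * (n2 - 1))))
      \<or> (\<forall>p. (n1 + n2) * l p \<le> n1 * l p - n2 / f p * laplacian A1 g1 f p)
      \<or> (\<forall>p. (n1 + n2) * l p - n2 * \<mu> \<ge> n1 * l p - n2 / f p * laplacian A1 g1 f p)
        \<and> (\<forall>p. n2 * \<mu> / ((n1 + n2) * l p) \<ge> n2 / (n1 + n2))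
      \<or> (\<forall>p. (n1 + n2) * l p - n2 * \<mu> / (f p)\<^sup>2 \<ge> n1 * l p - n2 / f p * laplacian A1 g1 f p)
      \<or> (\<forall>p. n1 * l p - n2 / f p * laplacian A1 g1 f p \<le> 0)
      \<or> (\<forall>p. n1 * l p - n2 / f p * laplacian A1 g1 f p \<ge> n1 * (n2 * \<mu>) / (n2 * (f p)\<^sup>2))"
      using conditions unfolding S1 S2 S sqrtN by simp
  qed (use P.f_pos l \<mu> in auto)
  \<comment> \<open>Carries the sign of the Laplacian to all points of every chart, as the maximum
    principle requires.\<close>
  have hess_x: "P.M1.hess_tr c f x = - laplacian A1 g1 f (cinv c x)" if "c \<in> A1" "x \<in> cimage c" for c x
    using hess[OF that(1) P.M1.cinv_in[OF that]] by (simp only: P.M1.cmap_cinv[OF that])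
  have at_max: "\<exists>r. \<forall>p. f p = r" if "\<forall>p. laplacian A1 g1 f p \<le> 0" "\<forall>p. f p \<le> f p0" for p0
  proof -
    have "P.M1.hess_tr c f x \<ge> 0" if "c \<in> A1" "x \<in> cimage c" for c x
      using hess_x[OF that] \<open>\<forall>p. laplacian A1 g1 f p \<le> 0\<close> by simp
    then have "f p = f p0" for p
      by (rule P.M1.subharmonic_max_constant[OF P.smooth_f]) (use that in auto)
    then show ?thesis by blast
  qed
  have at_min: "\<exists>r. \<forall>p. f p = r" if "\<forall>p. laplacian A1 g1 f p \<ge> 0" "\<forall>p. f p0 \<le> f p" for p0
  proof -
    \<comment> \<open>A minimum of f is a maximum of - f, whose Hessian has the opposite
      trace.\<close>
    have "P.M1.hess_tr c (\<lambda>p. - f p) x \<ge> 0" if "c \<in> A1" "x \<in> cimage c" for c x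
      using hess_x[OF that] P.M1.hess_tr_minus[OF that P.smooth_f] \<open>\<forall>p. laplacian A1 g1 f p \<ge> 0\<close> by simp
    then have "- f p = - f p0" for p
      by (rule P.M1.subharmonic_max_constant[OF P.M1.smooth_fun_minus[OF P.smooth_f]]) (use that in auto)
    then show ?thesis by auto
  qed
  have const: "\<exists>r. \<forall>p. f p = r" if "compact (UNIV :: 'a set)
       \<or> (\<forall>p. laplacian A1 g1 f p \<le> 0) \<and> (\<exists>p0. \<forall>p. f p \<le> f p0)
       \<or> (\<forall>p. laplacian A1 g1 f p \<ge> 0) \<and> (\<exists>p0. \<forall>p. f p0 \<le> f p)"
    using that
  proof (elim disjE)
    assume c: "compact (UNIV :: 'a set)"
    note cont = P.M1.smooth_fun_continuous[OF P.smooth_f]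
    have "\<exists>p0. \<forall>p. f p \<le> f p0" using continuous_attains_sup[OF c _ cont] by auto
    moreover have "\<exists>p0. \<forall>p. f p0 \<le> f p" using continuous_attains_inf[OF c _ cont] by auto
    ultimately show ?thesis using sign at_max at_min by blast
  qed (use at_max at_min in blast)+
  have "riemannian_product A1 (riem_norm g1) A2 F2 f" if "\<exists>r. \<forall>p. f p = r"
    unfolding riemannian_product_def using assms P.M1.finsler_riem_norm P.f_pos that by metis
  then show ?thesis
    using sign const P.prod_manifold P.finsler_warped P.weakly_berwald_warped[OF assms(15)]
    unfolding A_def D_def F_def by blast
qed

end
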